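(* Let $\rho_0\in C^\infty([0,1])$ satisfy $\min\rho_0>0$ and $\min\rho_0'>0$, let $g,\mu>0$ and let $k>0$ be fixed. Define $$\sigma_c:=\sup_{0\ne\vartheta\in H_0^1(I)}\frac{g\int_I\rho_0'\vartheta^2}{\int_I(\rho_0')^2(\vartheta')^2},\qquad \sigma_c(k):=\sup_{0\ne\vartheta\in H_0^1(I)}\frac{g\int_I\rho_0'\vartheta^2}{\int_I(\rho_0')^2\big(k^2\vartheta^2+(\vartheta')^2\big)} .$$ Then $\sigma_c(k)\in(0,\sigma_c)$, and for all $0<\sigma<\sigma_c(k)$ there exists a finite sequence of real characteristic values $$+\infty>\lambda_1(k,\sigma)>\lambda_2(k,\sigma)>\dots>\lambda_N(k,\sigma)>0$$ such that for each $1\le j\le N$ there is a nontrivial smooth solution $\phi_j\in H_0^2(I)\cap\bigcap_{s\ge0}H^s(I)$ of the boundary value problem $$\lambda^2\big(k^2\rho_0\phi-(\rho_0\phi')'\big)+\lambda\mu\big(\phi^{(4)}-2k^2\phi''+k^4\phi\big)=gk^2\rho_0'\phi+\sigma k^2\big((\rho_0')^2\phi'\big)'-\sigma k^4(\rho_0')^2\phi\quad\text{in }(0,1),$$ $$\phi(0)=\phi'(0)=0,\qquad \phi(1)=\phi'(1)=0,$$ with $\lambda=\lambda_j(k,\sigma)$.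
   Context: $I=(0,1)$ and $'=d/dx_3$. The parameters $g$, $\mu$, $\sigma>0$ are the gravity, viscosity and capillarity constants. A characteristic value is a number $\lambda\in\mathbb C$ with $\operatorname{Re}\lambda>0$ for which the displayed fourth-order boundary value problem has a nontrivial solution. All functions are real-valued. *)

theory Defs
  imports "HOL-Analysis.Analysis"
begin

abbreviation I01 :: "real set" where
  "I01 \<equiv> {0<..<1}"

abbreviation leb_I :: "real measure" where
  "leb_I \<equiv> lebesgue_on I01"

subsection \<open>Classical derivatives on the closed unit interval\<close>

text \<open>The derivative is one-sided at the end points, so on \<open>{0..1}\<close> it only depends on the values
  of the function on \<open>{0..1}\<close>; it is used there only.\<close>

definition D :: "(real \<Rightarrow> real) \<Rightarrow> real \<Rightarrow> real" where
  "D f x = vector_derivative f (at x within {0..1})"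

definition Ck_I :: "nat \<Rightarrow> (real \<Rightarrow> real) set" where
  "Ck_I n = {f. (\<forall>j<n. \<forall>x\<in>{0..1}. (D ^^ j) f differentiable (at x within {0..1}))
              \<and> continuous_on {0..1} ((D ^^ n) f)}"

definition Cinf_I :: "(real \<Rightarrow> real) set" where
  "Cinf_I = (\<Inter>n. Ck_I n)"

subsection \<open>Sobolev spaces on the open unit interval\<close>

text \<open>Elements of \<open>L\<^sup>2\<close> and of the Sobolev spaces are represented by functions on the real line; only their
  values almost everywhere on the open unit interval matter.\<close>

definition L2_I :: "(real \<Rightarrow> real) set" where
  "L2_I = {u \<in> borel_measurable leb_I. integrable leb_I (\<lambda>x. (u x)\<^sup>2)}"

definition test_fun :: "(real \<Rightarrow> real) set" where
  "test_fun = {\<psi>. (\<forall>n x. (deriv ^^ n) \<psi> field_differentiable (at x))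
                \<and> (\<exists>K. compact K \<and> K \<subseteq> I01 \<and> (\<forall>x. x \<notin> K \<longrightarrow> \<psi> x = 0))}"

definition has_weak_deriv :: "nat \<Rightarrow> (real \<Rightarrow> real) \<Rightarrow> (real \<Rightarrow> real) \<Rightarrow> bool" where
  "has_weak_deriv n u v \<longleftrightarrow> u \<in> L2_I \<and> v \<in> L2_I \<and>
     (\<forall>\<psi>\<in>test_fun. (LINT x|leb_I. u x * (deriv ^^ n) \<psi> x) = (-1) ^ n * (LINT x|leb_I. v x * \<psi> x))"

text \<open>An arbitrary representative; weak derivatives are unique up to null sets.\<close>

definition weak_deriv :: "nat \<Rightarrow> (real \<Rightarrow> real) \<Rightarrow> real \<Rightarrow> real" where
  "weak_deriv n u = (SOME v. has_weak_deriv n u v)"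

text \<open>The square of the Gagliardo (Sobolev--Slobodeckij) seminorm of order \<open>\<theta> \<in> (0,1)\<close>.\<close>

definition gagliardo :: "real \<Rightarrow> (real \<Rightarrow> real) \<Rightarrow> ennreal" where
  "gagliardo \<theta> v =
     (\<integral>\<^sup>+ x. (\<integral>\<^sup>+ y. ennreal ((v x - v y)\<^sup>2 / \<bar>x - y\<bar> powr (1 + 2 * \<theta>)) \<partial>leb_I) \<partial>leb_I)"

text \<open>\<open>H\<^sup>s\<close> for real \<open>s \<ge> 0\<close>: the integer-order space of order \<open>\<lfloor>s\<rfloor>\<close>, together with finiteness of the
  Gagliardo seminorm of the highest derivative if \<open>s\<close> is not an integer.\<close>

definition H :: "real \<Rightarrow> (real \<Rightarrow> real) set" where
  "H s = {u. u \<in> L2_I \<and> (\<forall>j\<le>nat \<lfloor>s\<rfloor>. \<exists>v. has_weak_deriv j u v)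
           \<and> (frac s \<noteq> 0 \<longrightarrow> gagliardo (frac s) (weak_deriv (nat \<lfloor>s\<rfloor>) u) < \<infinity>)}"

text \<open>The closure of the test functions in \<open>H\<^sup>m\<close>.\<close>

definition H0 :: "nat \<Rightarrow> (real \<Rightarrow> real) set" where
  "H0 m = {u \<in> H (real m). \<exists>\<psi>. (\<forall>n. \<psi> n \<in> test_fun) \<and>
     (\<forall>j\<le>m. (\<lambda>n. LINT x|leb_I. (weak_deriv j u x - (deriv ^^ j) (\<psi> n) x)\<^sup>2) \<longlonglongrightarrow> 0)}"

definition H01_nonzero :: "(real \<Rightarrow> real) set" where
  "H01_nonzero = {\<theta> \<in> H0 1. \<not> (AE x in leb_I. \<theta> x = 0)}"

subsection \<open>Critical capillarity constants and characteristic values\<close>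

text \<open>The suprema are taken in the extended reals, so that no boundedness is presupposed.\<close>

definition sigma_c :: "real \<Rightarrow> (real \<Rightarrow> real) \<Rightarrow> ereal" where
  "sigma_c g \<rho> = (SUP \<theta>\<in>H01_nonzero. ereal
     (g * (LINT x|leb_I. D \<rho> x * (\<theta> x)\<^sup>2)
      / (LINT x|leb_I. (D \<rho> x)\<^sup>2 * (weak_deriv 1 \<theta> x)\<^sup>2)))"

definition sigma_c_at :: "real \<Rightarrow> (real \<Rightarrow> real) \<Rightarrow> real \<Rightarrow> ereal" where
  "sigma_c_at g \<rho> k = (SUP \<theta>\<in>H01_nonzero. ereal
     (g * (LINT x|leb_I. D \<rho> x * (\<theta> x)\<^sup>2)
      / (LINT x|leb_I. (D \<rho> x)\<^sup>2 * (k\<^sup>2 * (\<theta> x)\<^sup>2 + (weak_deriv 1 \<theta> x)\<^sup>2))))"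

text \<open>A classical real-valued solution for the complex parameter \<open>l\<close>.\<close>

definition bvp_solution ::
  "real \<Rightarrow> real \<Rightarrow> real \<Rightarrow> real \<Rightarrow> (real \<Rightarrow> real) \<Rightarrow> complex \<Rightarrow> (real \<Rightarrow> real) \<Rightarrow> bool" where
  "bvp_solution g \<mu> \<sigma> k \<rho> l \<phi> \<longleftrightarrow>
     \<phi> \<in> Ck_I 4 \<and>
     (\<forall>x\<in>I01.
        l\<^sup>2 * complex_of_real (k\<^sup>2 * \<rho> x * \<phi> x - D (\<lambda>y. \<rho> y * D \<phi> y) x)
        + l * complex_of_real (\<mu> * ((D ^^ 4) \<phi> x - 2 * k\<^sup>2 * (D ^^ 2) \<phi> x + k ^ 4 * \<phi> x))
        = complex_of_real (g * k\<^sup>2 * D \<rho> x * \<phi> x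
            + \<sigma> * k\<^sup>2 * D (\<lambda>y. (D \<rho> y)\<^sup>2 * D \<phi> y) x
            - \<sigma> * k ^ 4 * (D \<rho> x)\<^sup>2 * \<phi> x)) \<and>
     \<phi> 0 = 0 \<and> D \<phi> 0 = 0 \<and> \<phi> 1 = 0 \<and> D \<phi> 1 = 0"

definition nontrivial :: "(real \<Rightarrow> real) \<Rightarrow> bool" where
  "nontrivial \<phi> \<longleftrightarrow> (\<exists>x\<in>I01. \<phi> x \<noteq> 0)"

definition characteristic_value ::
  "real \<Rightarrow> real \<Rightarrow> real \<Rightarrow> real \<Rightarrow> (real \<Rightarrow> real) \<Rightarrow> complex \<Rightarrow> bool" where
  "characteristic_value g \<mu> \<sigma> k \<rho> l \<longleftrightarrow>
     Re l > 0 \<and> (\<exists>\<phi>. nontrivial \<phi> \<and> bvp_solution g \<mu> \<sigma> k \<rho> l \<phi>)"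

end

theory Submission imports Defs begin

text \<open>
  For the capillarity constants, \<open>a = g \<integral> \<rho>' \<theta>\<^sup>2\<close>, \<open>b = \<integral> \<rho>'\<^sup>2 \<theta>'\<^sup>2\<close> and the denominator \<open>c\<close> of the quotient for
  \<open>\<sigma>\<^sub>c(k)\<close> satisfy \<open>c \<ge> b + \<delta> a\<close> with \<open>\<delta> = k\<^sup>2 min \<rho>' / g\<close>, so \<open>a \<le> S b\<close> implies \<open>a / c \<le> S / (1 + \<delta> S) < S\<close>.

  Multiplying the equation by \<open>\<phi>\<close> gives, for real \<open>l\<close>, the quadratic form \<open>Q\<^sub>l = l\<^sup>2 A + l B - C\<close> on clamped functions.
  It is nonnegative for large \<open>l\<close>; if \<open>\<sigma> < \<sigma>\<^sub>c(k)\<close>, then \<open>C\<close> is positive at some test function, so \<open>Q\<^sub>l\<close> takes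
  negative values for small \<open>l > 0\<close>. Let \<open>l\<close> be the supremum of the parameters at which negative values occur;
  then \<open>Q\<^sub>l \<ge> 0\<close>. If the boundary value problem had only the trivial solution at \<open>l\<close>, then the inhomogeneous problem would be
  solvable with an \<open>L\<^sup>2\<close> bound, by linear algebra on the solutions of the initial value problem, and this makes \<open>Q\<^sub>l\<close>
  coercive without any compactness argument. Coercivity persists for slightly smaller parameters, a contradiction.
  So one characteristic value \<open>\<lambda>\<^sub>1\<close> exists, and the finite sequence of the theorem is taken to be this one value.
\<close>

subsection \<open>Smooth functions and cut-offs\<close>

text \<open>Nonnegativity of the form at the supremum does not by itself produce a null vector: its
  infimum over normalized functions could be zero without being attained. Solvability of the
  inhomogeneous problem takes the place of an embedding theorem. Shooting from 0 turns the two
  conditions at 1 into a 2 x 2 linear system, so uniqueness alone yields existence together with a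
  bound. A separate obstacle is that Sobolev membership is phrased through arbitrary representatives
  and limits of test functions. Classical derivatives must be identified with chosen weak ones,
  which needs the fundamental lemma of the calculus of variations, and clamped smooth functions must
  be approximated by compactly supported ones. Rescaled copies of one explicit smooth step serve
  both purposes.\<close>

primrec Cn_on :: "nat \<Rightarrow> real set \<Rightarrow> (real \<Rightarrow> real) \<Rightarrow> bool" where
  "Cn_on 0 S f \<longleftrightarrow> continuous_on S f"
| "Cn_on (Suc n) S f \<longleftrightarrow>
     (\<exists>f'. (\<forall>x\<in>S. (f has_real_derivative f' x) (at x within S)) \<and> Cn_on n S f')"

text \<open>Since the derivative is only required to exist, each closure property below is an
  induction on \<open>n\<close> that exhibits one derivative and never a formula for the iterates.
  Derivatives within \<open>S\<close> let one predicate serve \<open>{0..1}\<close>, with one-sided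
  derivatives at the ends, and \<open>UNIV\<close>.\<close>

lemma Cn_on_SucI:
  assumes "\<And>x. x \<in> S \<Longrightarrow> (f has_real_derivative f' x) (at x within S)" "Cn_on n S f'"
  shows "Cn_on (Suc n) S f"
  using assms by auto

declare Cn_on.simps(2) [simp del]

lemma Cn_on_cong:
  assumes "Cn_on n S f" "\<And>x. x \<in> S \<Longrightarrow> f x = g x"
  shows "Cn_on n S g"
proof (cases n)
  case 0
  then show ?thesis using assms continuous_on_cong[of S S f g] by simp
next
  case (Suc m)
  obtain f' where f': "\<And>x. x \<in> S \<Longrightarrow> (f has_real_derivative f' x) (at x within S)"
    and c: "Cn_on m S f'" using assms(1) unfolding Suc Cn_on.simps(2) by blast
  have "(g has_real_derivative f' x) (at x within S)" if "x \<in> S" for x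
    by (rule has_field_derivative_transform_within[OF f'[OF that] zero_less_one that]) (use assms(2) in auto)
  with c Suc show ?thesis by (auto intro: Cn_on_SucI)
qed

lemma Cn_on_continuous: "Cn_on n S f \<Longrightarrow> continuous_on S f"
  by (cases n) (auto intro: DERIV_continuous_on simp: Cn_on.simps(2))

lemma Cn_on_Suc_imp: "Cn_on (Suc n) S f \<Longrightarrow> Cn_on n S f"
proof (induction n arbitrary: f)
  case 0
  then show ?case using Cn_on_continuous[OF 0] by simp
next
  case (Suc n)
  then show ?case by (metis Cn_on.simps(2))
qed

lemma Cn_on_const [simp]: "Cn_on n S (\<lambda>x. c)"
proof (induction n arbitrary: c)
  case (Suc n)
  show ?case by (rule Cn_on_SucI[OF _ Suc[of 0]]) auto
qed auto

lemma Cn_on_add: "Cn_on n S f \<Longrightarrow> Cn_on n S g \<Longrightarrow> Cn_on n S (\<lambda>x. f x + g x)"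
proof (induction n arbitrary: f g)
  case (Suc n)
  obtain f' where f: "\<And>x. x \<in> S \<Longrightarrow> (f has_real_derivative f' x) (at x within S)" "Cn_on n S f'"
    using Suc.prems(1) unfolding Cn_on.simps(2) by blast
  obtain g' where g: "\<And>x. x \<in> S \<Longrightarrow> (g has_real_derivative g' x) (at x within S)" "Cn_on n S g'"
    using Suc.prems(2) unfolding Cn_on.simps(2) by blast
  show ?case by (rule Cn_on_SucI[OF DERIV_add[OF f(1) g(1)] Suc.IH[OF f(2) g(2)]])
qed (auto intro: continuous_intros)

lemma Cn_on_mult: "Cn_on n S f \<Longrightarrow> Cn_on n S g \<Longrightarrow> Cn_on n S (\<lambda>x. f x * g x)"
proof (induction n arbitrary: f g)
  case (Suc n)
  obtain f' where f: "\<And>x. x \<in> S \<Longrightarrow> (f has_real_derivative f' x) (at x within S)" "Cn_on n S f'"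
    using Suc.prems(1) unfolding Cn_on.simps(2) by blast
  obtain g' where g: "\<And>x. x \<in> S \<Longrightarrow> (g has_real_derivative g' x) (at x within S)" "Cn_on n S g'"
    using Suc.prems(2) unfolding Cn_on.simps(2) by blast
  have "((\<lambda>x. f x * g x) has_real_derivative f' x * g x + f x * g' x) (at x within S)" if "x \<in> S" for x
    using f(1)[OF that] g(1)[OF that] by (auto intro!: derivative_eq_intros)
  moreover have "Cn_on n S (\<lambda>x. f' x * g x + f x * g' x)"
    using Suc.IH Cn_on_Suc_imp[OF Suc.prems(1)] Cn_on_Suc_imp[OF Suc.prems(2)] f g by (intro Cn_on_add) auto
  ultimately show ?case by (rule Cn_on_SucI)
qed (auto intro: continuous_intros)

lemma Cn_on_cmult: "Cn_on n S f \<Longrightarrow> Cn_on n S (\<lambda>x. c * f x)"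
  by (rule Cn_on_mult) auto

lemma Cn_on_diff: "Cn_on n S f \<Longrightarrow> Cn_on n S g \<Longrightarrow> Cn_on n S (\<lambda>x. f x - g x)"
  using Cn_on_add[of n S f "\<lambda>x. (-1) * g x"] Cn_on_cmult[of n S g "-1"] by simp

text \<open>The derivative of 1/f is -f' (1/f)^2, so \<open>1 / f\<close> at order \<open>n\<close>
  and \<open>f'\<close> at order \<open>n\<close> give order \<open>Suc n\<close>. The induction
  keeps \<open>f\<close> fixed and asks for it at every order, hence the assumption for all
  \<open>n\<close>.\<close>

lemma Cn_on_inverse:
  assumes "\<And>n. Cn_on n S f" "\<And>x. x \<in> S \<Longrightarrow> f x \<noteq> 0"
  shows "Cn_on n S (\<lambda>x. 1 / f x)"
proof (induction n)
  case 0
  show ?case using Cn_on_continuous[OF assms(1)[of 0]] assms(2) by (auto intro!: continuous_intros)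
next
  case (Suc n)
  from assms(1)[of "Suc n"] obtain f' where f': "\<And>x. x \<in> S \<Longrightarrow> (f has_real_derivative f' x) (at x within S)"
    and c: "Cn_on n S f'" unfolding Cn_on.simps(2) by blast
  have "((\<lambda>x. 1 / f x) has_real_derivative ((-1) * f' x) * ((1 / f x) * (1 / f x))) (at x within S)" if "x \<in> S" for x
    using f'[OF that] assms(2)[OF that] by (auto intro!: derivative_eq_intros simp: field_simps)
  moreover have "Cn_on n S (\<lambda>x. ((-1) * f' x) * ((1 / f x) * (1 / f x)))"
    by (intro Cn_on_mult Suc Cn_on_cmult c)
  ultimately show ?case by (rule Cn_on_SucI)
qed

lemma Cn_on_affine: "Cn_on n UNIV f \<Longrightarrow> Cn_on n UNIV (\<lambda>x. f (a * x + b))"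
proof (induction n arbitrary: f)
  case 0
  then show ?case by (auto intro!: continuous_intros continuous_on_compose2[of UNIV f])
next
  case (Suc n)
  from Suc.prems obtain f' where d: "\<And>x. (f has_real_derivative f' x) (at x)" "Cn_on n UNIV f'"
    unfolding Cn_on.simps(2) by blast
  have "((\<lambda>x. f (a * x + b)) has_real_derivative a * f' (a * x + b)) (at x)" for x
    using DERIV_chain2[OF d(1) DERIV_add[OF DERIV_cmult[OF DERIV_ident] DERIV_const], of a b x] by (simp add: mult.commute)
  then show ?case by (rule Cn_on_SucI) (rule Cn_on_cmult[OF Suc.IH[OF d(2)]])
qed

lemma Cn_on_subset: "Cn_on n T f \<Longrightarrow> S \<subseteq> T \<Longrightarrow> Cn_on n S f"
proof (induction n arbitrary: f)
  case 0
  then show ?case by (auto intro: continuous_on_subset)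
next
  case (Suc n)
  obtain f' where f': "\<And>x. x \<in> T \<Longrightarrow> (f has_real_derivative f' x) (at x within T)" and c: "Cn_on n T f'"
    using Suc.prems(1) unfolding Cn_on.simps(2) by blast
  show ?case
    by (rule Cn_on_SucI[OF _ Suc.IH[OF c Suc.prems(2)]]) (use f' Suc.prems(2) in \<open>auto intro: DERIV_subset\<close>)
qed

text \<open>Regularity is local, and the line is covered by two open sets: the open interval, where
  the extension is \<open>f\<close>, and the points beyond \<delta> or 1 - \<delta>, where it is
  zero.\<close>

lemma Cn_on_extend_zero:
  assumes "0 < \<delta>" "Cn_on n {0..1} f" "\<And>x. x \<in> {0..1} \<Longrightarrow> x < \<delta> \<or> 1 - \<delta> < x \<Longrightarrow> f x = 0"
  shows "Cn_on n UNIV (\<lambda>x. if x \<in> {0..1} then f x else 0)"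
  using assms(2,3)
proof (induction n arbitrary: f)
  case 0
  let ?g = "\<lambda>x. if x \<in> {0..1} then f x else 0"
  have "continuous (at x) ?g" for x
  proof -
    consider "x \<in> {0<..<1}" | "x \<in> {..<\<delta>} \<union> {1 - \<delta><..}" using \<open>0 < \<delta>\<close> by (cases "x \<in> {0<..<1}") auto
    then show ?thesis
    proof cases
      case 1
      have "continuous_on {0<..<1} f" using 0 by (auto intro: continuous_on_subset)
      then have "continuous_on {0<..<1} ?g" by (rule continuous_on_eq) auto
      then show ?thesis using 1 by (simp add: continuous_on_eq_continuous_at)
    next
      case 2
      have "continuous_on ({..<\<delta>} \<union> {1 - \<delta><..}) ?g"
        by (rule continuous_on_eq[of _ "\<lambda>x. 0"]) (use 0 in auto)
      then show ?thesis using 2 by (subst (asm) continuous_on_eq_continuous_at) auto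
    qed
  qed
  then show ?case by (simp add: continuous_on_eq_continuous_within)
next
  case (Suc n)
  let ?g = "\<lambda>x. if x \<in> {0..1} then f x else 0"
  obtain f' where f': "\<And>x. x \<in> {0..1} \<Longrightarrow> (f has_real_derivative f' x) (at x within {0..1})"
    and c: "Cn_on n {0..1} f'" using Suc.prems(1) unfolding Cn_on.simps(2) by blast
  let ?S = "{..<\<delta>} \<union> {1 - \<delta><..}"
  have zero: "(?g has_real_derivative 0) (at x)" if "x \<in> ?S" for x
    by (rule has_field_derivative_transform_within_open[of "\<lambda>x. 0" _ _ ?S]) (use that Suc.prems in auto)
  \<comment> \<open>The derivative inherits the vanishing near the ends, so the induction hypothesis
    applies to it. At 0 and 1 this rests on uniqueness of the one-sided derivative.\<close>
  have f'0: "f' x = 0" if x: "x \<in> {0..1}" "x < \<delta> \<or> 1 - \<delta> < x" for x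
  proof -
    have "(?g has_real_derivative 0) (at x within {0..1})" using zero[of x] x by (auto intro: DERIV_subset)
    then have "(f has_real_derivative 0) (at x within {0..1})"
      by (rule has_field_derivative_transform_within[of _ _ _ _ 1]) (use x in auto)
    then show ?thesis using f'[OF x(1)] x(1) vector_derivative_unique_within_closed_interval[of 0 1 x f]
      by (simp add: has_real_derivative_iff_has_vector_derivative)
  qed
  have "(?g has_real_derivative (if x \<in> {0..1} then f' x else 0)) (at x)" for x
  proof (cases "x \<in> {0<..<1}")
    case True
    then have "(f has_real_derivative f' x) (at x)"
      using f'[of x] by (simp add: at_within_Icc_at)
    then have "(?g has_real_derivative f' x) (at x)"
      by (rule has_field_derivative_transform_within_open[of _ _ _ "{0<..<1}"]) (use True in auto)
    then show ?thesis using True by auto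
  next
    case False
    then have "x \<in> ?S" using \<open>0 < \<delta>\<close> by auto
    moreover have "(if x \<in> {0..1} then f' x else 0) = 0" using f'0[of x] calculation by auto
    ultimately show ?thesis using zero[of x] by simp
  qed
  then show ?case by (rule Cn_on_SucI) (rule Suc.IH[OF c f'0])
qed

section \<open>Smoothness on the closed interval in terms of \<open>D\<close>\<close>

lemma D_eq:
  assumes "(f has_real_derivative f') (at x within {0..1})" "x \<in> {0..1}"
  shows "D f x = f'"
  unfolding D_def
  by (rule vector_derivative_within_cbox[of 0 1 x f f', unfolded cbox_interval])
     (use assms in \<open>auto simp: has_real_derivative_iff_has_vector_derivative\<close>)

lemma D_works:
  assumes "f differentiable (at x within {0..1})"
  shows "(f has_real_derivative D f x) (at x within {0..1})"
  using assms unfolding D_def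
  by (simp add: vector_derivative_works has_real_derivative_iff_has_vector_derivative)

lemma D_cong:
  assumes "\<And>y. y \<in> {0..1} \<Longrightarrow> f y = g y" "x \<in> {0..1}"
  shows "D f x = D g x"
  unfolding D_def
  by (rule vector_derivative_cong_eq) (use assms in \<open>auto simp: eventually_at_filter\<close>)

lemma Ck_I_Suc: "f \<in> Ck_I (Suc n) \<longleftrightarrow> (\<forall>x\<in>{0..1}. f differentiable (at x within {0..1})) \<and> D f \<in> Ck_I n"
proof -
  have "(D ^^ Suc j) f = (D ^^ j) (D f)" for j by (simp only: funpow_Suc_right comp_def)
  moreover have "(\<forall>j<Suc n. P j) \<longleftrightarrow> P 0 \<and> (\<forall>j<n. P (Suc j))" for P by (metis less_Suc_eq_0_disj)
  ultimately show ?thesis unfolding Ck_I_def by (simp only: mem_Collect_eq funpow_0) blast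
qed

lemma Ck_I_iff: "f \<in> Ck_I n \<longleftrightarrow> Cn_on n {0..1} f"
proof (induction n arbitrary: f)
  case 0
  then show ?case by (simp add: Ck_I_def)
next
  case (Suc n)
  show ?case
  proof
    assume "f \<in> Ck_I (Suc n)"
    then show "Cn_on (Suc n) {0..1} f" using Ck_I_Suc Suc D_works by (metis Cn_on.simps(2))
  next
    assume "Cn_on (Suc n) {0..1} f"
    then obtain f' where f': "\<And>x. x \<in> {0..1} \<Longrightarrow> (f has_real_derivative f' x) (at x within {0..1})"
      and c: "Cn_on n {0..1} f'" unfolding Cn_on.simps(2) by blast
    have "Cn_on n {0..1} (D f)" by (rule Cn_on_cong[OF c]) (use f' D_eq in metis)
    moreover have "\<forall>x\<in>{0..1}. f differentiable (at x within {0..1})"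
      using f' by (meson differentiable_def has_field_derivative_def)
    ultimately show "f \<in> Ck_I (Suc n)" using Ck_I_Suc Suc by auto
  qed
qed

lemma Cinf_I_iff: "f \<in> Cinf_I \<longleftrightarrow> (\<forall>n. Cn_on n {0..1} f)"
  by (auto simp: Cinf_I_def Ck_I_iff)

lemma Cinf_I_D:
  assumes "f \<in> Cinf_I"
  shows "D f \<in> Cinf_I" "(D ^^ n) f \<in> Cinf_I"
    "x \<in> {0..1} \<Longrightarrow> ((D ^^ n) f has_real_derivative (D ^^ Suc n) f x) (at x within {0..1})"
proof -
  have *: "D f \<in> Cinf_I" if "f \<in> Cinf_I" for f using that Ck_I_Suc unfolding Cinf_I_def by auto
  show "D f \<in> Cinf_I" using *[OF assms] .
  show n: "(D ^^ n) f \<in> Cinf_I" by (induction n) (use * assms in auto)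
  then have "(D ^^ n) f \<in> Ck_I (Suc 0)" by (auto simp: Cinf_I_def)
  then show "((D ^^ n) f has_real_derivative (D ^^ Suc n) f x) (at x within {0..1})" if "x \<in> {0..1}"
    using that D_works by (auto simp: Ck_I_Suc)
qed

lemma Cinf_I_continuous: "f \<in> Cinf_I \<Longrightarrow> continuous_on {0..1} f"
  using Cinf_I_iff Cn_on_continuous by blast

lemma Cn_on_UNIV_deriv:
  assumes "\<And>n. Cn_on n UNIV f"
  shows "(deriv ^^ n) f field_differentiable (at x)"
proof -
  have *: "(\<forall>x. f field_differentiable (at x)) \<and> (\<forall>n. Cn_on n UNIV (deriv f))" if that0: "\<And>n. Cn_on n UNIV f" for f
  proof -
    have "(\<forall>x. f field_differentiable (at x)) \<and> Cn_on n UNIV (deriv f)" for n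
    proof -
      obtain f' where "\<And>x. (f has_real_derivative f' x) (at x)" "Cn_on n UNIV f'" using that0[of "Suc n"] unfolding Cn_on.simps(2) by blast
      moreover from this have "f' = deriv f" by (metis DERIV_imp_deriv ext)
      ultimately show ?thesis by (auto simp: field_differentiable_def)
    qed
    then show ?thesis by auto
  qed
  have "\<forall>n. Cn_on n UNIV ((deriv ^^ m) f)" for m by (induction m) (use assms * in auto)
  then show ?thesis using * by blast
qed

section \<open>Test functions and a smooth step\<close>

lemma test_funI:
  assumes "\<And>n. Cn_on n UNIV f" "0 < \<delta>" "\<And>x. x < \<delta> \<or> 1 - \<delta> < x \<Longrightarrow> f x = 0"
  shows "f \<in> test_fun"
proof -
  have "compact {\<delta>..1-\<delta>} \<and> {\<delta>..1-\<delta>} \<subseteq> I01 \<and> (\<forall>x. x \<notin> {\<delta>..1-\<delta>} \<longrightarrow> f x = 0)"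
    using assms by (auto simp: not_le)
  then show ?thesis unfolding test_fun_def using Cn_on_UNIV_deriv[OF assms(1)] by blast
qed

lemma test_fun_deriv:
  assumes "\<psi> \<in> test_fun"
  shows "((deriv ^^ n) \<psi> has_real_derivative (deriv ^^ Suc n) \<psi> x) (at x)"
  using assms unfolding test_fun_def by (auto simp: DERIV_deriv_iff_field_differentiable)

lemma test_fun_continuous:
  assumes "\<psi> \<in> test_fun"
  shows "continuous_on S ((deriv ^^ n) \<psi>)"
  by (rule DERIV_continuous_on[OF has_field_derivative_at_within[OF test_fun_deriv[OF assms]]])

text \<open>The complement of the support is open and contains every point outside the open
  interval, so \<open>\<psi>\<close> vanishes near such a point with all derivatives. This removes
  the boundary terms in integrations by parts.\<close>

lemma test_fun_boundary:
  assumes "\<psi> \<in> test_fun" "x \<le> 0 \<or> 1 \<le> x"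
  shows "(deriv ^^ n) \<psi> x = 0"
proof -
  obtain K where K: "compact K" "K \<subseteq> I01" "\<And>x. x \<notin> K \<Longrightarrow> \<psi> x = 0" using assms unfolding test_fun_def by auto
  have o: "open (- K)" using K(1) compact_imp_closed by auto
  have "\<forall>x\<in>- K. (deriv ^^ n) \<psi> x = 0"
  proof (induction n)
    case (Suc n)
    show ?case
    proof
      fix x assume "x \<in> - K"
      then have "((deriv ^^ n) \<psi> has_real_derivative 0) (at x)"
        by (intro has_field_derivative_transform_within_open[OF DERIV_const o]) (use Suc in auto)
      then show "(deriv ^^ Suc n) \<psi> x = 0" by (simp add: DERIV_imp_deriv)
    qed
  qed (use K in auto)
  moreover have "x \<in> - K" using K(2) assms(2) by auto
  ultimately show ?thesis by auto
qed

text \<open>The class of functions \<open>poly p (1/x) exp(-1/x)\<close> is closed under differentiation, also across \<open>0\<close>.\<close>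

definition flat :: "real poly \<Rightarrow> real \<Rightarrow> real" where
  "flat p x = (if 0 < x then poly p (1 / x) * exp (- (1 / x)) else 0)"

lemma poly_exp_decay: "((\<lambda>t. poly p t * exp (- t)) \<longlongrightarrow> (0::real)) at_top"
proof -
  have "((\<lambda>t. \<Sum>i\<le>degree p. coeff p i * (t ^ i * exp (- t))) \<longlongrightarrow> (\<Sum>i\<le>degree p. coeff p i * 0)) at_top"
  proof (intro tendsto_sum tendsto_mult tendsto_const)
    fix i show "((\<lambda>t::real. t ^ i * exp (- t)) \<longlongrightarrow> 0) at_top"
      using tendsto_power_div_exp_0[of i] by (simp add: exp_minus field_simps)
  qed
  then show ?thesis by (simp add: poly_altdef sum_distrib_right mult.assoc)
qed

text \<open>With t = 1/x one has dt/dx = -t^2, so p(t) exp(-t) has derivative t^2 (p - p')(t)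
  exp(-t); \<open>[:0,0,1:]\<close> is the factor t^2. At 0 the right difference quotient is t p(t)
  exp(-t) as t tends to infinity, again a polynomial against an exponential.\<close>

lemma flat_deriv: "(flat p has_real_derivative flat ([:0,0,1:] * (p - pderiv p)) x) (at x)"
proof -
  consider "x < 0" | "x > 0" | "x = 0" by linarith
  then show ?thesis
  proof cases
    case 1
    have "(flat p has_real_derivative 0) (at x)"
      by (rule has_field_derivative_transform_within_open[of "\<lambda>x. 0" _ _ "{..<0}"]) (use 1 in \<open>auto simp: flat_def\<close>)
    then show ?thesis using 1 by (simp add: flat_def)
  next
    case 2
    have d1: "((\<lambda>x. 1 / x) has_real_derivative - (1 / x^2)) (at x)"
      using 2 by (auto intro!: derivative_eq_intros simp: field_simps power2_eq_square)
    have d2: "((\<lambda>x. poly p (1 / x)) has_real_derivative poly (pderiv p) (1 / x) * (- (1 / x^2))) (at x)"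
      by (rule DERIV_chain2[OF poly_DERIV d1])
    have "((\<lambda>x. poly p (1 / x) * exp (- (1 / x))) has_real_derivative
       poly (pderiv p) (1 / x) * (- (1 / x^2)) * exp (- (1/x)) + poly p (1/x) * (exp (- (1/x)) * (1/x^2))) (at x)"
      by (rule derivative_eq_intros d1 d2 refl | simp)+
    then have "((\<lambda>x. poly p (1 / x) * exp (- (1 / x))) has_real_derivative flat ([:0,0,1:] * (p - pderiv p)) x) (at x)"
      using 2 by (simp add: flat_def algebra_simps power2_eq_square)
    then show ?thesis
      by (rule has_field_derivative_transform_within_open[of _ _ _ "{0<..}"]) (use 2 in \<open>auto simp: flat_def\<close>)
  next
    case 3
    have "((\<lambda>h. flat p h / h) \<longlongrightarrow> 0) (at 0)"
    proof (rule filterlim_split_at)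
      show "((\<lambda>h. flat p h / h) \<longlongrightarrow> 0) (at_left 0)"
        by (rule tendsto_eventually) (auto simp: eventually_at_filter flat_def)
      have "((\<lambda>h. poly ([:0,1:] * p) (inverse h) * exp (- inverse h)) \<longlongrightarrow> 0) (at_right (0::real))"
        by (rule filterlim_compose[OF poly_exp_decay filterlim_inverse_at_top_right])
      then show "((\<lambda>h. flat p h / h) \<longlongrightarrow> 0) (at_right 0)"
        by (rule Lim_transform_eventually) (auto simp: eventually_at_filter flat_def field_simps)
    qed
    then show ?thesis using 3 by (simp add: DERIV_def flat_def)
  qed
qed

lemma flat_Cn_on: "Cn_on n UNIV (flat p)"
proof (induction n arbitrary: p)
  case 0
  show ?case using flat_deriv by (auto intro: DERIV_continuous_on)
next
  case (Suc n)
  then show ?case using flat_deriv by (metis Cn_on.simps(2))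
qed

text \<open>A step from 0 to 1 with transition on \<open>{1..2}\<close>; x - 1 and 2 - x are never
  both nonpositive, so the denominator is positive. Starting at 1 rather than 0 makes x \<mapsto>
  \<open>sstep\<close> (N x) vanish for x \<le> 1/N, which yields compact support inside the open
  interval.\<close>

definition sstep :: "real \<Rightarrow> real" where
  "sstep x = flat 1 (x - 1) * (1 / (flat 1 (x - 1) + flat 1 (2 - x)))"

lemma sstep_Cn_on: "Cn_on n UNIV sstep"
proof -
  have c: "Cn_on n UNIV (\<lambda>x. flat 1 (x - 1))" "Cn_on n UNIV (\<lambda>x. flat 1 (2 - x))" for n
    using Cn_on_affine[OF flat_Cn_on, of n 1 1 "-1"] Cn_on_affine[OF flat_Cn_on, of n 1 "-1" 2]
    by (simp_all add: algebra_simps)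
  have "flat 1 (x - 1) + flat 1 (2 - x) \<noteq> 0" for x :: real
  proof -
    have "flat 1 (x-1) > 0 \<or> flat 1 (2-x) > 0" by (auto simp: flat_def)
    moreover have "flat 1 y \<ge> 0" for y by (auto simp: flat_def)
    ultimately show ?thesis by (smt (verit))
  qed
  then show ?thesis unfolding sstep_def[abs_def]
    by (intro Cn_on_mult c Cn_on_inverse Cn_on_add) auto
qed

lemma sstep_vals: "x \<le> 1 \<Longrightarrow> sstep x = 0" "x \<ge> 2 \<Longrightarrow> sstep x = 1" "0 \<le> sstep x" "sstep x \<le> 1"
proof -
  have nn: "flat 1 y \<ge> 0" for y by (auto simp: flat_def)
  show "x \<le> 1 \<Longrightarrow> sstep x = 0" "x \<ge> 2 \<Longrightarrow> sstep x = 1"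
    by (auto simp: sstep_def flat_def)
  show "0 \<le> sstep x" using nn by (simp add: sstep_def)
  show "sstep x \<le> 1" using nn[of "x-1"] nn[of "2-x"] by (auto simp add: sstep_def divide_le_eq_1)
qed

text \<open>Off the transition interval the step is locally constant, so both derivatives vanish
  there and their bounds come from continuity on \<open>{1..2}\<close>.\<close>

lemma sstep_derivs:
  obtains s1 s2 M where "\<And>x. (sstep has_real_derivative s1 x) (at x)" "\<And>x. (s1 has_real_derivative s2 x) (at x)"
    "\<And>x. \<bar>s1 x\<bar> \<le> M" "\<And>x. \<bar>s2 x\<bar> \<le> M" "\<And>x. x < 1 \<or> x > 2 \<Longrightarrow> s1 x = 0" "\<And>x. x < 1 \<or> x > 2 \<Longrightarrow> s2 x = 0"
proof -
  have "Cn_on (Suc (Suc 0)) UNIV sstep" by (rule sstep_Cn_on)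
  then obtain s1 where s1: "\<And>x. (sstep has_real_derivative s1 x) (at x)" and c1: "Cn_on (Suc 0) UNIV s1"
    unfolding Cn_on.simps(2) by blast
  from c1 obtain s2 where s2: "\<And>x. (s1 has_real_derivative s2 x) (at x)" and c2: "Cn_on 0 UNIV s2"
    unfolding Cn_on.simps(2) by blast
  note s = s1 s2 and c = c2[simplified]
  let ?S = "{..<1} \<union> {2<..} :: real set"
  have z1: "s1 x = 0" if "x \<in> ?S" for x
  proof -
    have "(sstep has_real_derivative 0) (at x)"
    proof (cases "x < 1")
      case True
      then show ?thesis by (intro has_field_derivative_transform_within_open[OF DERIV_const open_lessThan[of 1], of _ 0]) (auto simp: sstep_vals)
    next
      case False
      then show ?thesis using that by (intro has_field_derivative_transform_within_open[OF DERIV_const open_greaterThan[of 2], of _ 1]) (auto simp: sstep_vals)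
    qed
    then show ?thesis using s(1) DERIV_unique by blast
  qed
  have z2: "s2 x = 0" if "x \<in> ?S" for x
  proof -
    have "(s1 has_real_derivative 0) (at x)"
      by (rule has_field_derivative_transform_within_open[of "\<lambda>x. 0" _ _ ?S]) (use that z1 in auto)
    then show ?thesis using s(2) DERIV_unique by blast
  qed
  have c1: "continuous_on {1..2} s1" "continuous_on {1..2} s2"
    using s(2) c by (auto intro: DERIV_continuous_on has_field_derivative_at_within continuous_on_subset)
  obtain M1 M2 where M: "\<And>x. x \<in> {1..2} \<Longrightarrow> \<bar>s1 x\<bar> \<le> M1" "\<And>x. x \<in> {1..2} \<Longrightarrow> \<bar>s2 x\<bar> \<le> M2"
    using c1[THEN compact_continuous_image[OF _ compact_Icc], THEN compact_imp_bounded]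
    unfolding bounded_iff by (metis image_eqI real_norm_def)
  have "\<bar>s1 x\<bar> \<le> max 0 (max M1 M2)" "\<bar>s2 x\<bar> \<le> max 0 (max M1 M2)" for x
    using M[of x] z1[of x] z2[of x] by (cases "x \<in> {1..2}"; force)+
  then show thesis using that[of s1 s2 "max 0 (max M1 M2)"] s z1 z2 by auto
qed

section \<open>Integrals over the open unit interval\<close>

lemma I01_lebesgue [simp, measurable]: "I01 \<in> sets lebesgue"
  by simp

lemma integrable_continuous_I:
  assumes "continuous_on {0..1} f"
  shows "integrable leb_I (f :: real \<Rightarrow> real)"
proof -
  have "set_integrable lebesgue {0..1} f"
    using assms by (rule absolutely_integrable_continuous_real)
  then have "set_integrable lebesgue I01 f"
    by (rule set_integrable_subset) auto
  then show ?thesis by (simp add: set_integrable_def integrable_restrict_space)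
qed

lemma lint_continuous_I:
  assumes "continuous_on {0..1} f"
  shows "(LINT x|leb_I. f x) = integral {0..1} (f :: real \<Rightarrow> real)"
  using lebesgue_integral_eq_integral[OF integrable_continuous_I[OF assms]]
  by (simp add: integral_open_interval_real)

lemma lint_FTC:
  assumes "\<And>x. x \<in> {0..1} \<Longrightarrow> (F has_real_derivative f x) (at x within {0..1})" "continuous_on {0..1} f"
  shows "(LINT x|leb_I. f x) = F 1 - F 0"
proof -
  have "(f has_integral (F 1 - F 0)) {0..1}"
    by (rule fundamental_theorem_of_calculus)
       (use assms in \<open>auto simp: has_real_derivative_iff_has_vector_derivative\<close>)
  then show ?thesis using lint_continuous_I[OF assms(2)] by (simp add: integral_unique)
qed

lemma lint_mono_I:
  assumes "integrable leb_I f" "integrable leb_I g" "\<And>x. x \<in> I01 \<Longrightarrow> f x \<le> (g x :: real)"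
  shows "(LINT x|leb_I. f x) \<le> (LINT x|leb_I. g x)"
  by (rule integral_mono) (use assms in auto)

lemma lint_nonneg_I:
  assumes "\<And>x. x \<in> I01 \<Longrightarrow> 0 \<le> (g x :: real)"
  shows "0 \<le> (LINT x|leb_I. g x)"
  by (rule integral_nonneg_AE) (use assms in auto)

lemma lint_cong_I:
  assumes "\<And>x. x \<in> I01 \<Longrightarrow> f x = (g x :: real)"
  shows "(LINT x|leb_I. f x) = (LINT x|leb_I. g x)"
  by (rule Bochner_Integration.integral_cong) (use assms in auto)

lemma finite_measure_leb_I: "finite_measure leb_I"
  by (rule finite_measureI) (simp add: emeasure_restrict_space)

lemma integrable_const_I [simp]: "integrable leb_I (\<lambda>x. c :: real)"
  using finite_measure.integrable_const[OF finite_measure_leb_I] .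

lemma lint_const_I [simp]: "(LINT x|leb_I. c) = (c :: real)"
  using lint_continuous_I[of "\<lambda>x. c"] by simp

subsection \<open>Square integrable functions\<close>

lemma L2_I_integrable: "u \<in> L2_I \<Longrightarrow> integrable leb_I u"
proof -
  assume u: "u \<in> L2_I"
  show "integrable leb_I u"
  proof (rule Bochner_Integration.integrable_bound)
    show "integrable leb_I (\<lambda>x. 1 + (u x)\<^sup>2)" using u by (auto simp: L2_I_def)
    show "AE x in leb_I. norm (u x) \<le> norm (1 + (u x)\<^sup>2)"
    proof (rule AE_I2)
      fix x
      have "2 * \<bar>u x\<bar> \<le> 1 + \<bar>u x\<bar>\<^sup>2" using sum_squares_bound[of 1 "\<bar>u x\<bar>"] by simp
      then show "norm (u x) \<le> norm (1 + (u x)\<^sup>2)" by simp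
    qed
  qed (use u in \<open>auto simp: L2_I_def\<close>)
qed

lemma L2_I_mult:
  assumes "u \<in> L2_I" "v \<in> L2_I"
  shows "integrable leb_I (\<lambda>x. u x * v x)"
proof (rule Bochner_Integration.integrable_bound)
  show "integrable leb_I (\<lambda>x. (u x)\<^sup>2 + (v x)\<^sup>2)" using assms by (auto simp: L2_I_def)
  show "AE x in leb_I. norm (u x * v x) \<le> norm ((u x)\<^sup>2 + (v x)\<^sup>2)"
  proof (rule AE_I2)
    fix x
    have "2 * \<bar>u x\<bar> * \<bar>v x\<bar> \<le> \<bar>u x\<bar>\<^sup>2 + \<bar>v x\<bar>\<^sup>2" by (rule sum_squares_bound)
    moreover have "0 \<le> \<bar>u x\<bar> * \<bar>v x\<bar>" by simp
    ultimately have "\<bar>u x\<bar> * \<bar>v x\<bar> \<le> (u x)\<^sup>2 + (v x)\<^sup>2" unfolding power2_abs by linarith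
    then show "norm (u x * v x) \<le> norm ((u x)\<^sup>2 + (v x)\<^sup>2)" by (simp add: abs_mult)
  qed
qed (use assms in \<open>auto simp: L2_I_def\<close>)

lemma L2_I_diff: "u \<in> L2_I \<Longrightarrow> v \<in> L2_I \<Longrightarrow> (\<lambda>x. u x - v x) \<in> L2_I"
  using L2_I_mult[of u v] by (auto simp: L2_I_def power2_diff mult.assoc)

lemma measurable_continuous_I: "continuous_on {0..1} f \<Longrightarrow> (f :: real \<Rightarrow> real) \<in> borel_measurable leb_I"
  using integrable_continuous_I by blast

lemma continuous_L2_I: "continuous_on {0..1} f \<Longrightarrow> f \<in> L2_I"
  unfolding L2_I_def
  by (auto intro!: integrable_continuous_I continuous_intros measurable_continuous_I)

lemma integrable_continuous_mult_I:
  assumes "continuous_on {0..1} f" "integrable leb_I u"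
  shows "integrable leb_I (\<lambda>x. f x * (u x :: real))"
proof -
  obtain M where M: "\<And>x. x \<in> {0..1} \<Longrightarrow> \<bar>f x\<bar> \<le> M"
    using compact_imp_bounded[OF compact_continuous_image[OF assms(1) compact_Icc]]
    unfolding bounded_iff by (metis image_eqI real_norm_def)
  show ?thesis
  proof (rule Bochner_Integration.integrable_bound)
    show "integrable leb_I (\<lambda>x. M * u x)" using assms by simp
    show "AE x in leb_I. norm (f x * u x) \<le> norm (M * u x)"
    proof (rule AE_I2)
      fix x assume "x \<in> space leb_I"
      then have "\<bar>f x\<bar> \<le> \<bar>M\<bar>" using M[of x] by auto
      then show "norm (f x * u x) \<le> norm (M * u x)" by (simp add: abs_mult mult_right_mono)
    qed
  qed (use assms measurable_continuous_I in auto)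
qed

subsection \<open>The fundamental lemma of the calculus of variations\<close>

text \<open>The first factor vanishes for x \<le> a + 1/(n+1) and the second for x \<ge> b -
  1/(n+1), so the support keeps distance 1/(n+1) from 0 and 1. As n grows these functions
  approximate the indicator of the interval from a to b.\<close>

lemma cutoff_test_fun:
  assumes "0 \<le> a" "b \<le> 1"
  shows "(\<lambda>x. sstep (real (Suc n) * (x - a)) * sstep (real (Suc n) * (b - x))) \<in> test_fun"
proof (rule test_funI[of _ "1 / real (Suc n)"])
  fix m
  have "Cn_on m UNIV (\<lambda>x. sstep (real (Suc n) * x + - real (Suc n) * a))"
    "Cn_on m UNIV (\<lambda>x. sstep (- real (Suc n) * x + real (Suc n) * b))"
    by (intro Cn_on_affine sstep_Cn_on)+
  then have "Cn_on m UNIV (\<lambda>x. sstep (real (Suc n) * (x - a)))"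
    "Cn_on m UNIV (\<lambda>x. sstep (real (Suc n) * (b - x)))"
    by (simp_all only: right_diff_distrib diff_conv_add_uminus distrib_left mult_minus_left mult_minus_right add.commute)
  then show "Cn_on m UNIV (\<lambda>x. sstep (real (Suc n) * (x - a)) * sstep (real (Suc n) * (b - x)))"
    by (rule Cn_on_mult)
next
  fix x assume x: "x < 1 / real (Suc n) \<or> 1 - 1 / real (Suc n) < x"
  have "real (Suc n) * (x - a) \<le> 1 \<or> real (Suc n) * (b - x) \<le> 1"
  proof (cases "x < 1 / real (Suc n)")
    case True
    then have "x - a \<le> 1 / real (Suc n)" using assms by linarith
    then show ?thesis by (simp add: field_simps)
  next
    case False
    then have "b - x \<le> 1 / real (Suc n)" using x assms by linarith
    then show ?thesis by (simp add: field_simps)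
  qed
  then show "sstep (real (Suc n) * (x - a)) * sstep (real (Suc n) * (b - x)) = 0"
    using sstep_vals(1) by auto
qed simp

lemma cutoff_eventually:
  assumes "a < x"
  shows "\<forall>\<^sub>F n in sequentially. 2 < real (Suc n) * (x - a)"
proof -
  obtain N :: nat where "2 / (x - a) < real N" using reals_Archimedean2 by blast
  then have N: "2 < real N * (x - a)" using assms by (simp add: field_simps)
  have "2 < real (Suc n) * (x - a)" if "N \<le> n" for n
  proof -
    have "real N * (x - a) \<le> real (Suc n) * (x - a)" using assms that by (intro mult_right_mono) auto
    then show ?thesis using N by linarith
  qed
  then show ?thesis unfolding eventually_sequentially by blast
qed

lemma cutoff_limit:
  assumes "x \<noteq> a" "x \<noteq> b"
  shows "(\<lambda>n. sstep (real (Suc n) * (x - a)) * sstep (real (Suc n) * (b - x))) \<longlonglongrightarrow> indicator {a<..<b} x"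
proof -
  have neg: "sstep (real (Suc n) * y) = 0" if "y \<le> 0" for n y
    using mult_nonneg_nonpos[of "real (Suc n)" y] that by (intro sstep_vals(1)) linarith
  consider "a < x" "x < b" | "x < a \<or> b < x" using assms by linarith
  then show ?thesis
  proof cases
    case 1
    have "\<forall>\<^sub>F n in sequentially. sstep (real (Suc n) * (x - a)) * sstep (real (Suc n) * (b - x)) = 1"
      using cutoff_eventually[OF 1(1)] cutoff_eventually[of "-b" "-x", simplified, OF 1(2)]
    proof eventually_elim
      case (elim n)
      then have "2 \<le> real (Suc n) * (x - a)" "2 \<le> real (Suc n) * (b - x)" by (simp_all add: algebra_simps)
      then show ?case by (simp only: sstep_vals(2) mult_1)
    qed
    then show ?thesis using 1 by (simp add: tendsto_eventually)
  next
    case 2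
    then have "sstep (real (Suc n) * (x - a)) * sstep (real (Suc n) * (b - x)) = 0" for n
      using neg[of "x - a"] neg[of "b - x"] by auto
    moreover have "indicator {a<..<b} x = (0 :: real)" using 2 by auto
    ultimately show ?thesis by (simp only: tendsto_const)
  qed
qed

text \<open>The cut-offs take values between 0 and 1, so the modulus of \<open>v\<close> dominates
  and the limit may be taken under the integral.\<close>

lemma weak_zero_intervals:
  assumes v: "integrable leb_I v" and z: "\<And>\<psi>. \<psi> \<in> test_fun \<Longrightarrow> (LINT x|leb_I. v x * \<psi> x) = 0"
    and "0 \<le> a" "b \<le> 1"
  shows "(LINT x|leb_I. v x * indicator {a<..<b} x) = 0"
proof -
  let ?\<chi> = "\<lambda>n x. sstep (real (Suc n) * (x - a)) * sstep (real (Suc n) * (b - x))"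
  have "(\<lambda>n. LINT x|leb_I. v x * ?\<chi> n x) \<longlonglongrightarrow> (LINT x|leb_I. v x * indicator {a<..<b} x)"
  proof (rule integral_dominated_convergence[where w = "\<lambda>x. \<bar>v x\<bar>"])
    show "(\<lambda>x. v x * ?\<chi> n x) \<in> borel_measurable leb_I" for n
      using v test_fun_continuous[OF cutoff_test_fun[OF assms(3,4)], of "{0..1}" 0 n]
      by (intro borel_measurable_times measurable_continuous_I borel_measurable_integrable[OF v]) simp
    have "{a<..<b} \<inter> space leb_I \<in> sets leb_I" by (auto simp: sets_restrict_space)
    then show "(\<lambda>x. v x * indicator {a<..<b} x) \<in> borel_measurable leb_I"
      using v by (auto intro!: borel_measurable_times simp: borel_measurable_indicator_iff)
    have "negligible {a, b}" by simp
    then have "AE x in lebesgue. x \<notin> {a,b}" unfolding negligible_iff_null_sets by (rule AE_not_in)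
    then have "AE x in leb_I. x \<notin> {a,b}" by (auto simp: AE_restrict_space_iff)
    then show "AE x in leb_I. (\<lambda>n. v x * ?\<chi> n x) \<longlonglongrightarrow> v x * indicator {a<..<b} x"
      by (rule AE_mp) (intro AE_I2 impI tendsto_mult tendsto_const cutoff_limit; auto)
    show "AE x in leb_I. norm (v x * ?\<chi> n x) \<le> \<bar>v x\<bar>" for n
      by (intro AE_I2) (auto simp: abs_mult sstep_vals intro!: mult_left_le mult_le_one)
  qed (use v in auto)
  moreover have "(LINT x|leb_I. v x * ?\<chi> n x) = 0" for n by (rule z[OF cutoff_test_fun[OF assms(3,4)]])
  ultimately show ?thesis by (simp only: LIMSEQ_const_iff)
qed

text \<open>Positive and negative part of \<open>h\<close> are densities of two measures that agree
  on all open right rays. Rays determine a Borel measure that is finite on them, and equal measures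
  have almost everywhere equal densities.\<close>

lemma AE_zero_if_rays_zero:
  fixes h :: "real \<Rightarrow> real"
  assumes h: "integrable lborel h" and z: "\<And>x. (LINT t|lborel. h t * indicator {x<..} t) = 0"
  shows "AE x in lborel. h x = 0"
proof -
  have [measurable]: "h \<in> borel_measurable borel" using h by auto
  define p where "p = (\<lambda>x. max 0 (h x))"
  define q where "q = (\<lambda>x. max 0 (- h x))"
  have [measurable]: "p \<in> borel_measurable borel" "q \<in> borel_measurable borel" unfolding p_def q_def by measurable
  have ip: "integrable lborel p" "integrable lborel q" unfolding p_def q_def using h by auto
  have hpq: "h x = p x - q x" for x by (auto simp: p_def q_def)
  have ii: "integrable lborel (\<lambda>t. p t * indicator {x<..} t)" "integrable lborel (\<lambda>t. q t * indicator {x<..} t)" for x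
    using integrable_mult_indicator[of "{x<..}" lborel, OF _ ip(1)] integrable_mult_indicator[of "{x<..}" lborel, OF _ ip(2)]
    by (simp_all add: mult.commute)
  have E: "emeasure (density lborel (\<lambda>x. ennreal (r x))) {x<..} = ennreal (LINT t|lborel. r t * indicator {x<..} t)"
    if "r \<in> borel_measurable borel" "\<And>x. 0 \<le> r x" "integrable lborel (\<lambda>t. r t * indicator {x<..} t)" for r :: "real \<Rightarrow> real" and x
  proof -
    have "emeasure (density lborel (\<lambda>x. ennreal (r x))) {x<..} = (\<integral>\<^sup>+t. ennreal (r t) * indicator {x<..} t \<partial>lborel)"
      using that by (subst emeasure_density) auto
    also have "\<dots> = (\<integral>\<^sup>+t. ennreal (r t * indicator {x<..} t) \<partial>lborel)"
      by (intro nn_integral_cong) (auto split: split_indicator)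
    also have "\<dots> = ennreal (LINT t|lborel. r t * indicator {x<..} t)"
      using that by (intro nn_integral_eq_integral) auto
    finally show ?thesis .
  qed
  have pq0: "0 \<le> p x" "0 \<le> q x" for x by (auto simp: p_def q_def)
  have eq: "(LINT t|lborel. p t * indicator {x<..} t) = (LINT t|lborel. q t * indicator {x<..} t)" for x
    using z[of x] Bochner_Integration.integral_diff[OF ii[of x]] by (simp add: hpq left_diff_distrib)
  have "density lborel (\<lambda>x. ennreal (p x)) = density lborel (\<lambda>x. ennreal (q x))"
    by (rule measure_eqI_lessThan) (use eq in \<open>simp_all add: E pq0 ii\<close>)
  then have "AE x in lborel. ennreal (p x) = ennreal (q x)"
    by (intro sigma_finite_measure.density_unique[OF sigma_finite_lborel]) auto
  then show ?thesis
    by (rule AE_mp) (intro AE_I2 impI, simp add: hpq pq0)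
qed

lemma weak_zero_AE:
  assumes v: "integrable leb_I v" and z: "\<And>\<psi>. \<psi> \<in> test_fun \<Longrightarrow> (LINT x|leb_I. v x * \<psi> x) = 0"
  shows "AE x in leb_I. v x = 0"
proof -
  define w where "w = (\<lambda>x. if x \<in> I01 then v x else 0)"
  have w: "integrable lebesgue w" unfolding w_def using v by (subst Lebesgue_Measure.integrable_restrict_UNIV) simp_all
  \<comment> \<open>The argument with rays concerns Borel functions, while \<open>w\<close> is only
    Lebesgue measurable, so it is exchanged for an almost everywhere equal Borel function.\<close>
  obtain h where h: "h \<in> borel_measurable lborel" "AE x in lborel. w x = h x"
    using completion_ex_borel_measurable_real[OF borel_measurable_integrable[OF w]] by auto
  have wh: "AE x in lebesgue. w x = h x" using h(2) by (rule AE_completion)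
  have hm: "h \<in> borel_measurable lebesgue" using h(1) by (rule measurable_completion)
  have "integrable lebesgue h" using integrable_cong_AE[OF borel_measurable_integrable[OF w] hm wh] w by simp
  then have hi: "integrable lborel h" using integrable_completion[OF h(1)] by simp
  have "AE x in lborel. h x = 0"
  proof (rule AE_zero_if_rays_zero[OF hi])
    fix x
    have m: "(\<lambda>t. h t * indicator {x<..} t) \<in> borel_measurable lborel" using h(1) by simp
    have "(LINT t|lborel. h t * indicator {x<..} t) = (LINT t|lebesgue. h t * indicator {x<..} t)"
      using integral_completion[OF m] by simp
    also have "\<dots> = (LINT t|lebesgue. w t * indicator {x<..} t)"
    proof (rule integral_cong_AE)
      show "(\<lambda>t. h t * indicator {x<..} t) \<in> borel_measurable lebesgue" using m by (rule measurable_completion)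
      show "(\<lambda>t. w t * indicator {x<..} t) \<in> borel_measurable lebesgue"
        by (intro borel_measurable_times borel_measurable_integrable[OF w] borel_measurable_indicator) simp
      show "AE t in lebesgue. h t * indicator {x<..} t = w t * indicator {x<..} t"
        using wh by (rule AE_mp) auto
    qed
    also have "\<dots> = (LINT t|lebesgue. indicator I01 t *\<^sub>R (v t * indicator {max 0 x<..<1} t))"
      by (intro Bochner_Integration.integral_cong) (auto simp: w_def split: split_indicator)
    also have "\<dots> = (LINT t|leb_I. v t * indicator {max 0 x<..<1} t)"
      by (rule integral_restrict_space[symmetric]) auto
    also have "\<dots> = 0" by (rule weak_zero_intervals[OF v z]) auto
    finally show "(LINT t|lborel. h t * indicator {x<..} t) = 0" .
  qed
  then have "AE x in lebesgue. h x = 0" by (rule AE_completion)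
  with wh have "AE x in lebesgue. w x = 0" by eventually_elim simp
  then have "AE x in lebesgue. x \<in> I01 \<longrightarrow> v x = 0"
    by (rule eventually_mono) (auto simp: w_def split: if_splits)
  then show ?thesis by (simp add: AE_restrict_space_iff)
qed

subsection \<open>Weak derivatives of classical functions\<close>

text \<open>The difference of two weak derivatives annihilates every test function. As
  \<open>weak_deriv\<close> is a mere choice, this is what ties it to a derivative that can be
  computed.\<close>

lemma has_weak_deriv_unique:
  assumes "has_weak_deriv n u v" "has_weak_deriv n u w"
  shows "AE x in leb_I. v x = w x"
proof -
  have L: "v \<in> L2_I" "w \<in> L2_I" using assms by (auto simp: has_weak_deriv_def)
  have "AE x in leb_I. v x - w x = 0"
  proof (rule weak_zero_AE)
    show "integrable leb_I (\<lambda>x. v x - w x)" using L L2_I_integrable by auto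
    fix \<psi> assume \<psi>: "\<psi> \<in> test_fun"
    have \<psi>2: "\<psi> \<in> L2_I" using test_fun_continuous[OF \<psi>, of _ 0] continuous_L2_I by simp
    have "(-1) ^ n * (LINT x|leb_I. v x * \<psi> x) = (-1) ^ n * (LINT x|leb_I. w x * \<psi> x)"
      using assms \<psi> unfolding has_weak_deriv_def by simp
    then have "(LINT x|leb_I. v x * \<psi> x) = (LINT x|leb_I. w x * \<psi> x)" by simp
    then show "(LINT x|leb_I. (v x - w x) * \<psi> x) = 0"
      using L2_I_mult[OF L(1) \<psi>2] L2_I_mult[OF L(2) \<psi>2] by (simp add: left_diff_distrib)
  qed
  then show ?thesis by simp
qed

lemma weak_deriv_AE_eq:
  assumes "has_weak_deriv n u v"
  shows "AE x in leb_I. weak_deriv n u x = v x" "has_weak_deriv n u (weak_deriv n u)"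
proof -
  show "has_weak_deriv n u (weak_deriv n u)" unfolding weak_deriv_def using assms by (rule someI[of "has_weak_deriv n u"])
  then show "AE x in leb_I. weak_deriv n u x = v x" using has_weak_deriv_unique assms by blast
qed

lemma has_weak_deriv_0: "u \<in> L2_I \<Longrightarrow> has_weak_deriv 0 u u"
  by (simp add: has_weak_deriv_def)

text \<open>Each induction step moves one derivative from the test function to \<open>f\<close> by
  the fundamental theorem of calculus, so the induction runs over all smooth
  \<open>f\<close>.\<close>

lemma Cinf_I_has_weak_deriv:
  assumes "f \<in> Cinf_I"
  shows "has_weak_deriv n f ((D ^^ n) f)"
proof -
  have "(LINT x|leb_I. f x * (deriv ^^ n) \<psi> x) = (-1) ^ n * (LINT x|leb_I. (D ^^ n) f x * \<psi> x)"
    if \<psi>: "\<psi> \<in> test_fun" for \<psi>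
    using assms
  proof (induction n arbitrary: f)
    case (Suc n)
    have c: "continuous_on {0..1} (\<lambda>x. f x * (deriv ^^ Suc n) \<psi> x)" "continuous_on {0..1} (\<lambda>x. D f x * (deriv ^^ n) \<psi> x)"
      using Suc.prems Cinf_I_D(1) Cinf_I_continuous test_fun_continuous[OF \<psi>] by (blast intro: continuous_on_mult)+
    have "(LINT x|leb_I. f x * (deriv ^^ Suc n) \<psi> x + D f x * (deriv ^^ n) \<psi> x)
      = f 1 * (deriv ^^ n) \<psi> 1 - f 0 * (deriv ^^ n) \<psi> 0"
    proof (rule lint_FTC)
      fix x :: real assume "x \<in> {0..1}"
      then have "(f has_real_derivative D f x) (at x within {0..1})" using Cinf_I_D(3)[OF Suc.prems, of x 0] by simp
      then show "((\<lambda>x. f x * (deriv ^^ n) \<psi> x) has_real_derivative f x * (deriv ^^ Suc n) \<psi> x + D f x * (deriv ^^ n) \<psi> x) (at x within {0..1})"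
        by (rule DERIV_mult[OF _ has_field_derivative_at_within[OF test_fun_deriv[OF \<psi>, of n x]], THEN DERIV_cong]) simp
    qed (intro continuous_on_add c)
    then have "(LINT x|leb_I. f x * (deriv ^^ Suc n) \<psi> x) = - (LINT x|leb_I. D f x * (deriv ^^ n) \<psi> x)"
      using c[THEN integrable_continuous_I] by (simp add: test_fun_boundary[OF \<psi>] del: funpow.simps)
    then show ?case using Suc.IH[OF Cinf_I_D(1)[OF Suc.prems]] by (simp only: funpow_Suc_right comp_def power_Suc)
  qed simp
  then show ?thesis using Cinf_I_D(2)[OF assms, of n] assms
    by (auto simp: has_weak_deriv_def intro: continuous_L2_I Cinf_I_continuous)
qed

section \<open>Finite Gagliardo seminorms of smooth functions\<close>

lemma Cinf_I_bound:
  assumes "f \<in> Cinf_I"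
  obtains M where "0 \<le> M" "\<And>x. x \<in> {0..1} \<Longrightarrow> \<bar>f x\<bar> \<le> M"
proof -
  obtain M where M: "\<And>x. x \<in> {0..1} \<Longrightarrow> \<bar>f x\<bar> \<le> M"
    using compact_imp_bounded[OF compact_continuous_image[OF Cinf_I_continuous[OF assms] compact_Icc]]
    unfolding bounded_iff by (metis image_eqI real_norm_def)
  moreover have "0 \<le> M" using M[of 0] by auto
  ultimately show thesis using that by blast
qed

lemma C1_lipschitz:
  assumes "\<And>x. x \<in> {0..1} \<Longrightarrow> (f has_real_derivative f' x) (at x within {0..1})"
    and "\<And>x. x \<in> {0..1} \<Longrightarrow> \<bar>f' x\<bar> \<le> M" "x \<in> {0..1}" "y \<in> {0..1}"
  shows "\<bar>f x - f y\<bar> \<le> M * \<bar>x - y\<bar>"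
proof -
  have "norm (f x - f y) \<le> M * norm (x - y)"
    by (rule field_differentiable_bound[where S = "{0..1}" and f' = f']) (use assms in auto)
  then show ?thesis by simp
qed

lemma nn_integral_leb_I:
  "(\<integral>\<^sup>+x. f x \<partial>leb_I) = (\<integral>\<^sup>+x. f x * indicator I01 x \<partial>lborel)"
  by (simp add: nn_integral_restrict_space nn_integral_completion)

text \<open>The points left and right of \<open>x\<close> contribute separately; after a shift or a
  reflection each part is at most the integral of z^b over the unit interval, which is 1 / (b +
  1).\<close>

lemma nn_integral_abs_powr:
  assumes "-1 < b" and that: "x \<in> {0..1}"
  shows "(\<integral>\<^sup>+y. ennreal (\<bar>x - y\<bar> powr b) * indicator I01 y \<partial>lborel) \<le> ennreal (2 / (b + 1))"
proof -
  have hi: "((\<lambda>z. z powr b) has_integral (1 / (b + 1))) {0..1}"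
    using has_integral_powr_from_0[OF assms(1), of 1] by simp
  have 1: "(\<integral>\<^sup>+z. ennreal (z powr b) * indicator {0..1} z \<partial>lborel) = ennreal (1 / (b + 1))"
    by (rule nn_integral_has_integral_lebesgue'[OF _ hi]) simp
  have m: "(\<lambda>z. ennreal (z powr b) * indicator {0..1} z) \<in> borel_measurable borel" by measurable
  have A: "(\<integral>\<^sup>+z. ennreal ((x + c * z) powr b) * indicator {0..1} (x + c * z) \<partial>lborel) = ennreal (1 / (b + 1))" if "\<bar>c\<bar> = 1" for c x :: real
    using nn_integral_real_affine[OF m, of c x] that 1 by auto
  have "(\<integral>\<^sup>+y. ennreal (\<bar>x - y\<bar> powr b) * indicator I01 y \<partial>lborel)
    \<le> (\<integral>\<^sup>+y. (ennreal ((x + (-1) * y) powr b) * indicator {0..1} (x + (-1) * y)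
         + ennreal ((-x + 1 * y) powr b) * indicator {0..1} (-x + 1 * y)) \<partial>lborel)"
    by (intro nn_integral_mono) (use that in \<open>auto split: split_indicator\<close>)
  also have "\<dots> = ennreal (1 / (b + 1)) + ennreal (1 / (b + 1))"
    by (subst nn_integral_add) (simp_all only: A abs_minus_cancel abs_one, measurable)
  also have "\<dots> = ennreal (2 / (b + 1))" using assms by (simp flip: ennreal_plus)
  finally show ?thesis .
qed

text \<open>A Lipschitz bound reduces the integrand to M^2 times the distance to the power 1 - 2
  \<theta>, an integrable singularity since \<theta> < 1. The inner bound is available only where
  \<open>v\<close> agrees with \<open>f\<close>, hence the two almost everywhere
  comparisons.\<close>

lemma gagliardo_finite:
  assumes v: "AE x in leb_I. v x = f x" and \<theta>: "0 < \<theta>" "\<theta> < 1"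
    and L: "\<And>x y. x \<in> {0..1} \<Longrightarrow> y \<in> {0..1} \<Longrightarrow> \<bar>f x - f y\<bar> \<le> M * \<bar>x - y\<bar>"
  shows "gagliardo \<theta> v < \<infinity>"
proof -
  define b where "b = 1 - 2 * \<theta>"
  have b: "-1 < b" using \<theta> by (simp add: b_def)
  have pt: "(f x - f y)\<^sup>2 / \<bar>x - y\<bar> powr (1 + 2 * \<theta>) \<le> M\<^sup>2 * \<bar>x - y\<bar> powr b" if "x \<in> I01" "y \<in> I01" for x y
  proof (cases "x = y")
    case False
    then have p: "0 < \<bar>x - y\<bar>" by simp
    have "(f x - f y)\<^sup>2 \<le> (M * \<bar>x - y\<bar>)\<^sup>2" using L[of x y] that by (intro power2_le_iff_abs_le[THEN iffD2]) (auto intro: order_trans[OF abs_ge_zero])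
    also have "\<dots> = M\<^sup>2 * \<bar>x - y\<bar> powr 2" using p by (simp add: power_mult_distrib powr_numeral)
    finally have "(f x - f y)\<^sup>2 / \<bar>x - y\<bar> powr (1 + 2 * \<theta>) \<le> M\<^sup>2 * \<bar>x - y\<bar> powr 2 / \<bar>x - y\<bar> powr (1 + 2 * \<theta>)"
      by (intro divide_right_mono) auto
    also have "\<dots> = M\<^sup>2 * \<bar>x - y\<bar> powr b" using powr_diff[of "\<bar>x - y\<bar>" 2 "1 + 2 * \<theta>"] by (simp add: b_def)
    finally show ?thesis .
  qed simp
  let ?K = "ennreal (M\<^sup>2) * ennreal (2 / (b + 1))"
  have inner: "(\<integral>\<^sup>+ y. ennreal ((v x - v y)\<^sup>2 / \<bar>x - y\<bar> powr (1 + 2 * \<theta>)) \<partial>leb_I) \<le> ?K"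
    if vx: "v x = f x" and x: "x \<in> I01" for x
  proof -
    have "(\<integral>\<^sup>+ y. ennreal ((v x - v y)\<^sup>2 / \<bar>x - y\<bar> powr (1 + 2 * \<theta>)) \<partial>leb_I)
      \<le> (\<integral>\<^sup>+ y. ennreal (M\<^sup>2) * ennreal (\<bar>x - y\<bar> powr b) \<partial>leb_I)"
    proof (rule nn_integral_mono_AE, use v in \<open>rule AE_mp\<close>, intro AE_I2 impI)
      fix y assume "y \<in> space leb_I" "v y = f y"
      then show "ennreal ((v x - v y)\<^sup>2 / \<bar>x - y\<bar> powr (1 + 2 * \<theta>)) \<le> ennreal (M\<^sup>2) * ennreal (\<bar>x - y\<bar> powr b)"
        using pt[of x y] x vx by (simp flip: ennreal_mult)
    qed
    also have "\<dots> = ennreal (M\<^sup>2) * (\<integral>\<^sup>+ y. ennreal (\<bar>x - y\<bar> powr b) * indicator I01 y \<partial>lborel)"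
      unfolding nn_integral_leb_I mult.assoc by (rule nn_integral_cmult) measurable
    also have "\<dots> \<le> ?K" by (intro mult_left_mono nn_integral_abs_powr[OF b]) (use x in auto)
    finally show ?thesis .
  qed
  have "gagliardo \<theta> v \<le> (\<integral>\<^sup>+ x. ?K \<partial>leb_I)"
    unfolding gagliardo_def
  proof (rule nn_integral_mono_AE, use v in \<open>rule AE_mp\<close>, intro AE_I2 impI)
    fix x assume "x \<in> space leb_I" "v x = f x"
    then show "(\<integral>\<^sup>+ y. ennreal ((v x - v y)\<^sup>2 / \<bar>x - y\<bar> powr (1 + 2 * \<theta>)) \<partial>leb_I) \<le> ?K"
      by (intro inner) auto
  qed
  also have "\<dots> = ?K" by (simp add: emeasure_restrict_space)
  also have "\<dots> < \<infinity>" by (simp add: ennreal_mult_less_top)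
  finally show ?thesis .
qed

lemma Cinf_I_in_H:
  assumes "f \<in> Cinf_I"
  shows "f \<in> H s"
proof -
  have w: "has_weak_deriv j f ((D ^^ j) f)" for j by (rule Cinf_I_has_weak_deriv[OF assms])
  have "gagliardo (frac s) (weak_deriv m f) < \<infinity>" if "frac s \<noteq> 0" for m
  proof -
    obtain M where M: "\<And>x. x \<in> {0..1} \<Longrightarrow> \<bar>(D ^^ Suc m) f x\<bar> \<le> M"
      using Cinf_I_bound[OF Cinf_I_D(2)[OF assms]] by blast
    show ?thesis
    proof (rule gagliardo_finite[OF weak_deriv_AE_eq(1)[OF w]])
      show "0 < frac s" using that frac_ge_0[of s] by linarith
      show "frac s < 1" by (rule frac_lt_1)
      show "\<bar>(D ^^ m) f x - (D ^^ m) f y\<bar> \<le> M * \<bar>x - y\<bar>" if "x \<in> {0..1}" "y \<in> {0..1}" for x y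
        by (rule C1_lipschitz[OF Cinf_I_D(3)[OF assms] M]) (use that in auto)
    qed
  qed
  moreover have "f \<in> L2_I" using w has_weak_deriv_def by blast
  ultimately show ?thesis unfolding H_def using w by blast
qed

lemma test_fun_Cinf_I:
  assumes "\<psi> \<in> test_fun"
  shows "\<psi> \<in> Cinf_I" "x \<in> {0..1} \<Longrightarrow> (D ^^ n) \<psi> x = (deriv ^^ n) \<psi> x"
proof -
  have "Cn_on m UNIV ((deriv ^^ j) \<psi>)" for m j
  proof (induction m arbitrary: j)
    case 0
    then show ?case using test_fun_continuous[OF assms] by simp
  next
    case (Suc m)
    show ?case by (rule Cn_on_SucI[OF _ Suc[of "Suc j"]]) (rule test_fun_deriv[OF assms])
  qed
  then have "Cn_on m UNIV ((deriv ^^ 0) \<psi>)" for m by blast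
  then show "\<psi> \<in> Cinf_I" unfolding Cinf_I_iff by (auto intro: Cn_on_subset)
  show "(D ^^ n) \<psi> x = (deriv ^^ n) \<psi> x" if "x \<in> {0..1}"
    using that
  proof (induction n arbitrary: x)
    case (Suc n)
    have "D ((D ^^ n) \<psi>) x = D ((deriv ^^ n) \<psi>) x" using Suc by (intro D_cong) auto
    also have "\<dots> = (deriv ^^ Suc n) \<psi> x"
      by (rule D_eq[OF has_field_derivative_at_within[OF test_fun_deriv[OF assms]] Suc.prems])
    finally show ?case by simp
  qed simp
qed

lemma Cinf_I_in_H0:
  assumes f: "f \<in> Cinf_I" and \<psi>: "\<And>n. \<psi> n \<in> test_fun"
    and l: "\<And>j. j \<le> m \<Longrightarrow> (\<lambda>n. LINT x|leb_I. ((D ^^ j) f x - (D ^^ j) (\<psi> n) x)\<^sup>2) \<longlonglongrightarrow> 0"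
  shows "f \<in> H0 m"
proof -
  have "(LINT x|leb_I. (weak_deriv j f x - (deriv ^^ j) (\<psi> n) x)\<^sup>2) = (LINT x|leb_I. ((D ^^ j) f x - (D ^^ j) (\<psi> n) x)\<^sup>2)" for j n
  proof (rule integral_cong_AE)
    have w: "has_weak_deriv j f ((D ^^ j) f)" by (rule Cinf_I_has_weak_deriv[OF f])
    have [measurable]: "weak_deriv j f \<in> borel_measurable leb_I" "(D ^^ j) f \<in> borel_measurable leb_I"
      using w weak_deriv_AE_eq(2)[OF w] by (auto simp: has_weak_deriv_def L2_I_def)
    have [measurable]: "(deriv ^^ j) (\<psi> n) \<in> borel_measurable leb_I" "(D ^^ j) (\<psi> n) \<in> borel_measurable leb_I"
      by (intro measurable_continuous_I test_fun_continuous \<psi> Cinf_I_continuous Cinf_I_D(2) test_fun_Cinf_I(1))+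
    show "(\<lambda>x. (weak_deriv j f x - (deriv ^^ j) (\<psi> n) x)\<^sup>2) \<in> borel_measurable leb_I"
      "(\<lambda>x. ((D ^^ j) f x - (D ^^ j) (\<psi> n) x)\<^sup>2) \<in> borel_measurable leb_I" by measurable
    show "AE x in leb_I. (weak_deriv j f x - (deriv ^^ j) (\<psi> n) x)\<^sup>2 = ((D ^^ j) f x - (D ^^ j) (\<psi> n) x)\<^sup>2"
      using weak_deriv_AE_eq(1)[OF w] by (rule AE_mp) (intro AE_I2 impI, simp add: test_fun_Cinf_I(2)[OF \<psi>])
  qed
  then show ?thesis unfolding H0_def using \<psi> l Cinf_I_in_H[OF f] by (intro CollectI conjI exI[of _ \<psi>]) auto
qed

lemma test_fun_in_H0: "\<psi> \<in> test_fun \<Longrightarrow> \<psi> \<in> H0 m"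
  by (rule Cinf_I_in_H0[OF test_fun_Cinf_I(1), of _ "\<lambda>n. \<psi>"]) auto

subsection \<open>Clamped smooth functions belong to \<open>H\<^sub>0\<^sup>2\<close>\<close>

text \<open>The mean value inequality is applied twice, outward from the clamped end
  \<open>c\<close>. The cruder constant \<open>K\<close> in place of K/2 suffices, since only the
  order of vanishing matters.\<close>

lemma clamped_bound:
  assumes d: "\<And>x. x \<in> {0..1} \<Longrightarrow> (f has_real_derivative f1 x) (at x within {0..1})"
    and d1: "\<And>x. x \<in> {0..1} \<Longrightarrow> (f1 has_real_derivative f2 x) (at x within {0..1})"
    and K: "\<And>x. x \<in> {0..1} \<Longrightarrow> \<bar>f2 x\<bar> \<le> K" and b: "f c = 0" "f1 c = 0"
    and c: "c \<in> {0..1}" "x \<in> {0..1}"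
  shows "\<bar>f1 x\<bar> \<le> K * \<bar>x - c\<bar>" "\<bar>f x\<bar> \<le> K * \<bar>x - c\<bar>\<^sup>2"
proof -
  have 1: "\<bar>f1 y\<bar> \<le> K * \<bar>y - c\<bar>" if "y \<in> {0..1}" for y
    using C1_lipschitz[OF d1 K that c(1)] b by simp
  show "\<bar>f1 x\<bar> \<le> K * \<bar>x - c\<bar>" using 1 c by simp
  have K0: "0 \<le> K" using K[OF c(1)] by linarith
  have sub: "closed_segment c x \<subseteq> {0..1}" using c by (simp add: closed_segment_subset)
  have "norm (f x - f c) \<le> (K * \<bar>x - c\<bar>) * norm (x - c)"
  proof (rule field_differentiable_bound[where S = "closed_segment c x" and f' = f1])
    fix y assume y: "y \<in> closed_segment c x"
    then have yI: "y \<in> {0..1}" using sub by blast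
    show "(f has_real_derivative f1 y) (at y within closed_segment c x)"
      using d[OF yI] sub by (rule DERIV_subset)
    have "\<bar>y - c\<bar> \<le> \<bar>x - c\<bar>" using y by (auto simp: closed_segment_eq_real_ivl split: if_splits)
    then show "norm (f1 y) \<le> K * \<bar>x - c\<bar>" using 1[OF yI] K0 by (auto intro: order_trans mult_left_mono)
  qed auto
  then show "\<bar>f x\<bar> \<le> K * \<bar>x - c\<bar>\<^sup>2" using b by (simp add: power2_eq_square mult.assoc)
qed

text \<open>Wherever \<open>s\<close> is nonzero its argument N y is at most 2. Hence a factor y^k
  exactly compensates the growth N^k of the k-th derivative of a rescaled cut-off, uniformly in
  N.\<close>

lemma scaled_cutoff_bound:
  fixes z y N M :: real
  assumes "\<And>x. \<bar>s x\<bar> \<le> M" "\<And>x. x < 1 \<or> x > 2 \<Longrightarrow> s x = 0" "0 \<le> y" "0 < N"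
  shows "(N * y) ^ k * \<bar>s (N * y)\<bar> \<le> 2 ^ k * M"
proof (cases "N * y > 2")
  case True
  then show ?thesis using assms(1)[of 0] assms(2)[of "N * y"] by auto
next
  case False
  then show ?thesis using assms by (intro mult_mono power_mono) auto
qed

text \<open>The approximants are \<open>f\<close> times a cut-off that is 1 except near the ends.
  Derivatives of the cut-off grow like N and N^2, but \<open>f'\<close> and \<open>f\<close> vanish
  to first and second order at the ends, so the differences up to order two stay bounded. At every
  interior point they are eventually zero, and dominated convergence applies.\<close>

lemma clamped_in_H0:
  assumes f: "f \<in> Cinf_I" and b: "f 0 = 0" "D f 0 = 0" "f 1 = 0" "D f 1 = 0"
  shows "f \<in> H0 2"
proof -
  define f1 where "f1 = D f"
  define f2 where "f2 = D (D f)"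
  have df: "(f has_real_derivative f1 x) (at x within {0..1})"
    and df1: "(f1 has_real_derivative f2 x) (at x within {0..1})" if "x \<in> {0..1}" for x
    using Cinf_I_D(3)[OF f that, of 0] Cinf_I_D(3)[OF f that, of 1] by (simp_all add: f1_def f2_def)
  obtain K where K: "0 \<le> K" "\<And>x. x \<in> {0..1} \<Longrightarrow> \<bar>f2 x\<bar> \<le> K"
    using Cinf_I_bound[of f2] Cinf_I_D(1)[OF Cinf_I_D(1)[OF f]] unfolding f2_def by blast
  have b0: "\<bar>f1 x\<bar> \<le> K * x" "\<bar>f x\<bar> \<le> K * x\<^sup>2" and b1: "\<bar>f1 x\<bar> \<le> K * (1 - x)" "\<bar>f x\<bar> \<le> K * (1 - x)\<^sup>2"
    if "x \<in> {0..1}" for x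
    using clamped_bound[OF df df1 K(2), of 0 x] clamped_bound[OF df df1 K(2), of 1 x] b that
    by (auto simp: f1_def abs_minus_commute[of x 1])
  \<comment> \<open>Needed for the mixed term of the second derivative, in which one derivative
    falls on the cut-off at 0 and one on the cut-off at 1.\<close>
  have b01: "\<bar>f x\<bar> \<le> K * (x * (1 - x))" if x: "x \<in> {0..1}" for x
  proof (cases "x \<le> 1/2")
    case True
    then have "x * x \<le> x * (1 - x)" using x by (intro mult_left_mono) auto
    then show ?thesis using b0(2)[OF x] K(1) by (auto simp: power2_eq_square intro: order_trans mult_left_mono)
  next
    case False
    then have "(1 - x) * (1 - x) \<le> x * (1 - x)" using x by (intro mult_right_mono) auto
    then show ?thesis using b1(2)[OF x] K(1) by (auto simp: power2_eq_square intro: order_trans mult_left_mono)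
  qed
  have bf: "\<bar>f x\<bar> \<le> K * x" "\<bar>f x\<bar> \<le> K * (1 - x)" "\<bar>f x\<bar> \<le> K" "\<bar>f1 x\<bar> \<le> K" if x: "x \<in> {0..1}" for x
  proof -
    have "x * (1 - x) \<le> x * 1" "x * (1 - x) \<le> 1 * (1 - x)" using x by (intro mult_left_mono mult_right_mono; simp)+
    then have *: "K * (x * (1 - x)) \<le> K * x" "K * (x * (1 - x)) \<le> K * (1 - x)"
      using K(1) by (auto intro: mult_left_mono)
    moreover have k: "K * x \<le> K * 1" using K(1) x by (intro mult_left_mono) auto
    ultimately show "\<bar>f x\<bar> \<le> K * x" "\<bar>f x\<bar> \<le> K * (1 - x)" "\<bar>f x\<bar> \<le> K" "\<bar>f1 x\<bar> \<le> K"
      using b01[OF x] b0(1)[OF x] by linarith+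
  qed
  obtain s1 s2 M where s: "\<And>x. (sstep has_real_derivative s1 x) (at x)" "\<And>x. (s1 has_real_derivative s2 x) (at x)"
    "\<And>x. \<bar>s1 x\<bar> \<le> M" "\<And>x. \<bar>s2 x\<bar> \<le> M" "\<And>x. x < 1 \<or> x > 2 \<Longrightarrow> s1 x = 0" "\<And>x. x < 1 \<or> x > 2 \<Longrightarrow> s2 x = 0"
    by (rule sstep_derivs) blast
  have M0: "0 \<le> M" using s(3)[of 0] by linarith
  \<comment> \<open>\<open>A\<close> cuts off at 0 and \<open>B\<close> at 1; the indices 1 and 2
    mark their derivatives.\<close>
  define A where "A = (\<lambda>n x. sstep (real (Suc n) * x))"
  define B where "B = (\<lambda>n x. sstep (real (Suc n) * (1 - x)))"
  define A1 where "A1 = (\<lambda>n x. real (Suc n) * s1 (real (Suc n) * x))"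
  define B1 where "B1 = (\<lambda>n x. - real (Suc n) * s1 (real (Suc n) * (1 - x)))"
  define A2 where "A2 = (\<lambda>n x. real (Suc n) ^ 2 * s2 (real (Suc n) * x))"
  define B2 where "B2 = (\<lambda>n x. real (Suc n) ^ 2 * s2 (real (Suc n) * (1 - x)))"
  have dl: "((\<lambda>x. real (Suc n) * x) has_real_derivative real (Suc n)) (at x)"
    "((\<lambda>x. real (Suc n) * (1 - x)) has_real_derivative - real (Suc n)) (at x)" for n x
    by (auto intro!: derivative_eq_intros)
  have dA: "(A n has_real_derivative A1 n x) (at x)" "(A1 n has_real_derivative A2 n x) (at x)"
    "(B n has_real_derivative B1 n x) (at x)" "(B1 n has_real_derivative B2 n x) (at x)" for n x
    unfolding A_def A1_def A2_def B_def B1_def B2_def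
    using DERIV_chain2[OF s(1) dl(1)] DERIV_chain2[OF s(1) dl(2)]
      DERIV_cmult[OF DERIV_chain2[OF s(2) dl(1)], of "real (Suc n)"]
      DERIV_cmult[OF DERIV_chain2[OF s(2) dl(2)], of "- real (Suc n)"]
    by (simp_all only: power2_eq_square mult.assoc mult.commute mult.left_commute mult_minus_left mult_minus_right minus_minus)
  define \<eta> where "\<eta> = (\<lambda>n x. A n x * B n x)"
  define \<eta>1 where "\<eta>1 = (\<lambda>n x. A1 n x * B n x + A n x * B1 n x)"
  define \<eta>2 where "\<eta>2 = (\<lambda>n x. A2 n x * B n x + 2 * (A1 n x * B1 n x) + A n x * B2 n x)"
  have d\<eta>: "(\<eta> n has_real_derivative \<eta>1 n x) (at x)" "(\<eta>1 n has_real_derivative \<eta>2 n x) (at x)" for n x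
    unfolding \<eta>_def \<eta>1_def \<eta>2_def by (rule derivative_eq_intros dA refl | simp add: algebra_simps)+
  define \<psi> where "\<psi> = (\<lambda>n x. if x \<in> {0..1} then f x * \<eta> n x else 0)"
  have \<eta>t: "\<eta> n \<in> test_fun" for n
    using cutoff_test_fun[of 0 1 n] by (simp add: \<eta>_def A_def B_def)
  have \<eta>0: "\<eta> n x = 0" if "x < 1 / real (Suc n) \<or> 1 - 1 / real (Suc n) < x" for n x
  proof -
    have "real (Suc n) * x \<le> 1 \<or> real (Suc n) * (1 - x) \<le> 1" using that by (auto simp: field_simps)
    then show ?thesis using sstep_vals(1) by (auto simp: \<eta>_def A_def B_def)
  qed
  have \<psi>t: "\<psi> n \<in> test_fun" for n
  proof (rule test_funI)
    have "Cn_on m {0..1} (\<lambda>x. f x * \<eta> n x)" for m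
      using f test_fun_Cinf_I(1)[OF \<eta>t] Cinf_I_iff by (blast intro: Cn_on_mult)
    then show "Cn_on m UNIV (\<psi> n)" for m
      unfolding \<psi>_def by (intro Cn_on_extend_zero[of "1 / real (Suc n)"]) (auto simp: \<eta>0)
    show "\<psi> n x = 0" if "x < 1 / real (Suc n) \<or> 1 - 1 / real (Suc n) < x" for x
      using \<eta>0[OF that] by (simp add: \<psi>_def)
  qed simp
  have D1: "D (\<psi> n) x = f1 x * \<eta> n x + f x * \<eta>1 n x" if x: "x \<in> {0..1}" for n x
  proof -
    have "D (\<psi> n) x = D (\<lambda>x. f x * \<eta> n x) x" using x by (intro D_cong) (auto simp: \<psi>_def)
    also have "\<dots> = f1 x * \<eta> n x + f x * \<eta>1 n x"
      by (rule D_eq[OF DERIV_mult[OF df[OF x] has_field_derivative_at_within[OF d\<eta>(1)], THEN DERIV_cong] x]) simp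
    finally show ?thesis .
  qed
  have D2: "D (D (\<psi> n)) x = f2 x * \<eta> n x + 2 * (f1 x * \<eta>1 n x) + f x * \<eta>2 n x" if x: "x \<in> {0..1}" for n x
  proof -
    have "D (D (\<psi> n)) x = D (\<lambda>x. f1 x * \<eta> n x + f x * \<eta>1 n x) x" using x D1 by (intro D_cong) auto
    also have "\<dots> = f2 x * \<eta> n x + 2 * (f1 x * \<eta>1 n x) + f x * \<eta>2 n x"
      by (rule D_eq[OF DERIV_add[OF DERIV_mult[OF df1[OF x] has_field_derivative_at_within[OF d\<eta>(1)]]
         DERIV_mult[OF df[OF x] has_field_derivative_at_within[OF d\<eta>(2)]], THEN DERIV_cong] x]) simp
    finally show ?thesis .
  qed
  have AB: "0 \<le> A n x" "A n x \<le> 1" "0 \<le> B n x" "B n x \<le> 1" for n x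
    by (auto simp: A_def B_def sstep_vals)
  have cb: "x * \<bar>A1 n x\<bar> \<le> 2 * M" "x\<^sup>2 * \<bar>A2 n x\<bar> \<le> 4 * M"
    "(1 - x) * \<bar>B1 n x\<bar> \<le> 2 * M" "(1 - x)\<^sup>2 * \<bar>B2 n x\<bar> \<le> 4 * M" if x: "x \<in> {0..1}" for n x
    using scaled_cutoff_bound[of s1 M x "real (Suc n)" 1, OF s(3,5)] scaled_cutoff_bound[of s2 M x "real (Suc n)" 2, OF s(4,6)]
      scaled_cutoff_bound[of s1 M "1 - x" "real (Suc n)" 1, OF s(3,5)] scaled_cutoff_bound[of s2 M "1 - x" "real (Suc n)" 2, OF s(4,6)] x
    by (simp_all add: A1_def A2_def B1_def B2_def abs_mult power_mult_distrib mult.assoc mult.left_commute add.commute)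
  \<comment> \<open>Contributions to the second derivative: 2 K from f'' and its cut-off version, 8
    K M from the doubled cross term, 8 K M from the two terms with a second derivative on one
    cut-off, 8 K M^2 from the mixed term.\<close>
  define C where "C = K * (2 + 8 * M + 8 * M + 8 * M\<^sup>2)"
  \<comment> \<open>The factor y by which \<open>u\<close> vanishes is traded against the growth of
    the cut-off derivative \<open>v\<close>.\<close>
  have mulb: "\<bar>u * (v * w)\<bar> \<le> K * L" if "\<bar>u\<bar> \<le> K * y" "0 \<le> y" "y * \<bar>v\<bar> \<le> L" "0 \<le> w" "w \<le> 1" for u v w y L :: real
  proof -
    have "\<bar>u * (v * w)\<bar> \<le> (\<bar>u\<bar> * \<bar>v\<bar>) * 1" using that unfolding abs_mult mult.assoc[symmetric] by (intro mult_left_mono) auto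
    also have "\<dots> \<le> (K * y) * \<bar>v\<bar>" using that by (auto intro: mult_right_mono)
    also have "\<dots> = K * (y * \<bar>v\<bar>)" by simp
    also have "\<dots> \<le> K * L" using that K(1) by (intro mult_left_mono)
    finally show ?thesis .
  qed
  have \<eta>le: "\<bar>u * \<eta> n x\<bar> \<le> K" if "\<bar>u\<bar> \<le> K" for u n x
    using that AB[of n x] mult_mono[of "\<bar>u\<bar>" K "A n x * B n x" 1] K(1) by (auto simp: \<eta>_def abs_mult mult_le_one)
  have bd: "\<bar>f x - \<psi> n x\<bar> \<le> C" "\<bar>f1 x - D (\<psi> n) x\<bar> \<le> C" "\<bar>f2 x - D (D (\<psi> n)) x\<bar> \<le> C" if x: "x \<in> {0..1}" for n x
  proof -
    have x01: "0 \<le> x" "0 \<le> 1 - x" using x by auto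
    note AB' = AB[of n x]
    have m1: "\<bar>f1 x * (A1 n x * B n x)\<bar> \<le> K * (2 * M)" "\<bar>f1 x * (B1 n x * A n x)\<bar> \<le> K * (2 * M)"
      "\<bar>f x * (A1 n x * B n x)\<bar> \<le> K * (2 * M)" "\<bar>f x * (B1 n x * A n x)\<bar> \<le> K * (2 * M)"
      by (rule mulb[OF b0(1)[OF x] x01(1) cb(1)[OF x]] mulb[OF b1(1)[OF x] x01(2) cb(3)[OF x]]
        mulb[OF bf(1)[OF x] x01(1) cb(1)[OF x]] mulb[OF bf(2)[OF x] x01(2) cb(3)[OF x]]; use AB' in simp)+
    have m2: "\<bar>f x * (A2 n x * B n x)\<bar> \<le> K * (4 * M)" "\<bar>f x * (B2 n x * A n x)\<bar> \<le> K * (4 * M)"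
      by (rule mulb[OF b0(2)[OF x] zero_le_power2 cb(2)[OF x]] mulb[OF b1(2)[OF x] zero_le_power2 cb(4)[OF x]]; use AB' in simp)+
    have "(x * \<bar>A1 n x\<bar>) * ((1 - x) * \<bar>B1 n x\<bar>) \<le> (2 * M) * (2 * M)"
      by (rule mult_mono[OF cb(1)[OF x] cb(3)[OF x]]) (use x01 M0 in simp_all)
    then have m3: "\<bar>f x * ((A1 n x * B1 n x) * 1)\<bar> \<le> K * (4 * M\<^sup>2)"
      using x01 by (intro mulb[OF b01[OF x]]) (simp_all add: abs_mult power2_eq_square mult_ac)
    have C: "C = 2 * K + 16 * (K * M) + 8 * (K * M\<^sup>2)" by (simp add: C_def algebra_simps)
    have KM: "0 \<le> K * M" "0 \<le> K * M\<^sup>2" using K(1) M0 by auto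
    have e: "f1 x * \<eta>1 n x = f1 x * (A1 n x * B n x) + f1 x * (B1 n x * A n x)"
      "f x * \<eta>1 n x = f x * (A1 n x * B n x) + f x * (B1 n x * A n x)"
      "f x * \<eta>2 n x = f x * (A2 n x * B n x) + 2 * (f x * ((A1 n x * B1 n x) * 1)) + f x * (B2 n x * A n x)"
      by (simp_all add: \<eta>1_def \<eta>2_def algebra_simps)
    have t: "\<bar>f1 x * \<eta>1 n x\<bar> \<le> 4 * (K * M)" "\<bar>f x * \<eta>1 n x\<bar> \<le> 4 * (K * M)"
      unfolding e
      using abs_triangle_ineq[of "f1 x * (A1 n x * B n x)" "f1 x * (B1 n x * A n x)"]
        abs_triangle_ineq[of "f x * (A1 n x * B n x)" "f x * (B1 n x * A n x)"] m1 by simp_all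
    have add3: "\<bar>p + 2 * q + r\<bar> \<le> \<bar>p\<bar> + 2 * \<bar>q\<bar> + \<bar>r\<bar>" for p q r :: real by linarith
    have t2: "\<bar>f x * \<eta>2 n x\<bar> \<le> 8 * (K * M) + 8 * (K * M\<^sup>2)"
      unfolding e using add3[of "f x * (A2 n x * B n x)" "f x * ((A1 n x * B1 n x) * 1)" "f x * (B2 n x * A n x)"] m2 m3
      by simp
    have e0: "\<psi> n x = f x * \<eta> n x" using x by (simp add: \<psi>_def)
    show "\<bar>f x - \<psi> n x\<bar> \<le> C" using \<eta>le[OF bf(3)[OF x], of n x] bf(3)[OF x] KM unfolding e0 C by linarith
    show "\<bar>f1 x - D (\<psi> n) x\<bar> \<le> C"
      using \<eta>le[OF bf(4)[OF x], of n x] bf(4)[OF x] t KM unfolding D1[OF x] C by linarith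
    show "\<bar>f2 x - D (D (\<psi> n)) x\<bar> \<le> C"
      using \<eta>le[OF K(2)[OF x], of n x] K(2)[OF x] t t2 KM unfolding D2[OF x] C by linarith
  qed
  \<comment> \<open>Once N x and N (1 - x) both exceed 2, the two steps equal 1 and their
    derivatives vanish.\<close>
  have ev: "\<forall>\<^sub>F n in sequentially. \<psi> n x = f x \<and> D (\<psi> n) x = f1 x \<and> D (D (\<psi> n)) x = f2 x" if x: "x \<in> I01" for x
  proof -
    have "\<forall>\<^sub>F n in sequentially. 2 < real (Suc n) * (x - 0)" "\<forall>\<^sub>F n in sequentially. 2 < real (Suc n) * (- x - - 1)"
      by (rule cutoff_eventually; use x in simp)+
    then show ?thesis
  proof eventually_elim
    case (elim n)
    then have n: "2 < real (Suc n) * x" "2 < real (Suc n) * (1 - x)" by simp_all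
    then have n': "2 \<le> real (Suc n) * x" "2 \<le> real (Suc n) * (1 - x)" by simp_all
    have z: "s1 (real (Suc n) * x) = 0" "s2 (real (Suc n) * x) = 0" "s1 (real (Suc n) * (1 - x)) = 0" "s2 (real (Suc n) * (1 - x)) = 0"
      using n by (intro s(5) s(6); simp)+
    have "A n x = 1" "B n x = 1" unfolding A_def B_def by (intro sstep_vals(2) n')+
    moreover have "A1 n x = 0" "B1 n x = 0" "A2 n x = 0" "B2 n x = 0"
      unfolding A1_def A2_def B1_def B2_def z by simp_all
    ultimately have "\<eta> n x = 1" "\<eta>1 n x = 0" "\<eta>2 n x = 0" by (simp_all add: \<eta>_def \<eta>1_def \<eta>2_def)
    then show ?case
      using x D1[of x n] D2[of x n] by (simp add: \<psi>_def)
  qed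
  qed
  show ?thesis
  proof (rule Cinf_I_in_H0[OF f \<psi>t])
    fix j :: nat assume "j \<le> 2"
    then have j: "j = 0 \<or> j = 1 \<or> j = 2" by linarith
    then have bj: "\<bar>(D ^^ j) f x - (D ^^ j) (\<psi> n) x\<bar> \<le> C" if "x \<in> {0..1}" for n x
      using bd[OF that, of n] by (auto simp: f1_def f2_def numeral_2_eq_2)
    have evj: "\<forall>\<^sub>F n in sequentially. (D ^^ j) (\<psi> n) x = (D ^^ j) f x" if "x \<in> I01" for x
      using ev[OF that] j by (auto simp: f1_def f2_def numeral_2_eq_2 elim: eventually_mono)
    have "(\<lambda>n. LINT x|leb_I. ((D ^^ j) f x - (D ^^ j) (\<psi> n) x)\<^sup>2) \<longlonglongrightarrow> (LINT x|leb_I. 0)"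
    proof (rule integral_dominated_convergence[where w = "\<lambda>x. C\<^sup>2"])
      show "(\<lambda>x. ((D ^^ j) f x - (D ^^ j) (\<psi> n) x)\<^sup>2) \<in> borel_measurable leb_I" for n
        by (intro borel_measurable_power borel_measurable_diff measurable_continuous_I Cinf_I_continuous Cinf_I_D(2) f test_fun_Cinf_I(1) \<psi>t)
      show "AE x in leb_I. (\<lambda>n. ((D ^^ j) f x - (D ^^ j) (\<psi> n) x)\<^sup>2) \<longlonglongrightarrow> 0"
      proof (intro AE_I2 tendsto_eventually)
        fix x assume "x \<in> space leb_I"
        then have "\<forall>\<^sub>F n in sequentially. (D ^^ j) (\<psi> n) x = (D ^^ j) f x" by (intro evj) auto
        then show "\<forall>\<^sub>F n in sequentially. ((D ^^ j) f x - (D ^^ j) (\<psi> n) x)\<^sup>2 = 0"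
          by eventually_elim simp
      qed
      show "AE x in leb_I. norm (((D ^^ j) f x - (D ^^ j) (\<psi> n) x)\<^sup>2) \<le> C\<^sup>2" for n
      proof (intro AE_I2)
        fix x assume "x \<in> space leb_I"
        then have "\<bar>(D ^^ j) f x - (D ^^ j) (\<psi> n) x\<bar> \<le> C" by (intro bj) auto
        then show "norm (((D ^^ j) f x - (D ^^ j) (\<psi> n) x)\<^sup>2) \<le> C\<^sup>2"
          using abs_le_square_iff[of "(D ^^ j) f x - (D ^^ j) (\<psi> n) x" C] by simp
      qed
    qed auto
    then show "(\<lambda>n. LINT x|leb_I. ((D ^^ j) f x - (D ^^ j) (\<psi> n) x)\<^sup>2) \<longlonglongrightarrow> 0" by simp
  qed
qed


subsection \<open>The critical capillarity constants\<close>

text \<open>Obtained by integrating the derivative of \<open>(t - 1) * (f t)\<^sup>2\<close> over \<open>{0..1}\<close>.\<close>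

lemma poincare_C1:
  assumes d: "\<And>x. x \<in> {0..1} \<Longrightarrow> (f has_real_derivative f' x) (at x within {0..1})"
    and c: "continuous_on {0..1} f'" and f0: "f 0 = 0"
  shows "(LINT x|leb_I. (f x)\<^sup>2) \<le> 4 * (LINT x|leb_I. (f' x)\<^sup>2)"
proof -
  have cf: "continuous_on {0..1} f" by (rule DERIV_continuous_on[OF d])
  have "(LINT x|leb_I. (f x)\<^sup>2 + (x - 1) * (2 * f x * f' x)) = (1 - 1) * (f 1)\<^sup>2 - (0 - 1) * (f 0)\<^sup>2"
    by (rule lint_FTC) (auto intro!: derivative_eq_intros continuous_intros d cf c)
  then have 1: "(LINT x|leb_I. (f x)\<^sup>2) + (LINT x|leb_I. (x - 1) * (2 * f x * f' x)) = 0"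
    using f0 cf c by (subst (asm) Bochner_Integration.integral_add) (auto intro!: integrable_continuous_I continuous_intros)
  have "- (LINT x|leb_I. (x - 1) * (2 * f x * f' x)) = (LINT x|leb_I. (1 - x) * (2 * f x * f' x))"
    by (simp flip: integral_minus add: algebra_simps)
  \<comment> \<open>Weights 1/2 and 2 in Young's inequality: half of the integral of f^2 is absorbed
    on the left, which produces the constant 4.\<close>
  also have "\<dots> \<le> (LINT x|leb_I. 1/2 * (f x)\<^sup>2 + 2 * (f' x)\<^sup>2)"
  proof (rule lint_mono_I)
    fix x :: real assume "x \<in> I01"
    then have "(1 - x)\<^sup>2 \<le> 1" by (auto simp: power_le_one)
    then have "(1 - x)\<^sup>2 * (f' x)\<^sup>2 \<le> 1 * (f' x)\<^sup>2" by (rule mult_right_mono) simp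
    moreover have "4 * (f x * b) \<le> (f x)\<^sup>2 + 4 * b\<^sup>2" for b
      using zero_le_power2[of "f x - 2 * b"] by (simp add: power2_diff power_mult_distrib)
    from this[of "(1 - x) * f' x"] have "4 * (f x * ((1 - x) * f' x)) \<le> (f x)\<^sup>2 + 4 * ((1 - x)\<^sup>2 * (f' x)\<^sup>2)"
      by (simp only: power_mult_distrib)
    moreover have "(1 - x) * (2 * f x * f' x) = 2 * (f x * ((1 - x) * f' x))" by simp
    ultimately show "(1 - x) * (2 * f x * f' x) \<le> 1/2 * (f x)\<^sup>2 + 2 * (f' x)\<^sup>2" by linarith
  qed (auto intro!: integrable_continuous_I continuous_intros cf c)
  also have "\<dots> = 1/2 * (LINT x|leb_I. (f x)\<^sup>2) + 2 * (LINT x|leb_I. (f' x)\<^sup>2)"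
    using cf c by (subst Bochner_Integration.integral_add) (auto intro!: integrable_continuous_I continuous_intros)
  finally show ?thesis using 1 by linarith
qed

text \<open>With d = u - v one has v^2 - u^2 = d^2 - 2 u d. The cross term is split by Young's
  inequality with a parameter \<epsilon> that tends to zero slowly enough for d^2 / \<epsilon> to
  vanish in the mean as well.\<close>

lemma L2_limit_weighted:
  assumes u: "u \<in> L2_I" "\<And>n. v n \<in> L2_I" and w: "continuous_on {0..1} w"
    and l: "(\<lambda>n. LINT x|leb_I. (u x - v n x)\<^sup>2) \<longlonglongrightarrow> 0"
  shows "(\<lambda>n. LINT x|leb_I. w x * (v n x)\<^sup>2) \<longlonglongrightarrow> (LINT x|leb_I. w x * (u x)\<^sup>2)"
proof -
  obtain W where W: "\<And>x. x \<in> {0..1} \<Longrightarrow> \<bar>w x\<bar> \<le> W"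
    using compact_imp_bounded[OF compact_continuous_image[OF w compact_Icc]]
    unfolding bounded_iff by (metis image_eqI real_norm_def)
  have W0: "0 \<le> W" using W[of 0] by auto
  define d where "d = (\<lambda>n x. u x - v n x)"
  have dL: "d n \<in> L2_I" for n unfolding d_def by (rule L2_I_diff[OF u])
  have sq: "integrable leb_I (\<lambda>x. (h x)\<^sup>2)" if "h \<in> L2_I" for h using that by (simp add: L2_I_def)
  have wsq: "integrable leb_I (\<lambda>x. w x * (h x)\<^sup>2)" if "h \<in> L2_I" for h
    by (rule integrable_continuous_mult_I[OF w sq[OF that]])
  define U where "U = (LINT x|leb_I. (u x)\<^sup>2)"
  define E where "E = (\<lambda>n. LINT x|leb_I. (d n x)\<^sup>2)"
  define e where "e = (\<lambda>n. sqrt (E n))"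
  \<comment> \<open>The norm of d makes the integral of d^2 / \<epsilon> at most that norm; the
    extra 1/(n+1) keeps \<epsilon> positive when d is zero.\<close>
  define \<epsilon> where "\<epsilon> = (\<lambda>n. e n + inverse (real (Suc n)))"
  have E0: "0 \<le> E n" for n unfolding E_def by (rule lint_nonneg_I) simp
  have ee: "e n * e n = E n" "0 \<le> e n" for n using E0 by (simp_all add: e_def)
  have eps: "0 < \<epsilon> n" for n unfolding \<epsilon>_def using ee(2) by (intro add_nonneg_pos) auto
  have bound: "\<bar>(LINT x|leb_I. w x * (v n x)\<^sup>2) - (LINT x|leb_I. w x * (u x)\<^sup>2)\<bar> \<le> W * (E n + e n + \<epsilon> n * U)" for n
  proof -
    have "\<bar>(LINT x|leb_I. w x * (v n x)\<^sup>2) - (LINT x|leb_I. w x * (u x)\<^sup>2)\<bar> = \<bar>LINT x|leb_I. w x * (v n x)\<^sup>2 - w x * (u x)\<^sup>2\<bar>"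
      by (subst Bochner_Integration.integral_diff) (auto intro: wsq u)
    also have "\<dots> \<le> (LINT x|leb_I. \<bar>w x * (v n x)\<^sup>2 - w x * (u x)\<^sup>2\<bar>)"
      by (rule integral_abs_bound)
    also have "\<dots> \<le> (LINT x|leb_I. W * ((1 + 1 / \<epsilon> n) * (d n x)\<^sup>2 + \<epsilon> n * (u x)\<^sup>2))"
    proof (rule lint_mono_I)
      fix x :: real assume x: "x \<in> I01"
      have 1: "\<bar>2 * (u x * d n x)\<bar> \<le> (d n x)\<^sup>2 / \<epsilon> n + \<epsilon> n * (u x)\<^sup>2"
      proof -
        have "0 \<le> (\<bar>d n x\<bar> - \<epsilon> n * \<bar>u x\<bar>)\<^sup>2" by simp
        then have "2 * (\<epsilon> n * (\<bar>u x\<bar> * \<bar>d n x\<bar>)) \<le> (d n x)\<^sup>2 + \<epsilon> n * (\<epsilon> n * (u x)\<^sup>2)"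
          by (simp add: power2_eq_square algebra_simps abs_mult_self_eq)
        then show ?thesis using eps[of n] by (simp add: field_simps abs_mult)
      qed
      have "(v n x)\<^sup>2 - (u x)\<^sup>2 = (d n x)\<^sup>2 - 2 * (u x * d n x)"
        by (simp add: d_def power2_eq_square algebra_simps)
      then have "\<bar>(v n x)\<^sup>2 - (u x)\<^sup>2\<bar> \<le> (1 + 1 / \<epsilon> n) * (d n x)\<^sup>2 + \<epsilon> n * (u x)\<^sup>2"
        using 1 zero_le_power2[of "d n x"] unfolding distrib_right times_divide_eq_left mult_1 by linarith
      moreover have "\<bar>w x\<bar> \<le> W" using W x by auto
      ultimately show "\<bar>w x * (v n x)\<^sup>2 - w x * (u x)\<^sup>2\<bar> \<le> W * ((1 + 1 / \<epsilon> n) * (d n x)\<^sup>2 + \<epsilon> n * (u x)\<^sup>2)"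
        unfolding right_diff_distrib[symmetric] abs_mult using W0 by (intro mult_mono) auto
    qed (use wsq[OF u(1)] wsq[OF u(2)] sq[OF dL] sq[OF u(1)] in auto)
    also have "\<dots> = W * ((1 + 1 / \<epsilon> n) * E n + \<epsilon> n * U)"
      using sq[OF dL] sq[OF u(1)] by (simp add: E_def U_def)
    also have "\<dots> \<le> W * (E n + e n + \<epsilon> n * U)"
    proof -
      have "e n * e n \<le> e n * \<epsilon> n" unfolding \<epsilon>_def using ee(2)[of n] by (intro mult_left_mono) auto
      then have "1 / \<epsilon> n * E n \<le> e n" using eps[of n] ee(1)[of n] by (simp add: field_simps)
      then show ?thesis using W0 by (intro mult_left_mono) (simp_all add: distrib_right)
    qed
    finally show ?thesis .
  qed
  have El: "E \<longlonglongrightarrow> 0" using l by (simp add: E_def d_def)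
  then have el: "e \<longlonglongrightarrow> 0" unfolding e_def using tendsto_real_sqrt[OF El] by simp
  then have epl: "\<epsilon> \<longlonglongrightarrow> 0" unfolding \<epsilon>_def using tendsto_add[OF el LIMSEQ_inverse_real_of_nat] by simp
  have "(\<lambda>n. W * (E n + e n + \<epsilon> n * U)) \<longlonglongrightarrow> W * (0 + 0 + 0 * U)" (is "?b \<longlonglongrightarrow> _")
    by (intro tendsto_intros El el epl)
  then have b0: "?b \<longlonglongrightarrow> 0" by simp
  have "(\<lambda>n. (LINT x|leb_I. w x * (v n x)\<^sup>2) - (LINT x|leb_I. w x * (u x)\<^sup>2)) \<longlonglongrightarrow> 0"
    by (rule Lim_null_comparison[OF always_eventually b0]) (use bound in simp)
  then show ?thesis by (simp add: LIM_zero_iff)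
qed

text \<open>Lets weighted quadratic expressions pass from test functions to all of
  \<open>H0 1\<close>. Even the weak derivative of order 0 is a chosen representative, so it is
  first replaced by \<open>\<theta>\<close> almost everywhere.\<close>

lemma H0_1_approx:
  assumes "\<theta> \<in> H0 1"
  obtains \<psi> where "\<And>n. \<psi> n \<in> test_fun"
    "\<And>w. continuous_on {0..1} w \<Longrightarrow> (\<lambda>n. LINT x|leb_I. w x * (\<psi> n x)\<^sup>2) \<longlonglongrightarrow> (LINT x|leb_I. w x * (\<theta> x)\<^sup>2)"
    "\<And>w. continuous_on {0..1} w \<Longrightarrow> (\<lambda>n. LINT x|leb_I. w x * (deriv (\<psi> n) x)\<^sup>2) \<longlonglongrightarrow> (LINT x|leb_I. w x * (weak_deriv 1 \<theta> x)\<^sup>2)"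
proof -
  obtain \<psi> where \<psi>: "\<And>n. \<psi> n \<in> test_fun" and
    l: "\<And>j. j \<le> 1 \<Longrightarrow> (\<lambda>n. LINT x|leb_I. (weak_deriv j \<theta> x - (deriv ^^ j) (\<psi> n) x)\<^sup>2) \<longlonglongrightarrow> 0"
    using assms unfolding H0_def by blast
  have \<theta>: "\<theta> \<in> L2_I" and "\<exists>v. has_weak_deriv 1 \<theta> v" using assms by (auto simp: H0_def H_def)
  then have \<theta>1: "weak_deriv 1 \<theta> \<in> L2_I" using weak_deriv_AE_eq(2) has_weak_deriv_def by blast
  have L: "(deriv ^^ j) (\<psi> n) \<in> L2_I" for j n by (intro continuous_L2_I test_fun_continuous \<psi>)
  have w0: "weak_deriv 0 \<theta> \<in> L2_I" "AE x in leb_I. weak_deriv 0 \<theta> x = \<theta> x"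
    using weak_deriv_AE_eq[OF has_weak_deriv_0[OF \<theta>]] by (auto simp: has_weak_deriv_def)
  have "(LINT x|leb_I. (weak_deriv 0 \<theta> x - (deriv ^^ 0) (\<psi> n) x)\<^sup>2) = (LINT x|leb_I. (\<theta> x - \<psi> n x)\<^sup>2)" for n
  proof (rule integral_cong_AE)
    show "AE x in leb_I. (weak_deriv 0 \<theta> x - (deriv ^^ 0) (\<psi> n) x)\<^sup>2 = (\<theta> x - \<psi> n x)\<^sup>2"
      using w0(2) by (rule eventually_mono) simp
  qed (use L2_I_diff[OF w0(1) L[of 0 n]] L2_I_diff[OF \<theta> L[of 0 n]] in \<open>auto simp: L2_I_def\<close>)
  then have l0: "(\<lambda>n. LINT x|leb_I. (\<theta> x - \<psi> n x)\<^sup>2) \<longlonglongrightarrow> 0" using l[of 0] by simp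
  have l1: "(\<lambda>n. LINT x|leb_I. (weak_deriv 1 \<theta> x - deriv (\<psi> n) x)\<^sup>2) \<longlonglongrightarrow> 0" using l[of 1] by simp
  have L': "\<psi> n \<in> L2_I" "deriv (\<psi> n) \<in> L2_I" for n using L[of 0 n] L[of 1 n] by simp_all
  show thesis
    by (rule that[OF \<psi> L2_limit_weighted[OF \<theta> L'(1) _ l0] L2_limit_weighted[OF \<theta>1 L'(2) _ l1]])
qed

lemma H0_1_L2:
  assumes "\<theta> \<in> H0 1"
  shows "\<theta> \<in> L2_I" "weak_deriv 1 \<theta> \<in> L2_I"
proof -
  show "\<theta> \<in> L2_I" using assms by (auto simp: H0_def H_def)
  have "\<exists>v. has_weak_deriv 1 \<theta> v" using assms by (auto simp: H0_def H_def)
  then show "weak_deriv 1 \<theta> \<in> L2_I" using weak_deriv_AE_eq(2) has_weak_deriv_def by blast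
qed

lemma poincare_H0_1:
  assumes "\<theta> \<in> H0 1"
  shows "(LINT x|leb_I. (\<theta> x)\<^sup>2) \<le> 4 * (LINT x|leb_I. (weak_deriv 1 \<theta> x)\<^sup>2)"
proof -
  obtain \<psi> where \<psi>: "\<And>n. \<psi> n \<in> test_fun"
    and l: "\<And>w. continuous_on {0..1} w \<Longrightarrow> (\<lambda>n. LINT x|leb_I. w x * (\<psi> n x)\<^sup>2) \<longlonglongrightarrow> (LINT x|leb_I. w x * (\<theta> x)\<^sup>2)"
    "\<And>w. continuous_on {0..1} w \<Longrightarrow> (\<lambda>n. LINT x|leb_I. w x * (deriv (\<psi> n) x)\<^sup>2) \<longlonglongrightarrow> (LINT x|leb_I. w x * (weak_deriv 1 \<theta> x)\<^sup>2)"
    by (rule H0_1_approx[OF assms]) blast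
  have l0: "(\<lambda>n. LINT x|leb_I. (\<psi> n x)\<^sup>2) \<longlonglongrightarrow> (LINT x|leb_I. (\<theta> x)\<^sup>2)" using l(1)[of "\<lambda>x. 1"] by simp
  have l1: "(\<lambda>n. 4 * (LINT x|leb_I. (deriv (\<psi> n) x)\<^sup>2)) \<longlonglongrightarrow> 4 * (LINT x|leb_I. (weak_deriv 1 \<theta> x)\<^sup>2)"
    using l(2)[of "\<lambda>x. 1"] by (intro tendsto_intros) simp
  have "(LINT x|leb_I. (\<psi> n x)\<^sup>2) \<le> 4 * (LINT x|leb_I. (deriv (\<psi> n) x)\<^sup>2)" for n
    using test_fun_deriv[OF \<psi>, of 0 n] test_fun_continuous[OF \<psi>, of "{0..1}" 1 n] test_fun_boundary[OF \<psi>, of 0 0 n]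
    by (intro poincare_C1) (auto intro: has_field_derivative_at_within)
  then show ?thesis by (intro LIMSEQ_le[OF l0 l1]) auto
qed

lemma H01_nonzero_pos:
  assumes "\<theta> \<in> H01_nonzero"
  shows "0 < (LINT x|leb_I. (\<theta> x)\<^sup>2)"
proof -
  have \<theta>: "\<theta> \<in> L2_I" "\<not> (AE x in leb_I. \<theta> x = 0)" using assms H0_1_L2 by (auto simp: H01_nonzero_def)
  then have "(LINT x|leb_I. (\<theta> x)\<^sup>2) \<noteq> 0"
    by (subst integral_nonneg_eq_0_iff_AE) (auto simp: L2_I_def)
  moreover have "0 \<le> (LINT x|leb_I. (\<theta> x)\<^sup>2)" by (rule lint_nonneg_I) simp
  ultimately show ?thesis by linarith
qed

text \<open>Over an empty set the suprema in the extended reals would be minus infinity, so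
  positivity of the constants depends on this.\<close>

lemma H01_nonzero_exists: "\<exists>\<theta>. \<theta> \<in> H01_nonzero"
proof -
  \<comment> \<open>With scale 4 both arguments equal 2 at the midpoint, where the function is
    therefore 1.\<close>
  let ?\<psi> = "\<lambda>x. sstep (real (Suc 3) * (x - 0)) * sstep (real (Suc 3) * (1 - x))"
  have \<psi>: "?\<psi> \<in> test_fun" by (rule cutoff_test_fun) auto
  have c: "continuous_on {0..1} (\<lambda>x. (?\<psi> x)\<^sup>2)"
    using test_fun_continuous[OF \<psi>, of "{0..1}" 0] by (intro continuous_on_power) simp
  have "\<not> (AE x in leb_I. ?\<psi> x = 0)"
  proof
    assume "AE x in leb_I. ?\<psi> x = 0"
    then have "AE x in leb_I. (?\<psi> x)\<^sup>2 = 0" by (rule eventually_mono) simp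
    then have "(LINT x|leb_I. (?\<psi> x)\<^sup>2) = 0" by (rule integral_eq_zero_AE)
    then have "integral {0..1} (\<lambda>x. (?\<psi> x)\<^sup>2) = 0" using lint_continuous_I[OF c] by simp
    then have "\<forall>x\<in>{0..1}. (?\<psi> x)\<^sup>2 = 0" using integral_eq_0_iff[OF c] by simp
    then have "(?\<psi> (1/2))\<^sup>2 = 0" by (rule bspec) simp
    moreover have "sstep 2 = 1" by (rule sstep_vals(2)) simp
    ultimately show False by simp
  qed
  then show ?thesis unfolding H01_nonzero_def using test_fun_in_H0[OF \<psi>] by blast
qed

text \<open>Here \<open>r\<close> is the density gradient and \<open>m\<close> a positive lower
  bound for it; viscosity does not enter the capillarity constants.\<close>

locale density_profile =
  fixes r :: "real \<Rightarrow> real" and m g k :: real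
  assumes r: "continuous_on {0..1} r" "\<And>x. x \<in> {0..1} \<Longrightarrow> m \<le> r x" and pos: "0 < m" "0 < g" "0 < k"
begin

definition "num \<theta> = g * (LINT x|leb_I. r x * (\<theta> x)\<^sup>2)"
definition "den \<theta> = (LINT x|leb_I. (r x)\<^sup>2 * (weak_deriv 1 \<theta> x)\<^sup>2)"
definition "denk \<theta> = (LINT x|leb_I. (r x)\<^sup>2 * (k\<^sup>2 * (\<theta> x)\<^sup>2 + (weak_deriv 1 \<theta> x)\<^sup>2))"
definition "\<delta> = k\<^sup>2 * m / g"

text \<open>Positivity of \<open>den\<close> is the Poincare inequality: a vanishing weak derivative
  would force \<open>\<theta>\<close> to vanish almost everywhere. The last bound uses r^2 \<ge> m r
  in the k^2 term.\<close>

lemma bounds: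
  assumes "\<theta> \<in> H01_nonzero"
  shows "0 < num \<theta>" "0 < den \<theta>" "den \<theta> + \<delta> * num \<theta> \<le> denk \<theta>"
proof -
  have H0: "\<theta> \<in> H0 1" using assms by (simp add: H01_nonzero_def)
  have sq: "integrable leb_I (\<lambda>x. (\<theta> x)\<^sup>2)" "integrable leb_I (\<lambda>x. (weak_deriv 1 \<theta> x)\<^sup>2)"
    using H0_1_L2[OF H0] by (auto simp: L2_I_def)
  note i = sq[THEN integrable_continuous_mult_I[OF r(1)]]
    sq[THEN integrable_continuous_mult_I[OF continuous_on_power[OF r(1)]], of 2]
  have p: "0 < (LINT x|leb_I. (\<theta> x)\<^sup>2)" by (rule H01_nonzero_pos[OF assms])
  have "m * (LINT x|leb_I. (\<theta> x)\<^sup>2) = (LINT x|leb_I. m * (\<theta> x)\<^sup>2)" by simp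
  also have "\<dots> \<le> (LINT x|leb_I. r x * (\<theta> x)\<^sup>2)"
  proof (rule lint_mono_I)
    show "m * (\<theta> x)\<^sup>2 \<le> r x * (\<theta> x)\<^sup>2" if "x \<in> I01" for x
      using r(2)[of x] that by (intro mult_right_mono) auto
  qed (use sq i in simp_all)
  finally have a: "m * (LINT x|leb_I. (\<theta> x)\<^sup>2) \<le> (LINT x|leb_I. r x * (\<theta> x)\<^sup>2)" .
  then have "0 < (LINT x|leb_I. r x * (\<theta> x)\<^sup>2)" using p pos by (meson mult_pos_pos less_le_trans)
  then show "0 < num \<theta>" using pos by (simp add: num_def)
  have "m\<^sup>2 * (LINT x|leb_I. (weak_deriv 1 \<theta> x)\<^sup>2) = (LINT x|leb_I. m\<^sup>2 * (weak_deriv 1 \<theta> x)\<^sup>2)" by simp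
  also have "\<dots> \<le> den \<theta>" unfolding den_def
  proof (rule lint_mono_I)
    show "m\<^sup>2 * (weak_deriv 1 \<theta> x)\<^sup>2 \<le> (r x)\<^sup>2 * (weak_deriv 1 \<theta> x)\<^sup>2" if "x \<in> I01" for x
      using r(2)[of x] that pos by (intro mult_right_mono power_mono) auto
  qed (use sq i in simp_all)
  finally have b: "m\<^sup>2 * (LINT x|leb_I. (weak_deriv 1 \<theta> x)\<^sup>2) \<le> den \<theta>" .
  have "0 < (LINT x|leb_I. (weak_deriv 1 \<theta> x)\<^sup>2)" using poincare_H0_1[OF H0] p by linarith
  then have "0 < m\<^sup>2 * (LINT x|leb_I. (weak_deriv 1 \<theta> x)\<^sup>2)" using pos by simp
  then show "0 < den \<theta>" using b by linarith
  have "\<delta> * num \<theta> = (LINT x|leb_I. k\<^sup>2 * (m * (r x * (\<theta> x)\<^sup>2)))" using pos by (simp add: \<delta>_def num_def)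
  also have "\<dots> \<le> (LINT x|leb_I. k\<^sup>2 * ((r x)\<^sup>2 * (\<theta> x)\<^sup>2))"
  proof (rule lint_mono_I)
    fix x :: real assume "x \<in> I01"
    then have "m \<le> r x" using r(2)[of x] by simp
    then have "m * r x \<le> r x * r x" using pos by (intro mult_right_mono) auto
    then show "k\<^sup>2 * (m * (r x * (\<theta> x)\<^sup>2)) \<le> k\<^sup>2 * ((r x)\<^sup>2 * (\<theta> x)\<^sup>2)"
      unfolding power2_eq_square[of "r x"] mult.assoc[symmetric, of m]
      by (intro mult_left_mono mult_right_mono[of "m * r x"]) auto
  qed (use i in auto)
  also have "\<dots> = denk \<theta> - den \<theta>"
    unfolding den_def denk_def using i by (subst Bochner_Integration.integral_diff[symmetric]) (auto simp: distrib_left mult.left_commute)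
  finally show "den \<theta> + \<delta> * num \<theta> \<le> denk \<theta>" by linarith
qed

lemma delta_pos: "0 < \<delta>" using pos by (simp add: \<delta>_def)

text \<open>A strict inequality between the quotients at each single function could become an
  equality of suprema. The fixed positive \<open>\<delta>\<close> gives a bound on the smaller
  quotients that is uniform in the function.\<close>

lemma sup_strict:
  defines "S \<equiv> (SUP \<theta>\<in>H01_nonzero. ereal (num \<theta> / den \<theta>))"
    and "Sk \<equiv> (SUP \<theta>\<in>H01_nonzero. ereal (num \<theta> / denk \<theta>))"
  shows "0 < Sk" "Sk < S"
proof -
  obtain \<theta>0 where \<theta>0: "\<theta>0 \<in> H01_nonzero" using H01_nonzero_exists by blast
  have dk: "0 < denk \<theta>" if "\<theta> \<in> H01_nonzero" for \<theta>
    using bounds[OF that] delta_pos mult_pos_pos[of \<delta> "num \<theta>"] by linarith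
  have "ereal 0 < ereal (num \<theta>0 / denk \<theta>0)" using bounds(1)[OF \<theta>0] dk[OF \<theta>0] by simp
  also have "\<dots> \<le> Sk" unfolding Sk_def by (rule SUP_upper[OF \<theta>0])
  finally show "0 < Sk" by (simp add: zero_ereal_def)
  have "ereal 0 < ereal (num \<theta>0 / den \<theta>0)" using bounds(1,2)[OF \<theta>0] by simp
  also have "\<dots> \<le> S" unfolding S_def by (rule SUP_upper[OF \<theta>0])
  finally have S0: "ereal 0 < S" .
  show "Sk < S"
  proof (cases S)
    case (real s)
    then have s: "0 < s" using S0 by simp
    have "num \<theta> / denk \<theta> \<le> s / (1 + \<delta> * s)" if \<theta>: "\<theta> \<in> H01_nonzero" for \<theta>
    proof -
      have "ereal (num \<theta> / den \<theta>) \<le> S" unfolding S_def by (rule SUP_upper[OF \<theta>])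
      then have 1: "num \<theta> \<le> s * den \<theta>" using real bounds(2)[OF \<theta>] by (simp add: divide_le_eq)
      have "num \<theta> * (1 + \<delta> * s) = num \<theta> + s * (\<delta> * num \<theta>)" by (simp add: algebra_simps)
      also have "\<dots> \<le> s * (den \<theta> + \<delta> * num \<theta>)" using 1 by (simp add: distrib_left)
      also have "\<dots> \<le> s * denk \<theta>" using bounds(3)[OF \<theta>] s by (intro mult_left_mono) auto
      finally show ?thesis using dk[OF \<theta>] s delta_pos by (simp add: divide_le_eq le_divide_eq add_pos_pos mult.commute)
    qed
    then have "Sk \<le> ereal (s / (1 + \<delta> * s))" unfolding Sk_def by (intro SUP_least) simp
    also have "\<dots> < ereal s" using s delta_pos by (simp add: divide_less_eq add_pos_pos)
    finally show ?thesis using real by simp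
  next
    case PInf
    \<comment> \<open>For an infinite supremum the term \<delta> \<open>num\<close> in the
      denominator alone keeps the smaller quotients bounded.\<close>
    have "num \<theta> / denk \<theta> \<le> 1 / \<delta>" if \<theta>: "\<theta> \<in> H01_nonzero" for \<theta>
      using bounds[OF \<theta>] dk[OF \<theta>] delta_pos by (simp add: divide_le_eq le_divide_eq mult.commute)
    then have "Sk \<le> ereal (1 / \<delta>)" unfolding Sk_def by (intro SUP_least) simp
    then show ?thesis using PInf by auto
  qed (use S0 in simp)
qed

text \<open>The condition on \<open>\<sigma>\<close> supplies a function with only one weak
  derivative. The strict sign survives approximation in H_0^1, which yields a trial function smooth
  enough for a form containing second derivatives.\<close>

lemma unstable_test_fun:
  assumes \<sigma>: "0 < \<sigma>" and "ereal \<sigma> < (SUP \<theta>\<in>H01_nonzero. ereal (num \<theta> / denk \<theta>))"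
  shows "\<exists>\<psi>\<in>test_fun. (LINT x|leb_I. (g * r x - \<sigma> * k\<^sup>2 * (r x)\<^sup>2) * (\<psi> x)\<^sup>2)
     - (LINT x|leb_I. \<sigma> * (r x)\<^sup>2 * (deriv \<psi> x)\<^sup>2) > 0"
proof -
  obtain \<theta> where \<theta>: "\<theta> \<in> H01_nonzero" "\<sigma> < num \<theta> / denk \<theta>"
    using assms(2) unfolding less_SUP_iff by auto
  have H0: "\<theta> \<in> H0 1" using \<theta> by (simp add: H01_nonzero_def)
  have "0 < denk \<theta>" using bounds[OF \<theta>(1)] delta_pos mult_pos_pos[of \<delta> "num \<theta>"] by linarith
  then have 1: "0 < num \<theta> - \<sigma> * denk \<theta>" using \<theta>(2) by (simp add: less_divide_eq)
  have sq: "integrable leb_I (\<lambda>x. (\<theta> x)\<^sup>2)" "integrable leb_I (\<lambda>x. (weak_deriv 1 \<theta> x)\<^sup>2)"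
    using H0_1_L2[OF H0] by (auto simp: L2_I_def)
  note i = sq[THEN integrable_continuous_mult_I[OF r(1)]]
    sq[THEN integrable_continuous_mult_I[OF continuous_on_power[OF r(1)]], of 2]
  have e1: "denk \<theta> = k\<^sup>2 * (LINT x|leb_I. (r x)\<^sup>2 * (\<theta> x)\<^sup>2) + den \<theta>"
    unfolding den_def denk_def using i
    by (subst integral_mult_right_zero[symmetric], subst Bochner_Integration.integral_add[symmetric]) (auto simp: distrib_left mult.left_commute)
  have e2: "(LINT x|leb_I. (g * r x - \<sigma> * k\<^sup>2 * (r x)\<^sup>2) * (\<theta> x)\<^sup>2) = num \<theta> - \<sigma> * (k\<^sup>2 * (LINT x|leb_I. (r x)\<^sup>2 * (\<theta> x)\<^sup>2))"
    using i by (simp add: num_def left_diff_distrib mult.assoc)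
  have e3: "(LINT x|leb_I. \<sigma> * (r x)\<^sup>2 * (weak_deriv 1 \<theta> x)\<^sup>2) = \<sigma> * den \<theta>"
    by (simp add: den_def mult.assoc)
  have 2: "0 < (LINT x|leb_I. (g * r x - \<sigma> * k\<^sup>2 * (r x)\<^sup>2) * (\<theta> x)\<^sup>2) - (LINT x|leb_I. \<sigma> * (r x)\<^sup>2 * (weak_deriv 1 \<theta> x)\<^sup>2)"
    using 1 unfolding e2 e3 e1 by (simp add: algebra_simps)
  obtain \<psi> where \<psi>: "\<And>n. \<psi> n \<in> test_fun"
    and l: "\<And>w. continuous_on {0..1} w \<Longrightarrow> (\<lambda>n. LINT x|leb_I. w x * (\<psi> n x)\<^sup>2) \<longlonglongrightarrow> (LINT x|leb_I. w x * (\<theta> x)\<^sup>2)"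
    "\<And>w. continuous_on {0..1} w \<Longrightarrow> (\<lambda>n. LINT x|leb_I. w x * (deriv (\<psi> n) x)\<^sup>2) \<longlonglongrightarrow> (LINT x|leb_I. w x * (weak_deriv 1 \<theta> x)\<^sup>2)"
    by (rule H0_1_approx[OF H0]) blast
  have "(\<lambda>n. (LINT x|leb_I. (g * r x - \<sigma> * k\<^sup>2 * (r x)\<^sup>2) * (\<psi> n x)\<^sup>2) - (LINT x|leb_I. \<sigma> * (r x)\<^sup>2 * (deriv (\<psi> n) x)\<^sup>2))
    \<longlonglongrightarrow> (LINT x|leb_I. (g * r x - \<sigma> * k\<^sup>2 * (r x)\<^sup>2) * (\<theta> x)\<^sup>2) - (LINT x|leb_I. \<sigma> * (r x)\<^sup>2 * (weak_deriv 1 \<theta> x)\<^sup>2)"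
    by (intro tendsto_diff l continuous_intros r(1))
  from order_tendstoD(1)[OF this 2] obtain n where
    "0 < (LINT x|leb_I. (g * r x - \<sigma> * k\<^sup>2 * (r x)\<^sup>2) * (\<psi> n x)\<^sup>2) - (LINT x|leb_I. \<sigma> * (r x)\<^sup>2 * (deriv (\<psi> n) x)\<^sup>2)"
    by (auto simp: eventually_sequentially)
  then show ?thesis using \<psi> by blast
qed

end

subsection \<open>Linear ordinary differential equations\<close>

text \<open>Picard iteration on \<open>exp (- M t) * y t\<close>: the weight makes it a contraction on all of \<open>{0..1}\<close>.\<close>

lemma lipschitz_ode_exists:
  fixes G :: "real \<Rightarrow> 'a::banach \<Rightarrow> 'a"
  assumes cont: "\<And>y. continuous_on {0..1} y \<Longrightarrow> continuous_on {0..1} (\<lambda>t. G t (y t))"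
    and lip: "\<And>t y z. t \<in> {0..1} \<Longrightarrow> norm (G t y - G t z) \<le> L * norm (y - z)" and L: "0 \<le> L"
  obtains y where "y 0 = y0" "\<And>x. x \<in> {0..1} \<Longrightarrow> (y has_vector_derivative G x (y x)) (at x within {0..1})"
proof -
  \<comment> \<open>Any rate with L / M \<le> 1/2 would do; adding 1 keeps it positive when
    \<open>L\<close> is zero.\<close>
  define M where "M = 2 * L + 1"
  have M: "0 < M" "L / M \<le> 1 / 2" using L by (auto simp: M_def field_simps)
  \<comment> \<open>Projection onto the unit interval; it extends functions on \<open>{0..1}\<close>
    to bounded continuous functions on the line, a complete space in which the fixed point is
    sought.\<close>
  define c where "c = (\<lambda>x::real. max 0 (min 1 x))"
  have c: "c x \<in> {0..1}" "x \<in> {0..1} \<Longrightarrow> c x = x" for x by (auto simp: c_def)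
  have cc: "continuous_on UNIV c" unfolding c_def by (intro continuous_intros)
  define F where "F = (\<lambda>(v :: real \<Rightarrow>\<^sub>C 'a) u. exp (- M * u) *\<^sub>R (y0 + integral {0..u} (\<lambda>t. G t (exp (M * t) *\<^sub>R v t))))"
  have ch: "continuous_on {0..1} (\<lambda>t. G t (exp (M * t) *\<^sub>R v t))" for v :: "real \<Rightarrow>\<^sub>C 'a"
    by (intro cont continuous_intros) auto
  have ih: "(\<lambda>t. G t (exp (M * t) *\<^sub>R v t)) integrable_on {0..u}" if "u \<in> {0..1}" for v :: "real \<Rightarrow>\<^sub>C 'a" and u
    by (rule integrable_continuous_real[OF continuous_on_subset[OF ch]]) (use that in auto)
  have cF: "continuous_on {0..1} (F v)" for v
    unfolding F_def by (intro continuous_intros indefinite_integral_continuous_1 ih) auto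
  have NF: "(\<lambda>x. F v (c x)) \<in> bcontfun" for v
  proof -
    have "continuous_on UNIV (\<lambda>x. F v (c x))" using c by (intro continuous_on_compose2[OF cF cc]) auto
    moreover have "bounded (F v ` {0..1})" by (intro compact_imp_bounded compact_continuous_image cF) auto
    then have "bounded (range (\<lambda>x. F v (c x)))" by (rule bounded_subset) (use c(1) in blast)
    ultimately show ?thesis by (simp add: bcontfun_def)
  qed
  define N where "N = (\<lambda>v. Bcontfun (\<lambda>x. F v (c x)))"
  have N: "apply_bcontfun (N v) x = F v (c x)" for v x
    by (simp add: N_def Bcontfun_inverse[OF NF])
  have "dist (N v) (N w) \<le> 1 / 2 * dist v w" for v w
  proof (rule dist_bound)
    fix x
    define u where "u = c x"
    have u: "u \<in> {0..1}" using c by (simp add: u_def)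
    \<comment> \<open>The integral of L exp(M t) up to u is L/M (exp(M u) - 1), and the outer weight
      exp(-M u) brings it below L/M, at most one half.\<close>
    have hi: "((\<lambda>t. L * (exp (M * t) * dist v w)) has_integral
       L / M * dist v w * exp (M * u) - L / M * dist v w * exp (M * 0)) {0..u}"
    proof (rule fundamental_theorem_of_calculus)
      show "((\<lambda>t. L / M * dist v w * exp (M * t)) has_vector_derivative L * (exp (M * t) * dist v w)) (at t within {0..u})" for t
        unfolding has_real_derivative_iff_has_vector_derivative[symmetric]
        using M(1) by (auto intro!: derivative_eq_intros)
    qed (use u in auto)
    have "dist (N v x) (N w x) = exp (- M * u) * norm (integral {0..u} (\<lambda>t. G t (exp (M * t) *\<^sub>R v t)) - integral {0..u} (\<lambda>t. G t (exp (M * t) *\<^sub>R w t)))"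
      by (simp add: N u_def[symmetric] F_def dist_norm flip: scaleR_diff_right)
    also have "\<dots> = exp (- M * u) * norm (integral {0..u} (\<lambda>t. G t (exp (M * t) *\<^sub>R v t) - G t (exp (M * t) *\<^sub>R w t)))"
      by (simp add: integral_diff ih[OF u])
    also have "\<dots> \<le> exp (- M * u) * integral {0..u} (\<lambda>t. L * (exp (M * t) * dist v w))"
    proof (intro mult_left_mono integral_norm_bound_integral)
      fix t assume t: "t \<in> {0..u}"
      then have "norm (G t (exp (M * t) *\<^sub>R v t) - G t (exp (M * t) *\<^sub>R w t)) \<le> L * norm (exp (M * t) *\<^sub>R v t - exp (M * t) *\<^sub>R w t)"
        using u by (intro lip) auto
      also have "\<dots> = L * (exp (M * t) * dist (v t) (w t))"
        by (simp add: dist_norm flip: scaleR_diff_right)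
      also have "\<dots> \<le> L * (exp (M * t) * dist v w)"
        using L by (intro mult_left_mono dist_bounded) auto
      finally show "norm (G t (exp (M * t) *\<^sub>R v t) - G t (exp (M * t) *\<^sub>R w t)) \<le> L * (exp (M * t) * dist v w)" .
    qed (use ih[OF u] hi in \<open>auto intro: integrable_diff\<close>)
    also have "\<dots> = exp (- M * u) * (L / M * dist v w * (exp (M * u) - 1))"
      unfolding integral_unique[OF hi] by (simp add: right_diff_distrib)
    also have "\<dots> = L / M * dist v w * (1 - exp (- M * u))"
      by (simp add: algebra_simps exp_minus)
    also have "\<dots> \<le> L / M * dist v w * 1" using L M by (intro mult_left_mono) auto
    also have "\<dots> \<le> 1 / 2 * dist v w * 1" using M by (intro mult_right_mono) auto
    finally show "dist (N v x) (N w x) \<le> 1 / 2 * dist v w" by simp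
  qed
  then obtain v where v: "N v = v"
    using banach_fix_type[of "1/2" N] by auto
  define y where "y = (\<lambda>t. exp (M * t) *\<^sub>R v t)"
  have y: "y x = y0 + integral {0..x} (\<lambda>t. G t (y t))" if "x \<in> {0..1}" for x
  proof -
    have "v x = F v x" using N[of v x] v c(2)[OF that] by simp
    then show ?thesis by (simp add: y_def F_def exp_minus)
  qed
  show thesis
  proof (rule that)
    show "y 0 = y0" using y[of 0] by simp
    fix x :: real assume x: "x \<in> {0..1}"
    have "((\<lambda>x. integral {0..x} (\<lambda>t. G t (y t))) has_vector_derivative G x (y x)) (at x within {0..1})"
      using ch[of v] x unfolding y_def by (rule integral_has_vector_derivative)
    then have "((\<lambda>x. y0 + integral {0..x} (\<lambda>t. G t (y t))) has_vector_derivative 0 + G x (y x)) (at x within {0..1})"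
      by (intro has_vector_derivative_add) auto
    then show "(y has_vector_derivative G x (y x)) (at x within {0..1})"
      using has_vector_derivative_transform[OF x y] by simp
  qed
qed

text \<open>The equation y'''' = p0 y + p1 y' + p2 y'' + f as a first-order system. A third-order
  term is absent because the operator in view has the form e y'''' - (P y')' + R y with constant
  e.\<close>

definition ode4 where
  "ode4 p0 p1 p2 f y1 y2 y3 y4 \<longleftrightarrow> (\<forall>x\<in>{0..1::real}.
     (y1 has_real_derivative y2 x) (at x within {0..1}) \<and>
     (y2 has_real_derivative y3 x) (at x within {0..1}) \<and>
     (y3 has_real_derivative y4 x) (at x within {0..1}) \<and>
     (y4 has_real_derivative p0 x * y1 x + p1 x * y2 x + p2 x * y3 x + f x) (at x within {0..1}))"

lemma ode4D:
  assumes "ode4 p0 p1 p2 f y1 y2 y3 y4" "x \<in> {0..1}"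
  shows "(y1 has_real_derivative y2 x) (at x within {0..1})" "(y2 has_real_derivative y3 x) (at x within {0..1})"
    "(y3 has_real_derivative y4 x) (at x within {0..1})"
    "(y4 has_real_derivative p0 x * y1 x + p1 x * y2 x + p2 x * y3 x + f x) (at x within {0..1})"
  using assms by (auto simp: ode4_def)

lemma ode4_continuous:
  assumes "ode4 p0 p1 p2 f y1 y2 y3 y4"
  shows "continuous_on {0..1} y1" "continuous_on {0..1} y2" "continuous_on {0..1} y3" "continuous_on {0..1} y4"
  by (rule DERIV_continuous_on, erule ode4D[OF assms])+

lemma ode4_combine:
  assumes "ode4 p0 p1 p2 f y1 y2 y3 y4" "ode4 p0 p1 p2 (\<lambda>x. 0) z1 z2 z3 z4"
  shows "ode4 p0 p1 p2 f (\<lambda>x. y1 x + a * z1 x) (\<lambda>x. y2 x + a * z2 x) (\<lambda>x. y3 x + a * z3 x) (\<lambda>x. y4 x + a * z4 x)"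
  unfolding ode4_def
proof (intro ballI conjI)
  fix x :: real assume x: "x \<in> {0..1}"
  note d = ode4D[OF assms(1) x] and e = ode4D[OF assms(2) x]
  show "((\<lambda>x. y1 x + a * z1 x) has_real_derivative y2 x + a * z2 x) (at x within {0..1})"
    "((\<lambda>x. y2 x + a * z2 x) has_real_derivative y3 x + a * z3 x) (at x within {0..1})"
    "((\<lambda>x. y3 x + a * z3 x) has_real_derivative y4 x + a * z4 x) (at x within {0..1})"
    by (intro DERIV_add DERIV_cmult d e)+
  show "((\<lambda>x. y4 x + a * z4 x) has_real_derivative
     p0 x * (y1 x + a * z1 x) + p1 x * (y2 x + a * z2 x) + p2 x * (y3 x + a * z3 x) + f x) (at x within {0..1})"
    by (rule DERIV_cong[OF DERIV_add[OF d(4) DERIV_cmult[OF e(4)]]]) (simp add: algebra_simps)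
qed

lemma ode4_exists:
  assumes p: "continuous_on {0..1} p0" "continuous_on {0..1} p1" "continuous_on {0..1} p2" and f: "continuous_on {0..1} f"
  obtains y1 y2 y3 y4 where "ode4 p0 p1 p2 f y1 y2 y3 y4" "y1 0 = a1" "y2 0 = a2" "y3 0 = a3" "y4 0 = a4"
proof -
  define G where "G = (\<lambda>t (y :: real \<times> real \<times> real \<times> real).
     (fst (snd y), fst (snd (snd y)), snd (snd (snd y)),
      p0 t * fst y + p1 t * fst (snd y) + p2 t * fst (snd (snd y)) + f t))"
  have "\<exists>P. \<forall>x\<in>{0..1}. \<bar>q x\<bar> \<le> P" if "continuous_on {0..1} q" for q :: "real \<Rightarrow> real"
    using compact_imp_bounded[OF compact_continuous_image[OF that compact_Icc]]
    unfolding bounded_iff by auto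
  then obtain P0 P1 P2 where P: "\<forall>x\<in>{0..1}. \<bar>p0 x\<bar> \<le> P0" "\<forall>x\<in>{0..1}. \<bar>p1 x\<bar> \<le> P1" "\<forall>x\<in>{0..1}. \<bar>p2 x\<bar> \<le> P2"
    using p by meson
  have P0: "0 \<le> P0" "0 \<le> P1" "0 \<le> P2" using P[THEN bspec, of 0] by auto
  have G1: "continuous_on {0..1} (\<lambda>t. G t (y t))" if "continuous_on {0..1} y" for y
    unfolding G_def by (intro continuous_intros that p f)
  \<comment> \<open>The three shifted components contribute 3 and the last row P0 + P1 + P2.\<close>
  have G2: "norm (G t y - G t z) \<le> (3 + P0 + P1 + P2) * norm (y - z)" if t: "t \<in> {0..1}" for t y z
  proof -
    define w where "w = y - z"
    have n: "norm (a, b, c, d) \<le> \<bar>a\<bar> + \<bar>b\<bar> + \<bar>c\<bar> + \<bar>d\<bar>" for a b c d :: real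
      using norm_Pair_le[of a "(b,c,d)"] norm_Pair_le[of b "(c,d)"] norm_Pair_le[of c d] by simp
    have le: "\<bar>fst w\<bar> \<le> norm w" "\<bar>fst (snd w)\<bar> \<le> norm w" "\<bar>fst (snd (snd w))\<bar> \<le> norm w" "\<bar>snd (snd (snd w))\<bar> \<le> norm w"
    proof -
      have a: "norm (fst v) \<le> norm v" "norm (snd v) \<le> norm v" for v :: "'b::real_normed_vector \<times> 'c::real_normed_vector"
        using norm_fst_le[of "fst v" "snd v"] norm_snd_le[of "snd v" "fst v"] by simp_all
      show "\<bar>fst w\<bar> \<le> norm w" "\<bar>fst (snd w)\<bar> \<le> norm w" "\<bar>fst (snd (snd w))\<bar> \<le> norm w" "\<bar>snd (snd (snd w))\<bar> \<le> norm w"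
        unfolding real_norm_def[symmetric] by (meson a order_trans)+
    qed
    have m: "\<bar>p0 t * fst w\<bar> \<le> P0 * norm w" "\<bar>p1 t * fst (snd w)\<bar> \<le> P1 * norm w" "\<bar>p2 t * fst (snd (snd w))\<bar> \<le> P2 * norm w"
      unfolding abs_mult using P t P0 le by (auto intro!: mult_mono)
    have "G t y - G t z = (fst (snd w), fst (snd (snd w)), snd (snd (snd w)),
      p0 t * fst w + p1 t * fst (snd w) + p2 t * fst (snd (snd w)))"
      by (simp add: G_def w_def algebra_simps)
    then have "norm (G t y - G t z) \<le> \<bar>fst (snd w)\<bar> + \<bar>fst (snd (snd w))\<bar> + \<bar>snd (snd (snd w))\<bar> +
      \<bar>p0 t * fst w + p1 t * fst (snd w) + p2 t * fst (snd (snd w))\<bar>"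
      using n by simp
    also have "\<dots> \<le> norm w + norm w + norm w + (P0 * norm w + P1 * norm w + P2 * norm w)"
      by (intro add_mono le order_trans[OF abs_triangle_ineq] m)
    also have "\<dots> = (3 + P0 + P1 + P2) * norm (y - z)" by (simp add: w_def algebra_simps)
    finally show "norm (G t y - G t z) \<le> (3 + P0 + P1 + P2) * norm (y - z)" .
  qed
  obtain y where y: "y 0 = (a1,a2,a3,a4)" "\<And>x. x \<in> {0..1} \<Longrightarrow> (y has_vector_derivative G x (y x)) (at x within {0..1})"
    using lipschitz_ode_exists[OF G1 G2, of "(a1,a2,a3,a4)"] P0 by (metis (no_types, lifting) add_nonneg_nonneg zero_le_numeral)
  have f': "((\<lambda>x. fst (h x)) has_vector_derivative fst h') F" if "(h has_vector_derivative h') F" for h :: "real \<Rightarrow> 'b::real_normed_vector \<times> 'c::real_normed_vector" and h' F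
    using bounded_linear.has_vector_derivative[OF bounded_linear_fst that] .
  have s': "((\<lambda>x. snd (h x)) has_vector_derivative snd h') F" if "(h has_vector_derivative h') F" for h :: "real \<Rightarrow> 'b::real_normed_vector \<times> 'c::real_normed_vector" and h' F
    using bounded_linear.has_vector_derivative[OF bounded_linear_snd that] .
  show thesis
  proof (rule that)
    show "ode4 p0 p1 p2 f (\<lambda>x. fst (y x)) (\<lambda>x. fst (snd (y x))) (\<lambda>x. fst (snd (snd (y x)))) (\<lambda>x. snd (snd (snd (y x))))"
      unfolding ode4_def has_real_derivative_iff_has_vector_derivative
      using f'[OF y(2)] f'[OF s'[OF y(2)]] f'[OF s'[OF s'[OF y(2)]]] s'[OF s'[OF s'[OF y(2)]]]
      by (auto simp: G_def)
  qed (use y(1) in simp_all)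
qed

text \<open>An energy estimate for zero initial data: the sum E of the four squares satisfies E'
  \<le> M E + f^2, so exp(-M x) E(x) minus the integral of f^2 up to x is nonincreasing and starts
  at zero. The constant is independent of \<open>f\<close>.\<close>

lemma ode4_bound:
  assumes p: "continuous_on {0..1} p0" "continuous_on {0..1} p1" "continuous_on {0..1} p2"
  obtains K where "0 \<le> K" "\<And>f y1 y2 y3 y4 x. continuous_on {0..1} f \<Longrightarrow> ode4 p0 p1 p2 f y1 y2 y3 y4 \<Longrightarrow>
     y1 0 = 0 \<Longrightarrow> y2 0 = 0 \<Longrightarrow> y3 0 = 0 \<Longrightarrow> y4 0 = 0 \<Longrightarrow> x \<in> {0..1} \<Longrightarrow>
     (y1 x)\<^sup>2 + (y2 x)\<^sup>2 \<le> K * (LINT t|leb_I. (f t)\<^sup>2)"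
proof -
  have "\<exists>P. \<forall>x\<in>{0..1}. \<bar>q x\<bar> \<le> P" if "continuous_on {0..1} q" for q :: "real \<Rightarrow> real"
    using compact_imp_bounded[OF compact_continuous_image[OF that compact_Icc]]
    unfolding bounded_iff by auto
  then obtain P0 P1 P2 where P': "\<forall>x\<in>{0..1}. \<bar>p0 x\<bar> \<le> P0" "\<forall>x\<in>{0..1}. \<bar>p1 x\<bar> \<le> P1" "\<forall>x\<in>{0..1}. \<bar>p2 x\<bar> \<le> P2"
    using p by meson
  define P where "P = max P0 (max P1 P2)"
  have P: "\<bar>p0 x\<bar> \<le> P" "\<bar>p1 x\<bar> \<le> P" "\<bar>p2 x\<bar> \<le> P" if "x \<in> {0..1}" for x
    using P'[THEN bspec, OF that] by (auto simp: P_def)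
  have P0: "0 \<le> P" using P(1)[of 0] by auto
  \<comment> \<open>After Young's inequality the four squares in E' carry coefficients 1 + P, 2 + P,
    2 + P and 2 + 3 P; this dominates them all.\<close>
  define M where "M = 3 + 3 * P"
  show thesis
  proof (rule that)
    show "0 \<le> exp M" by simp
    fix f y1 y2 y3 y4 and x :: real
    assume f: "continuous_on {0..1} f" and o: "ode4 p0 p1 p2 f y1 y2 y3 y4"
      and z: "y1 0 = 0" "y2 0 = 0" "y3 0 = 0" "y4 0 = 0" and x: "x \<in> {0..1}"
    define E where "E = (\<lambda>x. (y1 x)\<^sup>2 + (y2 x)\<^sup>2 + (y3 x)\<^sup>2 + (y4 x)\<^sup>2)"
    define E' where "E' = (\<lambda>x. 2 * y1 x * y2 x + 2 * y2 x * y3 x + 2 * y3 x * y4 x + 2 * y4 x * (p0 x * y1 x + p1 x * y2 x + p2 x * y3 x + f x))"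
    have cf2: "continuous_on {0..1} (\<lambda>t. (f t)\<^sup>2)" by (intro continuous_intros f)
    define F where "F = (\<lambda>u. integral {0..u} (\<lambda>t. (f t)\<^sup>2))"
    define h where "h = (\<lambda>x. exp (- M * x) * E x - F x)"
    have dh: "(h has_real_derivative exp (- M * t) * (E' t - M * E t) - (f t)\<^sup>2) (at t within {0..1})" if t: "t \<in> {0..1}" for t
    proof -
      have "(F has_real_derivative (f t)\<^sup>2) (at t within {0..1})"
        unfolding F_def by (rule integral_has_real_derivative[OF cf2 t])
      then show ?thesis unfolding h_def E_def E'_def
        by (auto intro!: derivative_eq_intros ode4D[OF o t] simp: algebra_simps)
    qed
    have le: "exp (- M * t) * (E' t - M * E t) - (f t)\<^sup>2 \<le> 0" if t: "t \<in> {0..1}" for t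
    proof -
      have ab: "2 * (a * b) \<le> a\<^sup>2 + b\<^sup>2" for a b :: real using sum_squares_bound[of a b] by simp
      have abp: "2 * (a * (q * b)) \<le> P * (a\<^sup>2 + b\<^sup>2)" if "\<bar>q\<bar> \<le> P" for a b q :: real
      proof -
        have "2 * (a * (q * b)) \<le> \<bar>q\<bar> * (2 * (\<bar>a\<bar> * \<bar>b\<bar>))"
          by (metis abs_ge_self abs_mult abs_numeral mult.left_commute)
        also have "\<dots> \<le> \<bar>q\<bar> * (a\<^sup>2 + b\<^sup>2)" using ab[of "\<bar>a\<bar>" "\<bar>b\<bar>"] by (intro mult_left_mono) auto
        also have "\<dots> \<le> P * (a\<^sup>2 + b\<^sup>2)" using that by (intro mult_right_mono) auto
        finally show ?thesis .
      qed
      have "E' t = 2 * (y1 t * y2 t) + 2 * (y2 t * y3 t) + 2 * (y3 t * y4 t) + (2 * (y4 t * (p0 t * y1 t))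
        + 2 * (y4 t * (p1 t * y2 t)) + 2 * (y4 t * (p2 t * y3 t)) + 2 * (y4 t * f t))"
        by (simp add: E'_def algebra_simps)
      also have "\<dots> \<le> ((y1 t)\<^sup>2 + (y2 t)\<^sup>2) + ((y2 t)\<^sup>2 + (y3 t)\<^sup>2) + ((y3 t)\<^sup>2 + (y4 t)\<^sup>2) + (P * ((y4 t)\<^sup>2 + (y1 t)\<^sup>2)
        + P * ((y4 t)\<^sup>2 + (y2 t)\<^sup>2) + P * ((y4 t)\<^sup>2 + (y3 t)\<^sup>2) + ((y4 t)\<^sup>2 + (f t)\<^sup>2))"
        by (intro add_mono ab abp P t)
      also have "\<dots> \<le> M * E t + (f t)\<^sup>2"
      proof -
        have n: "0 \<le> P * (y1 t)\<^sup>2" "0 \<le> P * (y2 t)\<^sup>2" "0 \<le> P * (y3 t)\<^sup>2" "0 \<le> P * (y4 t)\<^sup>2" using P0 by auto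
        have "M * E t = 3 * (y1 t)\<^sup>2 + 3 * (y2 t)\<^sup>2 + 3 * (y3 t)\<^sup>2 + 3 * (y4 t)\<^sup>2
          + 3 * (P * (y1 t)\<^sup>2) + 3 * (P * (y2 t)\<^sup>2) + 3 * (P * (y3 t)\<^sup>2) + 3 * (P * (y4 t)\<^sup>2)"
          by (simp add: M_def E_def algebra_simps)
        then show ?thesis using n zero_le_power2[of "y1 t"] zero_le_power2[of "y2 t"] zero_le_power2[of "y3 t"] zero_le_power2[of "y4 t"]
          unfolding distrib_left by linarith
      qed
      finally have "E' t - M * E t \<le> (f t)\<^sup>2" by simp
      then have "exp (- M * t) * (E' t - M * E t) \<le> exp (- M * t) * (f t)\<^sup>2" by (intro mult_left_mono) auto
      also have "\<dots> \<le> 1 * (f t)\<^sup>2" using t P0 by (intro mult_right_mono) (auto simp: M_def mult_nonpos_nonneg)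
      finally show ?thesis by simp
    qed
    have "h x \<le> h 0"
    proof (rule DERIV_nonpos_imp_decreasing_open[where f = h])
      show "0 \<le> x" using x by simp
      fix t assume t: "0 < t" "t < x"
      then have "(h has_real_derivative exp (- M * t) * (E' t - M * E t) - (f t)\<^sup>2) (at t)"
        using dh[of t] x by (simp add: at_within_Icc_at)
      then show "\<exists>y. (h has_real_derivative y) (at t) \<and> y \<le> 0" using le[of t] t x by auto
    next
      have "continuous_on {0..1} h" by (rule DERIV_continuous_on[OF dh])
      then show "continuous_on {0..x} h" by (rule continuous_on_subset) (use x in auto)
    qed
    then have "exp (- M * x) * E x \<le> F x" by (simp add: h_def E_def F_def z)
    also have "F x \<le> integral {0..1} (\<lambda>t. (f t)\<^sup>2)"
      unfolding F_def using x by (intro integral_subset_le integrable_continuous_real continuous_on_subset[OF cf2]) auto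
    also have "\<dots> = (LINT t|leb_I. (f t)\<^sup>2)" by (rule lint_continuous_I[OF cf2, symmetric])
    finally have 1: "exp (- M * x) * E x \<le> (LINT t|leb_I. (f t)\<^sup>2)" .
    have "(y1 x)\<^sup>2 + (y2 x)\<^sup>2 \<le> E x" by (simp add: E_def)
    also have "E x = exp (M * x) * (exp (- M * x) * E x)" by (simp add: exp_minus)
    also have "\<dots> \<le> exp (M * x) * (LINT t|leb_I. (f t)\<^sup>2)" using 1 by (intro mult_left_mono) auto
    also have "\<dots> \<le> exp M * (LINT t|leb_I. (f t)\<^sup>2)"
      using x P0 by (intro mult_right_mono lint_nonneg_I) (auto simp: M_def intro: mult_left_le)
    finally show "(y1 x)\<^sup>2 + (y2 x)\<^sup>2 \<le> exp M * (LINT t|leb_I. (f t)\<^sup>2)" .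
  qed
qed


text \<open>Inside the open interval this is differentiation of the zero function; continuity of
  \<open>f'\<close> carries it to the end points, where initial values are read off.\<close>

lemma deriv_zero_on_closed:
  assumes d: "\<And>x. x \<in> {0..1} \<Longrightarrow> (f has_real_derivative f' x) (at x within {0..1})"
    and c: "continuous_on {0..1} f'" and z: "\<And>x. x \<in> I01 \<Longrightarrow> f x = 0" and x: "x \<in> {0..1}"
  shows "f' x = 0"
proof -
  have "f' t = 0" if t: "t \<in> I01" for t
  proof -
    have "(f has_real_derivative f' t) (at t)" using d[of t] t by (simp add: at_within_Icc_at)
    moreover have "(f has_real_derivative 0) (at t)"
      by (rule has_field_derivative_transform_within_open[OF DERIV_const open_greaterThanLessThan t]) (use z in auto)
    ultimately show ?thesis by (rule DERIV_unique)
  qed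
  then show ?thesis
    using continuous_constant_on_closure[of I01 f' 0 x] c x by simp
qed

lemma ode4_zero: "ode4 p0 p1 p2 (\<lambda>x. 0) (\<lambda>x. 0) (\<lambda>x. 0) (\<lambda>x. 0) (\<lambda>x. 0)"
  by (simp add: ode4_def)

text \<open>Shooting: solutions with zero value and slope at 0 are w + a u + b v, with
  \<open>w\<close> a particular solution and \<open>u\<close>, \<open>v\<close> homogeneous. The
  conditions at 1 form a linear system for a and b with determinant \<open>\<Delta>\<close>, nonzero
  by uniqueness. Cramer's rule and the energy bound for \<open>w\<close> give the estimate.\<close>

lemma clamped_bvp_solvable:
  assumes p: "continuous_on {0..1} p0" "continuous_on {0..1} p1" "continuous_on {0..1} p2"
    and uniq: "\<And>y1 y2 y3 y4 x. ode4 p0 p1 p2 (\<lambda>x. 0) y1 y2 y3 y4 \<Longrightarrow> y1 0 = 0 \<Longrightarrow> y2 0 = 0 \<Longrightarrow> y1 1 = 0 \<Longrightarrow>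
      y2 1 = 0 \<Longrightarrow> x \<in> I01 \<Longrightarrow> y1 x = 0"
  shows "\<exists>C\<ge>0. \<forall>f. continuous_on {0..1} f \<longrightarrow> (\<exists>y1 y2 y3 y4. ode4 p0 p1 p2 f y1 y2 y3 y4 \<and>
    y1 0 = 0 \<and> y2 0 = 0 \<and> y1 1 = 0 \<and> y2 1 = 0 \<and> (\<forall>x\<in>{0..1}. (y1 x)\<^sup>2 \<le> C * (LINT t|leb_I. (f t)\<^sup>2)))"
proof -
  obtain u1 u2 u3 u4 where u: "ode4 p0 p1 p2 (\<lambda>x. 0) u1 u2 u3 u4" "u1 0 = 0" "u2 0 = 0" "u3 0 = 1" "u4 0 = 0"
    by (rule ode4_exists[OF p continuous_on_const])
  obtain v1 v2 v3 v4 where v: "ode4 p0 p1 p2 (\<lambda>x. 0) v1 v2 v3 v4" "v1 0 = 0" "v2 0 = 0" "v3 0 = 0" "v4 0 = 1"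
    by (rule ode4_exists[OF p continuous_on_const])
  define \<Delta> where "\<Delta> = u1 1 * v2 1 - u2 1 * v1 1"
  \<comment> \<open>Such a combination is clamped at both ends, hence zero with all derivatives; its
    second and third derivatives at 0 are a and b.\<close>
  have indep: "a = 0 \<and> b = 0" if ab: "a * u1 1 + b * v1 1 = 0" "a * u2 1 + b * v2 1 = 0" for a b
  proof -
    have o: "ode4 p0 p1 p2 (\<lambda>x. 0) (\<lambda>x. a * u1 x + b * v1 x) (\<lambda>x. a * u2 x + b * v2 x) (\<lambda>x. a * u3 x + b * v3 x) (\<lambda>x. a * u4 x + b * v4 x)"
      using ode4_combine[OF ode4_combine[OF ode4_zero u(1), of a] v(1), of b] by simp
    have z1: "a * u1 x + b * v1 x = 0" if "x \<in> I01" for x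
      using uniq[OF o] that ab u v by simp
    have z2: "a * u2 x + b * v2 x = 0" if "x \<in> {0..1}" for x
      by (rule deriv_zero_on_closed[OF ode4D(1)[OF o] ode4_continuous(2)[OF o] z1 that])
    have z3: "a * u3 x + b * v3 x = 0" if "x \<in> {0..1}" for x
      by (rule deriv_zero_on_closed[OF ode4D(2)[OF o] ode4_continuous(3)[OF o] z2 that]) auto
    have z4: "a * u4 x + b * v4 x = 0" if "x \<in> {0..1}" for x
      by (rule deriv_zero_on_closed[OF ode4D(3)[OF o] ode4_continuous(4)[OF o] z3 that]) auto
    show ?thesis using z3[of 0] z4[of 0] u v by simp
  qed
  \<comment> \<open>If the determinant vanished, the rows of the system would yield kernel vectors
    (v1, -u1) and (v2, -u2) at 1. Then v1 and v2 vanish at 1, and (0, 1) is a kernel vector as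
    well.\<close>
  have \<Delta>: "\<Delta> \<noteq> 0"
  proof
    assume 0: "\<Delta> = 0"
    have "v1 1 = 0" using indep[of "v1 1" "- u1 1"] 0 by (simp add: \<Delta>_def algebra_simps)
    moreover have "v2 1 = 0" using indep[of "v2 1" "- u2 1"] 0 by (simp add: \<Delta>_def algebra_simps)
    ultimately show False using indep[of 0 1] by simp
  qed
  obtain K where K: "0 \<le> K" "\<And>f y1 y2 y3 y4 x. continuous_on {0..1} f \<Longrightarrow> ode4 p0 p1 p2 f y1 y2 y3 y4 \<Longrightarrow>
     y1 0 = 0 \<Longrightarrow> y2 0 = 0 \<Longrightarrow> y3 0 = 0 \<Longrightarrow> y4 0 = 0 \<Longrightarrow> x \<in> {0..1} \<Longrightarrow>
     (y1 x)\<^sup>2 + (y2 x)\<^sup>2 \<le> K * (LINT t|leb_I. (f t)\<^sup>2)"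
    using ode4_bound[OF p] by blast
  have "continuous_on {0..1} (\<lambda>x. \<bar>u1 x\<bar> + \<bar>v1 x\<bar> + \<bar>u2 x\<bar> + \<bar>v2 x\<bar>)"
    by (intro continuous_intros ode4_continuous[OF u(1)] ode4_continuous[OF v(1)])
  from compact_imp_bounded[OF compact_continuous_image[OF this compact_Icc]]
  obtain B where B': "\<And>x. x \<in> {0..1} \<Longrightarrow> \<bar>u1 x\<bar> + \<bar>v1 x\<bar> + \<bar>u2 x\<bar> + \<bar>v2 x\<bar> \<le> B"
    unfolding bounded_iff by fastforce
  have B: "\<bar>u1 x\<bar> \<le> B" "\<bar>v1 x\<bar> \<le> B" "\<bar>u2 x\<bar> \<le> B" "\<bar>v2 x\<bar> \<le> B" if "x \<in> {0..1}" for x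
    using B'[OF that] by linarith+
  have B0: "0 \<le> B" using B(1)[of 0] by auto
  \<comment> \<open>Here a u1 and b v1 are each at most 2 s B^2 / |\<Delta>|, so y1 is at most (1 +
    4 B^2 / |\<Delta>|) s, where s^2 is K times the integral of f^2.\<close>
  define C where "C = (1 + 4 * B\<^sup>2 / \<bar>\<Delta>\<bar>)\<^sup>2 * K"
  show ?thesis
  proof (intro exI[of _ C] conjI allI impI)
    show "0 \<le> C" using K by (simp add: C_def)
    fix f :: "real \<Rightarrow> real" assume f: "continuous_on {0..1} f"
    obtain w1 w2 w3 w4 where w: "ode4 p0 p1 p2 f w1 w2 w3 w4" "w1 0 = 0" "w2 0 = 0" "w3 0 = 0" "w4 0 = 0"
      by (rule ode4_exists[OF p f])
    define F where "F = (LINT t|leb_I. (f t)\<^sup>2)"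
    define s where "s = sqrt (K * F)"
    have F0: "0 \<le> F" unfolding F_def by (rule lint_nonneg_I) simp
    have ws: "\<bar>w1 x\<bar> \<le> s" "\<bar>w2 x\<bar> \<le> s" if "x \<in> {0..1}" for x
    proof -
      have "(w1 x)\<^sup>2 \<le> K * F" "(w2 x)\<^sup>2 \<le> K * F"
        using K(2)[OF f w that] zero_le_power2[of "w1 x"] zero_le_power2[of "w2 x"] unfolding F_def by linarith+
      then show "\<bar>w1 x\<bar> \<le> s" "\<bar>w2 x\<bar> \<le> s" unfolding s_def by (simp_all add: real_le_rsqrt)
    qed
    have s0: "0 \<le> s" "s\<^sup>2 = K * F" using K(1) F0 by (simp_all add: s_def)
    \<comment> \<open>Cramer's rule for w + a u + b v to have zero value and slope at 1.\<close>
    define a where "a = (w2 1 * v1 1 - w1 1 * v2 1) / \<Delta>"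
    define b where "b = (w1 1 * u2 1 - w2 1 * u1 1) / \<Delta>"
    have cb: "\<bar>(p * q - p' * q') / \<Delta>\<bar> \<le> 2 * s * B / \<bar>\<Delta>\<bar>" if "\<bar>p\<bar> \<le> s" "\<bar>p'\<bar> \<le> s" "\<bar>q\<bar> \<le> B" "\<bar>q'\<bar> \<le> B" for p q p' q'
    proof -
      have "\<bar>p * q\<bar> \<le> s * B" "\<bar>p' * q'\<bar> \<le> s * B" unfolding abs_mult using that s0 by (auto intro!: mult_mono)
      then have "\<bar>p * q - p' * q'\<bar> \<le> 2 * s * B" by linarith
      then show ?thesis by (simp add: divide_right_mono)
    qed
    have ab: "\<bar>a\<bar> \<le> 2 * s * B / \<bar>\<Delta>\<bar>" "\<bar>b\<bar> \<le> 2 * s * B / \<bar>\<Delta>\<bar>"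
      unfolding a_def b_def by (intro cb ws B; simp)+
    let ?y1 = "\<lambda>x. w1 x + a * u1 x + b * v1 x" and ?y2 = "\<lambda>x. w2 x + a * u2 x + b * v2 x"
      and ?y3 = "\<lambda>x. w3 x + a * u3 x + b * v3 x" and ?y4 = "\<lambda>x. w4 x + a * u4 x + b * v4 x"
    have "ode4 p0 p1 p2 f ?y1 ?y2 ?y3 ?y4" by (rule ode4_combine[OF ode4_combine[OF w(1) u(1)] v(1)])
    moreover have "?y1 0 = 0" "?y2 0 = 0" using w u v by simp_all
    moreover have "?y1 1 = 0"
    proof -
      have "\<Delta> * ?y1 1 = \<Delta> * w1 1 + (\<Delta> * a) * u1 1 + (\<Delta> * b) * v1 1" by (simp add: algebra_simps)
      also have "\<dots> = 0" using \<Delta> by (simp add: a_def b_def) (simp add: \<Delta>_def algebra_simps)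
      finally show ?thesis using \<Delta> by simp
    qed
    moreover have "?y2 1 = 0"
    proof -
      have "\<Delta> * ?y2 1 = \<Delta> * w2 1 + (\<Delta> * a) * u2 1 + (\<Delta> * b) * v2 1" by (simp add: algebra_simps)
      also have "\<dots> = 0" using \<Delta> by (simp add: a_def b_def) (simp add: \<Delta>_def algebra_simps)
      finally show ?thesis using \<Delta> by simp
    qed
    moreover have "(?y1 x)\<^sup>2 \<le> C * F" if x: "x \<in> {0..1}" for x
    proof -
      have "\<bar>a * u1 x\<bar> \<le> 2 * s * B / \<bar>\<Delta>\<bar> * B" "\<bar>b * v1 x\<bar> \<le> 2 * s * B / \<bar>\<Delta>\<bar> * B"
        unfolding abs_mult using s0 B0 by (intro mult_mono ab B x; simp)+
      then have "\<bar>?y1 x\<bar> \<le> s + 2 * (2 * s * B / \<bar>\<Delta>\<bar> * B)" using ws(1)[OF x] by linarith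
      also have "\<dots> = (1 + 4 * B\<^sup>2 / \<bar>\<Delta>\<bar>) * s" by (simp add: algebra_simps power2_eq_square)
      finally have "\<bar>?y1 x\<bar>\<^sup>2 \<le> ((1 + 4 * B\<^sup>2 / \<bar>\<Delta>\<bar>) * s)\<^sup>2" by (rule power_mono) simp
      then show ?thesis by (simp add: C_def power_mult_distrib s0 mult.assoc)
    qed
    ultimately show "\<exists>y1 y2 y3 y4. ode4 p0 p1 p2 f y1 y2 y3 y4 \<and>
      y1 0 = 0 \<and> y2 0 = 0 \<and> y1 1 = 0 \<and> y2 1 = 0 \<and> (\<forall>x\<in>{0..1}. (y1 x)\<^sup>2 \<le> C * (LINT t|leb_I. (f t)\<^sup>2))"
      unfolding F_def by blast
  qed
qed

subsection \<open>Coercivity of the quadratic form\<close>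

text \<open>The trial class: C^2 up to the boundary, with the derivatives carried along. It contains
  the test functions as well as the solutions of the boundary value problem.\<close>

definition clamped where
  "clamped f f1 f2 \<longleftrightarrow> (\<forall>x\<in>{0..1::real}. (f has_real_derivative f1 x) (at x within {0..1}) \<and>
     (f1 has_real_derivative f2 x) (at x within {0..1})) \<and> continuous_on {0..1} f2 \<and>
     f 0 = 0 \<and> f1 0 = 0 \<and> f 1 = 0 \<and> f1 1 = (0::real)"

lemma clampedD:
  assumes "clamped f f1 f2"
  shows "x \<in> {0..1} \<Longrightarrow> (f has_real_derivative f1 x) (at x within {0..1})"
    "x \<in> {0..1} \<Longrightarrow> (f1 has_real_derivative f2 x) (at x within {0..1})"
    "continuous_on {0..1} f2" "continuous_on {0..1} f1" "continuous_on {0..1} f"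
    "f 0 = 0" "f1 0 = 0" "f 1 = 0" "f1 1 = 0"
  using assms unfolding clamped_def by (blast intro: DERIV_continuous_on)+

lemma clamped_combine:
  assumes "clamped f f1 f2" "clamped h h1 h2"
  shows "clamped (\<lambda>x. f x - t * h x) (\<lambda>x. f1 x - t * h1 x) (\<lambda>x. f2 x - t * h2 x)"
  unfolding clamped_def using clampedD[OF assms(1)] clampedD[OF assms(2)]
  by (auto intro!: DERIV_diff DERIV_cmult continuous_intros)

lemma clamped_poincare:
  assumes "clamped f f1 f2"
  shows "(LINT x|leb_I. (f1 x)\<^sup>2) \<le> 4 * (LINT x|leb_I. (f2 x)\<^sup>2)"
  using clampedD[OF assms] by (intro poincare_C1)

text \<open>The form is the integral of e f''^2 + P f'^2 + R f^2, with Euler operator e y'''' - (P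
  y')' + R y. No sign is imposed on \<open>R\<close>, so the form can be indefinite.\<close>

locale clamped_form =
  fixes e :: real and P P' R :: "real \<Rightarrow> real"
  assumes e: "0 < e" and P: "\<And>x. x \<in> {0..1} \<Longrightarrow> (P has_real_derivative P' x) (at x within {0..1})"
    and P': "continuous_on {0..1} P'" and P0: "\<And>x. x \<in> {0..1} \<Longrightarrow> 0 \<le> P x" and R: "continuous_on {0..1} R"
begin

definition "Q f f1 f2 = (LINT x|leb_I. e * (f2 x)\<^sup>2 + P x * (f1 x)\<^sup>2 + R x * (f x)\<^sup>2)"

definition "solution f y1 y2 y3 y4 \<longleftrightarrow> ode4 (\<lambda>x. - R x / e) (\<lambda>x. P' x / e) (\<lambda>x. P x / e) f y1 y2 y3 y4 \<and>
  y1 0 = 0 \<and> y2 0 = 0 \<and> y1 1 = 0 \<and> y2 1 = 0"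

lemma cP: "continuous_on {0..1} P" by (rule DERIV_continuous_on[OF P])

lemma solution_clamped: "solution f y1 y2 y3 y4 \<Longrightarrow> clamped y1 y2 y3"
  unfolding solution_def clamped_def using ode4D[of _ _ _ f y1 y2 y3 y4] ode4_continuous(3)[of _ _ _ f y1 y2 y3 y4] by blast

text \<open>Two integrations by parts in one step: e f' y'' - e f y''' + P f y' has as derivative
  the left integrand minus h f, by the equation, and it vanishes at both ends because
  \<open>f\<close> is clamped.\<close>

lemma weak_form:
  assumes s: "solution (\<lambda>x. h x / e) y1 y2 y3 y4" and f: "clamped f f1 f2" and h: "continuous_on {0..1} h"
  shows "(LINT x|leb_I. e * (f2 x * y3 x) + P x * (f1 x * y2 x) + R x * (f x * y1 x)) = (LINT x|leb_I. h x * f x)"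
proof -
  have o: "ode4 (\<lambda>x. - R x / e) (\<lambda>x. P' x / e) (\<lambda>x. P x / e) (\<lambda>x. h x / e) y1 y2 y3 y4"
    using s by (simp add: solution_def)
  note oc = ode4_continuous[OF o] and fd = clampedD[OF f]
  let ?l = "\<lambda>x. e * (f2 x * y3 x) + P x * (f1 x * y2 x) + R x * (f x * y1 x)"
  have c: "continuous_on {0..1} ?l" "continuous_on {0..1} (\<lambda>x. h x * f x)"
    by (intro continuous_intros oc fd cP R h)+
  have "(LINT x|leb_I. ?l x - h x * f x) = (e * (f1 1 * y3 1) - e * (f 1 * y4 1) + f 1 * (P 1 * y2 1))
     - (e * (f1 0 * y3 0) - e * (f 0 * y4 0) + f 0 * (P 0 * y2 0))"
  proof (rule lint_FTC)
    show "continuous_on {0..1} (\<lambda>x. ?l x - h x * f x)" by (intro continuous_on_diff c)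
    fix x :: real assume x: "x \<in> {0..1}"
    have "e * (- R x / e * y1 x + P' x / e * y2 x + P x / e * y3 x + h x / e) = - R x * y1 x + P' x * y2 x + P x * y3 x + h x"
      using e by (simp add: field_simps)
    then obtain q where q: "q = - R x / e * y1 x + P' x / e * y2 x + P x / e * y3 x + h x / e"
      and "e * q = - R x * y1 x + P' x * y2 x + P x * y3 x + h x" by blast
    then have k: "f x * (e * q) = f x * (- R x * y1 x + P' x * y2 x + P x * y3 x + h x)" by simp
    have "((\<lambda>x. e * (f1 x * y3 x) - e * (f x * y4 x) + f x * (P x * y2 x)) has_real_derivative
       e * (f2 x * y3 x + y4 x * f1 x) - e * (f1 x * y4 x + q * f x)
       + (f1 x * (P x * y2 x) + (P' x * y2 x + y3 x * P x) * f x)) (at x within {0..1})"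
      unfolding q by (intro DERIV_add DERIV_diff DERIV_cmult DERIV_mult fd(1,2)[OF x] P[OF x] ode4D[OF o x])
    then show "((\<lambda>x. e * (f1 x * y3 x) - e * (f x * y4 x) + f x * (P x * y2 x)) has_real_derivative ?l x - h x * f x) (at x within {0..1})"
      by (rule DERIV_cong) (use k in \<open>simp add: algebra_simps\<close>)
  qed
  then show ?thesis using c[THEN integrable_continuous_I] by (simp add: fd)
qed

text \<open>With \<open>y\<close> the solution of the boundary value problem with right-hand side \<open>f\<close>, positivity of the form at
  \<open>f - t * y\<close> for a suitable \<open>t\<close> bounds the \<open>L\<^sup>2\<close> norm of \<open>f\<close> by the form at \<open>f\<close>.\<close>

lemma coercive:
  assumes nonneg: "\<And>f f1 f2. clamped f f1 f2 \<Longrightarrow> 0 \<le> Q f f1 f2"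
    and uniq: "\<And>y1 y2 y3 y4 x. solution (\<lambda>x. 0) y1 y2 y3 y4 \<Longrightarrow> x \<in> I01 \<Longrightarrow> y1 x = 0"
  obtains c where "0 < c" "\<And>f f1 f2. clamped f f1 f2 \<Longrightarrow>
    c * ((LINT x|leb_I. (f x)\<^sup>2) + (LINT x|leb_I. (f1 x)\<^sup>2) + (LINT x|leb_I. (f2 x)\<^sup>2)) \<le> Q f f1 f2"
proof -
  have cp: "continuous_on {0..1} (\<lambda>x. - R x / e)" "continuous_on {0..1} (\<lambda>x. P' x / e)" "continuous_on {0..1} (\<lambda>x. P x / e)"
    using e by (auto intro!: continuous_intros R P' cP)
  have u: "y1 x = 0" if "ode4 (\<lambda>x. - R x / e) (\<lambda>x. P' x / e) (\<lambda>x. P x / e) (\<lambda>x. 0) y1 y2 y3 y4" "y1 0 = 0" "y2 0 = 0" "y1 1 = 0"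
      "y2 1 = 0" "x \<in> I01" for y1 y2 y3 y4 x
    using uniq[of y1 y2 y3 y4 x] that by (simp add: solution_def)
  have "\<exists>C\<ge>0. \<forall>f. continuous_on {0..1} f \<longrightarrow> (\<exists>y1 y2 y3 y4. ode4 (\<lambda>x. - R x / e) (\<lambda>x. P' x / e) (\<lambda>x. P x / e) f y1 y2 y3 y4 \<and>
    y1 0 = 0 \<and> y2 0 = 0 \<and> y1 1 = 0 \<and> y2 1 = 0 \<and> (\<forall>x\<in>{0..1}. (y1 x)\<^sup>2 \<le> C * (LINT t|leb_I. (f t)\<^sup>2)))"
    by (rule clamped_bvp_solvable[OF cp]) (rule u)
  then obtain C where C: "0 \<le> C" "\<And>f. continuous_on {0..1} f \<Longrightarrow> \<exists>y1 y2 y3 y4. solution f y1 y2 y3 y4 \<and>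
     (\<forall>x\<in>{0..1}. (y1 x)\<^sup>2 \<le> C * (LINT t|leb_I. (f t)\<^sup>2))"
    unfolding solution_def by auto
  \<comment> \<open>From f y \<le> (f^2 + y^2)/2 and y^2 \<le> C n / e^2, with n the integral of
    f^2: the form at the solution is at most \<kappa> n.\<close>
  define \<kappa> where "\<kappa> = 1/2 + C / (2 * e\<^sup>2)"
  have \<kappa>: "0 < \<kappa>" using C e by (auto simp: \<kappa>_def intro: add_pos_nonneg)
  obtain r where r': "\<And>x. x \<in> {0..1} \<Longrightarrow> \<bar>R x\<bar> \<le> r"
    using compact_imp_bounded[OF compact_continuous_image[OF R compact_Icc]]
    unfolding bounded_iff by (metis image_eqI real_norm_def)
  have r0: "0 \<le> r" using r'[of 0] by auto
  have L2: "(LINT x|leb_I. (f x)\<^sup>2) \<le> \<kappa> * Q f f1 f2" if f: "clamped f f1 f2" for f f1 f2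
  proof -
    note fd = clampedD[OF f]
    have "continuous_on {0..1} (\<lambda>x. f x / e)" using e fd by (auto intro!: continuous_intros)
    then obtain y1 y2 y3 y4 where s: "solution (\<lambda>x. f x / e) y1 y2 y3 y4"
      and b: "\<And>x. x \<in> {0..1} \<Longrightarrow> (y1 x)\<^sup>2 \<le> C * (LINT t|leb_I. (f t / e)\<^sup>2)" using C(2) by blast
    have y: "clamped y1 y2 y3" by (rule solution_clamped[OF s])
    note yd = clampedD[OF y]
    define n where "n = (LINT x|leb_I. (f x)\<^sup>2)"
    have n0: "0 \<le> n" unfolding n_def by (rule lint_nonneg_I) simp
    \<comment> \<open>The bilinear form paired with the solution \<open>y\<close> reproduces the
      squared norm of \<open>f\<close>, because \<open>f\<close> is the right-hand side.\<close>
    have e1: "(LINT x|leb_I. e * (f2 x * y3 x) + P x * (f1 x * y2 x) + R x * (f x * y1 x)) = n"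
      using weak_form[OF s f fd(5)] by (simp add: n_def power2_eq_square)
    have e2: "Q y1 y2 y3 = (LINT x|leb_I. f x * y1 x)"
      using weak_form[OF s y fd(5)] by (simp add: Q_def power2_eq_square)
    have F: "(LINT t|leb_I. (f t / e)\<^sup>2) = n / e\<^sup>2" by (simp add: n_def power_divide)
    have "(LINT x|leb_I. f x * y1 x) \<le> (LINT x|leb_I. 1/2 * (f x)\<^sup>2 + 1/2 * (C * (n / e\<^sup>2)))"
    proof (rule lint_mono_I)
      fix x :: real assume "x \<in> I01"
      then have "(y1 x)\<^sup>2 \<le> C * (n / e\<^sup>2)" using b[of x] F by simp
      then show "f x * y1 x \<le> 1/2 * (f x)\<^sup>2 + 1/2 * (C * (n / e\<^sup>2))" using sum_squares_bound[of "f x" "y1 x"] by simp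
    qed (auto intro!: integrable_continuous_I continuous_intros fd yd)
    also have "\<dots> = (LINT x|leb_I. 1/2 * (f x)\<^sup>2) + (LINT x|leb_I. 1/2 * (C * (n / e\<^sup>2)))"
      by (intro Bochner_Integration.integral_add integrable_continuous_I continuous_intros fd)
    also have "\<dots> = 1/2 * n + 1/2 * (C * (n / e\<^sup>2))"
      by (simp only: lint_const_I integral_mult_right_zero n_def)
    also have "\<dots> = \<kappa> * n" by (simp add: \<kappa>_def algebra_simps)
    finally have e3: "Q y1 y2 y3 \<le> \<kappa> * n" using e2 by simp
    \<comment> \<open>This minimizes -2 t n + t^2 \<kappa> n, with minimum -n / \<kappa>.\<close>
    define t where "t = 1 / \<kappa>"
    have "0 \<le> Q (\<lambda>x. f x - t * y1 x) (\<lambda>x. f1 x - t * y2 x) (\<lambda>x. f2 x - t * y3 x)"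
      by (rule nonneg[OF clamped_combine[OF f y]])
    also have "\<dots> = (LINT x|leb_I. (e * (f2 x)\<^sup>2 + P x * (f1 x)\<^sup>2 + R x * (f x)\<^sup>2)
       - 2 * t * (e * (f2 x * y3 x) + P x * (f1 x * y2 x) + R x * (f x * y1 x))
       + t\<^sup>2 * (e * (y3 x)\<^sup>2 + P x * (y2 x)\<^sup>2 + R x * (y1 x)\<^sup>2))"
      unfolding Q_def by (rule lint_cong_I) (simp add: power2_eq_square algebra_simps)
    also have "\<dots> = Q f f1 f2 - 2 * t * n + t\<^sup>2 * Q y1 y2 y3"
    proof -
      have i: "integrable leb_I (\<lambda>x. e * (f2 x)\<^sup>2 + P x * (f1 x)\<^sup>2 + R x * (f x)\<^sup>2)"
        "integrable leb_I (\<lambda>x. e * (f2 x * y3 x) + P x * (f1 x * y2 x) + R x * (f x * y1 x))"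
        "integrable leb_I (\<lambda>x. e * (y3 x)\<^sup>2 + P x * (y2 x)\<^sup>2 + R x * (y1 x)\<^sup>2)"
        by (intro integrable_continuous_I continuous_intros fd yd cP R)+
      show ?thesis
        unfolding Q_def e1[symmetric]
        by (subst Bochner_Integration.integral_add, intro Bochner_Integration.integrable_diff integrable_mult_right i,
            intro integrable_mult_right i, subst Bochner_Integration.integral_diff, intro i, intro integrable_mult_right i)
           (simp only: integral_mult_right_zero)
    qed
    also have "\<dots> \<le> Q f f1 f2 - 2 * t * n + t\<^sup>2 * (\<kappa> * n)" using e3 by (intro add_left_mono mult_left_mono) auto
    also have "\<dots> = Q f f1 f2 - n / \<kappa>" using \<kappa> by (simp add: t_def power2_eq_square field_simps)
    finally have "n / \<kappa> \<le> Q f f1 f2" by simp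
    then show ?thesis using \<kappa> by (simp add: n_def divide_le_eq mult.commute)
  qed
  \<comment> \<open>The L2 bound contributes \<kappa>. The integral of f''^2 is at most (1 + r
    \<kappa>) / e times the form, and it counts 1 + 4 times because of the Poincare inequality for
    f'.\<close>
  define c where "c = 1 / (\<kappa> + 5 * ((1 + r * \<kappa>) / e))"
  have den: "0 < \<kappa> + 5 * ((1 + r * \<kappa>) / e)" using \<kappa> r0 e by (intro add_pos_nonneg) auto
  show thesis
  proof (rule that)
    show "0 < c" using den by (simp add: c_def)
    fix f f1 f2 assume f: "clamped f f1 f2"
    note fd = clampedD[OF f]
    have "e * (LINT x|leb_I. (f2 x)\<^sup>2) - r * (LINT x|leb_I. (f x)\<^sup>2) = (LINT x|leb_I. e * (f2 x)\<^sup>2 - r * (f x)\<^sup>2)"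
      by (subst Bochner_Integration.integral_diff) (auto intro!: integrable_continuous_I continuous_intros fd)
    also have "\<dots> \<le> Q f f1 f2" unfolding Q_def
    proof (rule lint_mono_I)
      fix x :: real assume "x \<in> I01"
      then have "0 \<le> P x" "- r \<le> R x" using P0[of x] r'[of x] by auto
      then have "0 \<le> P x * (f1 x)\<^sup>2" "- r * (f x)\<^sup>2 \<le> R x * (f x)\<^sup>2"
        by (intro mult_nonneg_nonneg mult_right_mono; simp)+
      then show "e * (f2 x)\<^sup>2 - r * (f x)\<^sup>2 \<le> e * (f2 x)\<^sup>2 + P x * (f1 x)\<^sup>2 + R x * (f x)\<^sup>2" by simp
    qed (auto intro!: integrable_continuous_I continuous_intros fd cP R)
    finally have "e * (LINT x|leb_I. (f2 x)\<^sup>2) \<le> Q f f1 f2 + r * (\<kappa> * Q f f1 f2)"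
      using mult_left_mono[OF L2[OF f] r0] by linarith
    then have "(LINT x|leb_I. (f2 x)\<^sup>2) \<le> (1 + r * \<kappa>) / e * Q f f1 f2"
      using e by (simp add: field_simps)
    then have "(LINT x|leb_I. (f x)\<^sup>2) + (LINT x|leb_I. (f1 x)\<^sup>2) + (LINT x|leb_I. (f2 x)\<^sup>2)
       \<le> \<kappa> * Q f f1 f2 + 5 * ((1 + r * \<kappa>) / e * Q f f1 f2)"
      using L2[OF f] clamped_poincare[OF f] by linarith
    also have "\<dots> = (\<kappa> + 5 * ((1 + r * \<kappa>) / e)) * Q f f1 f2" by (simp add: algebra_simps)
    finally show "c * ((LINT x|leb_I. (f x)\<^sup>2) + (LINT x|leb_I. (f1 x)\<^sup>2) + (LINT x|leb_I. (f2 x)\<^sup>2)) \<le> Q f f1 f2"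
      using den by (simp add: c_def divide_le_eq mult.commute)
  qed
qed

end

subsection \<open>Existence of a characteristic value\<close>

text \<open>Bootstrapping all four components together: order \<open>n\<close> for each gives order
  \<open>n\<close> of their derivatives, the last one through the equation.\<close>

lemma ode4_smooth:
  assumes o: "ode4 p0 p1 p2 (\<lambda>x. 0) y1 y2 y3 y4"
    and p: "p0 \<in> Cinf_I" "p1 \<in> Cinf_I" "p2 \<in> Cinf_I"
  shows "y1 \<in> Cinf_I"
proof -
  have "Cn_on n {0..1} y1 \<and> Cn_on n {0..1} y2 \<and> Cn_on n {0..1} y3 \<and> Cn_on n {0..1} y4" for n
  proof (induction n)
    case 0
    show ?case using ode4_continuous[OF o] by simp
  next
    case (Suc n)
    have "Cn_on n {0..1} (\<lambda>x. p0 x * y1 x + p1 x * y2 x + p2 x * y3 x + 0)"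
      using Suc p unfolding Cinf_I_iff by (intro Cn_on_add Cn_on_mult Cn_on_const) auto
    then show ?case using Suc
      by (intro conjI Cn_on_SucI[OF ode4D(1)[OF o]] Cn_on_SucI[OF ode4D(2)[OF o]] Cn_on_SucI[OF ode4D(3)[OF o]]
          Cn_on_SucI[OF ode4D(4)[OF o]]) auto
  qed
  then show ?thesis unfolding Cinf_I_iff by blast
qed

lemma Cinf_I_closed:
  assumes "f \<in> Cinf_I" "h \<in> Cinf_I"
  shows "(\<lambda>x. f x + h x) \<in> Cinf_I" "(\<lambda>x. f x - h x) \<in> Cinf_I" "(\<lambda>x. f x * h x) \<in> Cinf_I"
  using assms unfolding Cinf_I_iff by (auto intro: Cn_on_add Cn_on_diff Cn_on_mult)

lemma Cinf_I_const: "(\<lambda>x. c) \<in> Cinf_I"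
  unfolding Cinf_I_iff by simp

lemma test_fun_clamped:
  assumes "\<psi> \<in> test_fun"
  shows "clamped \<psi> (deriv \<psi>) (deriv (deriv \<psi>))"
  unfolding clamped_def
  using test_fun_deriv[OF assms, of 0] test_fun_deriv[OF assms, of 1] test_fun_continuous[OF assms, of "{0..1}" 2]
    test_fun_boundary[OF assms, of 0 0] test_fun_boundary[OF assms, of 0 1] test_fun_boundary[OF assms, of 1 0] test_fun_boundary[OF assms, of 1 1]
  by (auto simp: numeral_2_eq_2 intro: has_field_derivative_at_within)

section \<open>The quadratic form of the stratified fluid\<close>

locale stratified_fluid =
  fixes \<rho> :: "real \<Rightarrow> real" and g \<mu> k \<sigma> a m :: real
  assumes \<rho>: "\<rho> \<in> Cinf_I" "\<And>x. x \<in> {0..1} \<Longrightarrow> a \<le> \<rho> x" "\<And>x. x \<in> {0..1} \<Longrightarrow> m \<le> D \<rho> x"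
    and pos: "0 < a" "0 < m" "0 < g" "0 < \<mu>" "0 < k" "0 < \<sigma>"
begin

abbreviation "r \<equiv> D \<rho>"

text \<open>Collecting all terms on the left, the boundary value problem reads l \<mu> \<phi>'''' -
  (P \<phi>')' + R \<phi> = 0. The middle part -2 k^2 \<phi>'' of the viscous term enters
  \<open>P\<close> and the part k^4 \<phi> enters \<open>R\<close>.\<close>

definition "P l x = l\<^sup>2 * \<rho> x + 2 * l * \<mu> * k\<^sup>2 + \<sigma> * k\<^sup>2 * (r x)\<^sup>2"
definition "P' l x = l\<^sup>2 * r x + \<sigma> * k\<^sup>2 * (2 * r x * D r x)"
definition "R l x = l\<^sup>2 * k\<^sup>2 * \<rho> x + l * \<mu> * k ^ 4 - k\<^sup>2 * (g * r x - \<sigma> * k\<^sup>2 * (r x)\<^sup>2)"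

lemma smooth: "r \<in> Cinf_I" "D r \<in> Cinf_I" "P l \<in> Cinf_I" "P' l \<in> Cinf_I" "R l \<in> Cinf_I"
proof -
  show r: "r \<in> Cinf_I" "D r \<in> Cinf_I" using Cinf_I_D(1) \<rho>(1) by auto
  show "P l \<in> Cinf_I" "P' l \<in> Cinf_I" "R l \<in> Cinf_I"
    unfolding P_def[abs_def] P'_def[abs_def] R_def[abs_def] power2_eq_square[of "r _"]
    by (intro Cinf_I_closed Cinf_I_const r \<rho>(1))+
qed

lemma P_deriv: "x \<in> {0..1} \<Longrightarrow> (P l has_real_derivative P' l x) (at x within {0..1})"
  unfolding P_def[abs_def] P'_def
  using Cinf_I_D(3)[OF \<rho>(1), of x 0] Cinf_I_D(3)[OF \<rho>(1), of x 1] by (auto intro!: derivative_eq_intros)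

lemma clamped_form: "0 < l \<Longrightarrow> clamped_form (l * \<mu>) (P l) (P' l) (R l)"
proof (unfold_locales, goal_cases)
  case (4 x)
  then show ?case using \<rho>(2)[of x] pos unfolding P_def by (intro add_nonneg_nonneg mult_nonneg_nonneg) auto
qed (use pos P_deriv smooth Cinf_I_continuous in auto)

definition "qf l f f1 f2 = clamped_form.Q (l * \<mu>) (P l) (R l) f f1 f2"
text \<open>These are A, B and C of the overview: inertia, viscous dissipation, and gravity minus
  capillarity. The last one is k^2 times the expression made positive by \<open>\<sigma>\<close>
  below the critical constant.\<close>

definition "fA f f1 = (LINT x|leb_I. \<rho> x * (k\<^sup>2 * (f x)\<^sup>2 + (f1 x)\<^sup>2))"
definition "fB f f1 f2 = (LINT x|leb_I. \<mu> * ((f2 x)\<^sup>2 + 2 * k\<^sup>2 * (f1 x)\<^sup>2 + k ^ 4 * (f x)\<^sup>2))"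
definition "fC f f1 = k\<^sup>2 * ((LINT x|leb_I. (g * r x - \<sigma> * k\<^sup>2 * (r x)\<^sup>2) * (f x)\<^sup>2) - (LINT x|leb_I. \<sigma> * (r x)\<^sup>2 * (f1 x)\<^sup>2))"

lemma qf_split:
  assumes f: "clamped f f1 f2" and l: "0 < l"
  shows "qf l f f1 f2 = l\<^sup>2 * fA f f1 + l * fB f f1 f2 - fC f f1"
proof -
  note fd = clampedD[OF f] and c = Cinf_I_continuous[OF \<rho>(1)] Cinf_I_continuous[OF smooth(1)]
  have i: "integrable leb_I (\<lambda>x. \<rho> x * (k\<^sup>2 * (f x)\<^sup>2 + (f1 x)\<^sup>2))"
    "integrable leb_I (\<lambda>x. \<mu> * ((f2 x)\<^sup>2 + 2 * k\<^sup>2 * (f1 x)\<^sup>2 + k ^ 4 * (f x)\<^sup>2))"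
    "integrable leb_I (\<lambda>x. (g * r x - \<sigma> * k\<^sup>2 * (r x)\<^sup>2) * (f x)\<^sup>2)"
    "integrable leb_I (\<lambda>x. \<sigma> * (r x)\<^sup>2 * (f1 x)\<^sup>2)"
    by (intro integrable_continuous_I continuous_intros fd c)+
  have C: "fC f f1 = (LINT x|leb_I. k\<^sup>2 * ((g * r x - \<sigma> * k\<^sup>2 * (r x)\<^sup>2) * (f x)\<^sup>2 - \<sigma> * (r x)\<^sup>2 * (f1 x)\<^sup>2))"
    unfolding fC_def by (simp only: integral_mult_right_zero Bochner_Integration.integral_diff[OF i(3,4)])
  have "qf l f f1 f2 = (LINT x|leb_I. (l\<^sup>2 * (\<rho> x * (k\<^sup>2 * (f x)\<^sup>2 + (f1 x)\<^sup>2)) + l * (\<mu> * ((f2 x)\<^sup>2 + 2 * k\<^sup>2 * (f1 x)\<^sup>2 + k ^ 4 * (f x)\<^sup>2)))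
    - k\<^sup>2 * ((g * r x - \<sigma> * k\<^sup>2 * (r x)\<^sup>2) * (f x)\<^sup>2 - \<sigma> * (r x)\<^sup>2 * (f1 x)\<^sup>2))"
    unfolding qf_def clamped_form.Q_def[OF clamped_form[OF l]] P_def R_def
    by (rule lint_cong_I) (simp add: algebra_simps)
  also have "\<dots> = (LINT x|leb_I. l\<^sup>2 * (\<rho> x * (k\<^sup>2 * (f x)\<^sup>2 + (f1 x)\<^sup>2)) + l * (\<mu> * ((f2 x)\<^sup>2 + 2 * k\<^sup>2 * (f1 x)\<^sup>2 + k ^ 4 * (f x)\<^sup>2)))
     - (LINT x|leb_I. k\<^sup>2 * ((g * r x - \<sigma> * k\<^sup>2 * (r x)\<^sup>2) * (f x)\<^sup>2 - \<sigma> * (r x)\<^sup>2 * (f1 x)\<^sup>2))"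
    by (intro Bochner_Integration.integral_diff Bochner_Integration.integrable_add Bochner_Integration.integrable_diff integrable_mult_right i)
  also have "\<dots> = l\<^sup>2 * fA f f1 + l * fB f f1 f2 - fC f f1"
    unfolding C fA_def fB_def
    by (simp only: Bochner_Integration.integral_add[OF integrable_mult_right[OF i(1)] integrable_mult_right[OF i(2)]] integral_mult_right_zero)
  finally show ?thesis .
qed

lemma fA_nonneg: "0 \<le> fA f f1"
  unfolding fA_def using \<rho>(2) pos by (intro lint_nonneg_I mult_nonneg_nonneg add_nonneg_nonneg) (auto intro: order_trans[of 0 a])

lemma fB_nonneg: "0 \<le> fB f f1 f2"
  unfolding fB_def using pos by (intro lint_nonneg_I) auto

text \<open>Makes the change of the form under a change of \<open>l\<close> small relative to the
  norms controlled by coercivity.\<close>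

lemma fAB_bound:
  obtains K where "0 < K" "\<And>f f1 f2. clamped f f1 f2 \<Longrightarrow>
    fA f f1 + fB f f1 f2 \<le> K * ((LINT x|leb_I. (f x)\<^sup>2) + (LINT x|leb_I. (f1 x)\<^sup>2) + (LINT x|leb_I. (f2 x)\<^sup>2))"
proof -
  obtain M where M: "0 \<le> M" "\<And>x. x \<in> {0..1} \<Longrightarrow> \<bar>\<rho> x\<bar> \<le> M" using Cinf_I_bound[OF \<rho>(1)] by blast
  define K where "K = M * (k\<^sup>2 + 1) + \<mu> * (1 + 2 * k\<^sup>2 + k ^ 4)"
  show thesis
  proof (rule that)
    show "0 < K" unfolding K_def using M pos by (intro add_nonneg_pos mult_nonneg_nonneg mult_pos_pos add_pos_nonneg) auto
    fix f f1 f2 assume f: "clamped f f1 f2"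
    note fd = clampedD[OF f] and c = Cinf_I_continuous[OF \<rho>(1)]
    have i: "integrable leb_I (\<lambda>x. \<rho> x * (k\<^sup>2 * (f x)\<^sup>2 + (f1 x)\<^sup>2))"
      "integrable leb_I (\<lambda>x. \<mu> * ((f2 x)\<^sup>2 + 2 * k\<^sup>2 * (f1 x)\<^sup>2 + k ^ 4 * (f x)\<^sup>2))"
      "integrable leb_I (\<lambda>x. (f x)\<^sup>2)" "integrable leb_I (\<lambda>x. (f1 x)\<^sup>2)" "integrable leb_I (\<lambda>x. (f2 x)\<^sup>2)"
      by (intro integrable_continuous_I continuous_intros fd c)+
    have "fA f f1 + fB f f1 f2 = (LINT x|leb_I. \<rho> x * (k\<^sup>2 * (f x)\<^sup>2 + (f1 x)\<^sup>2) + \<mu> * ((f2 x)\<^sup>2 + 2 * k\<^sup>2 * (f1 x)\<^sup>2 + k ^ 4 * (f x)\<^sup>2))"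
      unfolding fA_def fB_def by (rule Bochner_Integration.integral_add[OF i(1,2), symmetric])
    also have "\<dots> \<le> (LINT x|leb_I. K * ((f x)\<^sup>2 + (f1 x)\<^sup>2 + (f2 x)\<^sup>2))"
    proof (rule lint_mono_I)
      fix x :: real assume "x \<in> I01"
      then have "\<rho> x \<le> M" using M(2)[of x] by auto
      define s where "s = (f x)\<^sup>2 + (f1 x)\<^sup>2 + (f2 x)\<^sup>2"
      have s: "(f x)\<^sup>2 \<le> s" "(f1 x)\<^sup>2 \<le> s" "(f2 x)\<^sup>2 \<le> s" by (auto simp: s_def)
      have "\<rho> x * (k\<^sup>2 * (f x)\<^sup>2 + (f1 x)\<^sup>2) \<le> M * (k\<^sup>2 * s + s)"
        using \<open>\<rho> x \<le> M\<close> M(1) s by (intro mult_mono add_mono mult_left_mono) auto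
      moreover have "\<mu> * ((f2 x)\<^sup>2 + 2 * k\<^sup>2 * (f1 x)\<^sup>2 + k ^ 4 * (f x)\<^sup>2) \<le> \<mu> * (s + 2 * k\<^sup>2 * s + k ^ 4 * s)"
        using pos s by (intro add_mono mult_left_mono) auto
      ultimately show "\<rho> x * (k\<^sup>2 * (f x)\<^sup>2 + (f1 x)\<^sup>2) + \<mu> * ((f2 x)\<^sup>2 + 2 * k\<^sup>2 * (f1 x)\<^sup>2 + k ^ 4 * (f x)\<^sup>2) \<le> K * ((f x)\<^sup>2 + (f1 x)\<^sup>2 + (f2 x)\<^sup>2)"
        unfolding s_def[symmetric] K_def by (simp add: algebra_simps)
    qed (intro Bochner_Integration.integrable_add integrable_mult_right i)+
    also have "\<dots> = K * ((LINT x|leb_I. (f x)\<^sup>2) + (LINT x|leb_I. (f1 x)\<^sup>2) + (LINT x|leb_I. (f2 x)\<^sup>2))"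
      using i by simp
    finally show "fA f f1 + fB f f1 f2 \<le> K * ((LINT x|leb_I. (f x)\<^sup>2) + (LINT x|leb_I. (f1 x)\<^sup>2) + (LINT x|leb_I. (f2 x)\<^sup>2))" .
  qed
qed

definition "unstable = {l. 0 < l \<and> (\<exists>f f1 f2. clamped f f1 f2 \<and> qf l f f1 f2 < 0)}"

lemma unstable_bounded: "bdd_above unstable"
proof -
  obtain M where M: "0 \<le> M" "\<And>x. x \<in> {0..1} \<Longrightarrow> \<bar>r x\<bar> \<le> M" using Cinf_I_bound[OF smooth(1)] by blast
  \<comment> \<open>For l > L \<ge> 1 one has a l^2 \<ge> a l \<ge> g M, so inertia outweighs
    gravity pointwise and \<open>R\<close> is nonnegative.\<close>
  define L where "L = 1 + g * M / a"
  have "l \<le> L" if lu: "l \<in> unstable" for l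
  proof (rule ccontr)
    assume "\<not> l \<le> L"
    then have l: "L < l" by simp
    have L1: "1 \<le> L" using M pos by (simp add: L_def)
    obtain f f1 f2 where f: "clamped f f1 f2" "qf l f f1 f2 < 0" using lu unfolding unstable_def by blast
    have l0: "0 < l" using l L1 by simp
    have "l * 1 \<le> l * l" using l L1 by (intro mult_left_mono) auto
    moreover have "g * M \<le> a * L" using pos by (simp add: L_def distrib_left)
    moreover have "a * L \<le> a * l" using l pos by simp
    moreover have "a * (l * 1) \<le> a * (l * l)" by (rule mult_left_mono[OF calculation(1)]) (use pos in simp)
    ultimately have gM: "g * M \<le> l\<^sup>2 * a" by (simp add: power2_eq_square mult.commute)
    have "0 \<le> qf l f f1 f2"
      unfolding qf_def clamped_form.Q_def[OF clamped_form[OF l0]]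
    proof (rule lint_nonneg_I)
      fix x :: real assume x: "x \<in> I01"
      then have xI: "x \<in> {0..1}" by auto
      have "g * r x \<le> g * M" using M(2)[OF xI] pos by auto
      also have "\<dots> \<le> l\<^sup>2 * \<rho> x" using gM \<rho>(2)[OF xI] mult_left_mono[of a "\<rho> x" "l\<^sup>2"] by simp
      finally have "k\<^sup>2 * (g * r x) \<le> k\<^sup>2 * (l\<^sup>2 * \<rho> x)" by (rule mult_left_mono) simp
      moreover have "0 \<le> l * \<mu> * k ^ 4" "0 \<le> k\<^sup>2 * (\<sigma> * k\<^sup>2 * (r x)\<^sup>2)" using l0 pos by auto
      ultimately have "0 \<le> R l x" unfolding R_def by (simp add: right_diff_distrib mult.left_commute mult.assoc)
      moreover have "0 \<le> P l x" using clamped_form.P0[OF clamped_form[OF l0] xI] .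
      ultimately show "0 \<le> l * \<mu> * (f2 x)\<^sup>2 + P l x * (f1 x)\<^sup>2 + R l x * (f x)\<^sup>2"
        using l0 pos by (intro add_nonneg_nonneg mult_nonneg_nonneg) auto
    qed
    then show False using f(2) by simp
  qed
  then show ?thesis unfolding bdd_above_def by blast
qed

lemma unstable_nonempty:
  assumes "clamped f f1 f2" "0 < fC f f1"
  shows "unstable \<noteq> {}"
proof -
  define S where "S = fA f f1 + fB f f1 f2"
  have S: "0 \<le> S" using fA_nonneg fB_nonneg by (simp add: S_def)
  \<comment> \<open>With l \<le> 1 the quadratic term is at most the linear one, so their sum is at
    most l S < l (S + 1) \<le> \<open>fC\<close>; S + 1 is positive even when S is zero.\<close>
  define l where "l = min 1 (fC f f1 / (S + 1))"
  have l: "0 < l" "l \<le> 1" using assms(2) S by (auto simp: l_def)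
  have "l\<^sup>2 * fA f f1 \<le> l * fA f f1" using l by (intro mult_right_mono fA_nonneg) (auto simp: power2_eq_square)
  then have "l\<^sup>2 * fA f f1 + l * fB f f1 f2 \<le> l * S" by (simp add: S_def distrib_left)
  also have "\<dots> < l * (S + 1)" using l by simp
  also have "\<dots> \<le> fC f f1 / (S + 1) * (S + 1)" using S by (intro mult_right_mono) (auto simp: l_def)
  also have "\<dots> = fC f f1" using S by simp
  finally have "qf l f f1 f2 < 0" using qf_split[OF assms(1) l(1)] by simp
  then show ?thesis unfolding unstable_def using assms(1) l by blast
qed

text \<open>The largest growth rate is the supremum of all \<open>l\<close> for which the form takes a negative value.
  If it were not a characteristic value, coercivity would persist for slightly smaller \<open>l\<close>.\<close>

lemma exists_solution:
  assumes "unstable \<noteq> {}"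
  obtains l y1 y2 y3 y4 x where "0 < l" "clamped_form.solution (l * \<mu>) (P l) (P' l) (R l) (\<lambda>x. 0) y1 y2 y3 y4"
    "x \<in> I01" "y1 x \<noteq> 0"
proof -
  define l where "l = Sup unstable"
  obtain l0 where l0: "l0 \<in> unstable" using assms by blast
  have up: "l' \<le> l" if "l' \<in> unstable" for l' unfolding l_def by (rule cSup_upper[OF that unstable_bounded])
  have "0 < l0" using l0 by (simp add: unstable_def)
  then have l: "0 < l" using up[OF l0] by simp
  interpret cf: clamped_form "l * \<mu>" "P l" "P' l" "R l" by (rule clamped_form[OF l])
  \<comment> \<open>A negative value at the supremum would, by continuity in the parameter for one
    fixed function, persist at some parameter beyond the supremum.\<close>
  have nonneg: "0 \<le> cf.Q f f1 f2" if f: "clamped f f1 f2" for f f1 f2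
  proof (rule ccontr)
    assume "\<not> 0 \<le> cf.Q f f1 f2"
    then have "l\<^sup>2 * fA f f1 + l * fB f f1 f2 - fC f f1 < 0" using qf_split[OF f l] by (simp add: qf_def)
    moreover have "((\<lambda>t. t\<^sup>2 * fA f f1 + t * fB f f1 f2 - fC f f1) \<longlongrightarrow> l\<^sup>2 * fA f f1 + l * fB f f1 f2 - fC f f1) (at_right l)"
      by (intro tendsto_intros)
    ultimately have "\<forall>\<^sub>F t in at_right l. t\<^sup>2 * fA f f1 + t * fB f f1 f2 - fC f f1 < 0" by (rule order_tendstoD(2)[rotated])
    then obtain b where b: "l < b" "\<And>t. l < t \<Longrightarrow> t < b \<Longrightarrow> t\<^sup>2 * fA f f1 + t * fB f f1 f2 - fC f f1 < 0"
      unfolding eventually_at_right_field by blast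
    define t where "t = (l + b) / 2"
    have t: "l < t" "t < b" using b(1) by (auto simp: t_def)
    have "qf t f f1 f2 < 0" using qf_split[OF f, of t] b(2)[OF t] t l by simp
    then have "t \<in> unstable" unfolding unstable_def using f t l by auto
    then show False using up t by force
  qed
  have "\<exists>y1 y2 y3 y4. \<exists>x\<in>I01. cf.solution (\<lambda>x. 0) y1 y2 y3 y4 \<and> y1 x \<noteq> 0"
  proof (rule ccontr)
    assume no: "\<not> ?thesis"
    have u: "y1 x = 0" if "cf.solution (\<lambda>x. 0) y1 y2 y3 y4" "x \<in> I01" for y1 y2 y3 y4 x
      using no that by blast
    obtain c where c: "0 < c" "\<And>f f1 f2. clamped f f1 f2 \<Longrightarrow>
      c * ((LINT x|leb_I. (f x)\<^sup>2) + (LINT x|leb_I. (f1 x)\<^sup>2) + (LINT x|leb_I. (f2 x)\<^sup>2)) \<le> cf.Q f f1 f2"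
      by (rule cf.coercive[OF nonneg]) (use u in auto)
    obtain K where K: "0 < K" "\<And>f f1 f2. clamped f f1 f2 \<Longrightarrow>
      fA f f1 + fB f f1 f2 \<le> K * ((LINT x|leb_I. (f x)\<^sup>2) + (LINT x|leb_I. (f1 x)\<^sup>2) + (LINT x|leb_I. (f2 x)\<^sup>2))"
      using fAB_bound by blast
    \<comment> \<open>Passing from l to l' \<le> l lowers the form by (l - l') ((l + l') A + B), at
      most (l - l') (2 l + 1) K times the sum of squared norms. Below this \<delta> the coercive
      term c absorbs the loss.\<close>
    define \<delta> where "\<delta> = c / ((2 * l + 1) * K)"
    have \<delta>: "0 < \<delta>" using c K l by (simp add: \<delta>_def)
    have "l' \<le> l - \<delta>" if l': "l' \<in> unstable" for l'
    proof (rule ccontr)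
      assume "\<not> l' \<le> l - \<delta>"
      then have d: "l - l' < \<delta>" "0 \<le> l - l'" using up[OF l'] by auto
      have l'0: "0 < l'" using l' by (simp add: unstable_def)
      obtain f f1 f2 where f: "clamped f f1 f2" "qf l' f f1 f2 < 0" using l' unfolding unstable_def by blast
      define N where "N = (LINT x|leb_I. (f x)\<^sup>2) + (LINT x|leb_I. (f1 x)\<^sup>2) + (LINT x|leb_I. (f2 x)\<^sup>2)"
      have N0: "0 \<le> N" unfolding N_def by (intro add_nonneg_nonneg lint_nonneg_I) auto
      have "cf.Q f f1 f2 - qf l' f f1 f2 = (l - l') * ((l + l') * fA f f1 + fB f f1 f2)"
        using qf_split[OF f(1) l] qf_split[OF f(1) l'0] by (simp add: qf_def power2_eq_square algebra_simps)
      also have "\<dots> \<le> (l - l') * ((2 * l + 1) * (fA f f1 + fB f f1 f2))"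
      proof (rule mult_left_mono)
        have "(l + l') * fA f f1 \<le> (2 * l + 1) * fA f f1" using up[OF l'] by (intro mult_right_mono fA_nonneg) simp
        moreover have "1 * fB f f1 f2 \<le> (2 * l + 1) * fB f f1 f2" using l by (intro mult_right_mono fB_nonneg) simp
        ultimately show "(l + l') * fA f f1 + fB f f1 f2 \<le> (2 * l + 1) * (fA f f1 + fB f f1 f2)" by (simp add: distrib_left)
      qed (use d in simp)
      also have "\<dots> \<le> \<delta> * ((2 * l + 1) * (K * N))"
        using d l K(2)[OF f(1)] fA_nonneg[of f f1] fB_nonneg[of f f1 f2] unfolding N_def[symmetric]
        by (intro mult_mono mult_left_mono) auto
      also have "\<dots> = c * N" using K l by (simp add: \<delta>_def)
      also have "\<dots> \<le> cf.Q f f1 f2" using c(2)[OF f(1)] by (simp add: N_def)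
      finally show False using f(2) by simp
    qed
    then have "l \<le> l - \<delta>" unfolding l_def using cSup_least[OF assms] by blast
    then show False using \<delta> by simp
  qed
  then show thesis using that l by blast
qed

text \<open>The divided coefficients are smooth because l \<mu> is a positive constant, so the
  solution is smooth. Multiplying the system back by l \<mu> and expanding the divergence terms
  recovers the equation; the clamped conditions give membership in \<open>H0 2\<close>.\<close>

lemma solution_bvp:
  assumes l: "0 < l" and s: "clamped_form.solution (l * \<mu>) (P l) (P' l) (R l) (\<lambda>x. 0) y1 y2 y3 y4"
  shows "y1 \<in> Cinf_I" "y1 \<in> H0 2" "bvp_solution g \<mu> \<sigma> k \<rho> (complex_of_real l) y1"
proof -
  interpret cf: clamped_form "l * \<mu>" "P l" "P' l" "R l" by (rule clamped_form[OF l])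
  have e: "0 < l * \<mu>" using cf.e .
  have o: "ode4 (\<lambda>x. - R l x / (l * \<mu>)) (\<lambda>x. P' l x / (l * \<mu>)) (\<lambda>x. P l x / (l * \<mu>)) (\<lambda>x. 0) y1 y2 y3 y4"
    and b: "y1 0 = 0" "y2 0 = 0" "y1 1 = 0" "y2 1 = 0" using s by (auto simp: cf.solution_def)
  have "(\<lambda>x. - (1 / (l * \<mu>)) * R l x) \<in> Cinf_I" "(\<lambda>x. (1 / (l * \<mu>)) * P' l x) \<in> Cinf_I" "(\<lambda>x. (1 / (l * \<mu>)) * P l x) \<in> Cinf_I"
    by (intro Cinf_I_closed Cinf_I_const smooth)+
  then have sm: "(\<lambda>x. - R l x / (l * \<mu>)) \<in> Cinf_I" "(\<lambda>x. P' l x / (l * \<mu>)) \<in> Cinf_I" "(\<lambda>x. P l x / (l * \<mu>)) \<in> Cinf_I"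
    by (simp_all add: field_simps)
  show y1: "y1 \<in> Cinf_I" by (rule ode4_smooth[OF o sm])
  note od = ode4D[OF o]
  have D1: "D y1 x = y2 x" if "x \<in> {0..1}" for x by (rule D_eq[OF od(1)[OF that] that])
  have D2: "D (D y1) x = y3 x" if "x \<in> {0..1}" for x
    using D_cong[OF D1 that] D_eq[OF od(2)[OF that] that] by simp
  have D3: "D (D (D y1)) x = y4 x" if "x \<in> {0..1}" for x
    using D_cong[OF D2 that] D_eq[OF od(3)[OF that] that] by simp
  have D4: "D (D (D (D y1))) x = - R l x / (l * \<mu>) * y1 x + P' l x / (l * \<mu>) * y2 x + P l x / (l * \<mu>) * y3 x" if "x \<in> {0..1}" for x
    using D_cong[OF D3 that] D_eq[OF od(4)[OF that] that] by simp
  show "y1 \<in> H0 2" by (rule clamped_in_H0[OF y1]) (use b D1 in auto)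
  show "bvp_solution g \<mu> \<sigma> k \<rho> (complex_of_real l) y1"
    unfolding bvp_solution_def
  proof (intro conjI ballI)
    show "y1 \<in> Ck_I 4" using y1 by (simp add: Cinf_I_def)
    show "y1 0 = 0" "D y1 0 = 0" "y1 1 = 0" "D y1 1 = 0" using b D1 by auto
    fix x :: real assume "x \<in> I01"
    then have x: "x \<in> {0..1}" by auto
    have d\<rho>: "(\<rho> has_real_derivative r x) (at x within {0..1})" "(r has_real_derivative D r x) (at x within {0..1})"
      using Cinf_I_D(3)[OF \<rho>(1) x, of 0] Cinf_I_D(3)[OF \<rho>(1) x, of 1] by simp_all
    have e1: "D (\<lambda>y. \<rho> y * D y1 y) x = r x * y2 x + \<rho> x * y3 x"
    proof -
      have "D (\<lambda>y. \<rho> y * D y1 y) x = D (\<lambda>y. \<rho> y * y2 y) x" by (rule D_cong[OF _ x]) (simp add: D1)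
      also have "\<dots> = r x * y2 x + \<rho> x * y3 x"
        by (rule D_eq[OF DERIV_cong[OF DERIV_mult[OF d\<rho>(1) od(2)[OF x]]] x]) simp
      finally show ?thesis .
    qed
    have e2: "D (\<lambda>y. (r y)\<^sup>2 * D y1 y) x = 2 * r x * D r x * y2 x + (r x)\<^sup>2 * y3 x"
    proof -
      have "D (\<lambda>y. (r y)\<^sup>2 * D y1 y) x = D (\<lambda>y. (r y * r y) * y2 y) x" by (rule D_cong[OF _ x]) (simp add: D1 power2_eq_square)
      also have "\<dots> = 2 * r x * D r x * y2 x + (r x)\<^sup>2 * y3 x"
        by (rule D_eq[OF DERIV_cong[OF DERIV_mult[OF DERIV_mult[OF d\<rho>(2) d\<rho>(2)] od(2)[OF x]]] x]) (simp add: power2_eq_square algebra_simps)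
      finally show ?thesis .
    qed
    have e4: "l * (\<mu> * (D ^^ 4) y1 x) = - R l x * y1 x + P' l x * y2 x + P l x * y3 x"
    proof -
      have "l * (\<mu> * (D ^^ 4) y1 x) = (l * \<mu>) * (- R l x / (l * \<mu>) * y1 x + P' l x / (l * \<mu>) * y2 x + P l x / (l * \<mu>) * y3 x)"
        using D4[OF x] by (simp add: eval_nat_numeral)
      also have "\<dots> = - R l x * y1 x + P' l x * y2 x + P l x * y3 x"
      proof -
        have "E * (p / E * y + q / E * z + w / E * v) = p * y + q * z + w * v" if "0 < E" for E p q w y z v :: real
          using that by (simp add: field_simps)
        from this[OF e] show ?thesis .
      qed
      finally show ?thesis .
    qed
    have "l\<^sup>2 * (k\<^sup>2 * \<rho> x * y1 x - D (\<lambda>y. \<rho> y * D y1 y) x)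
        + l * (\<mu> * ((D ^^ 4) y1 x - 2 * k\<^sup>2 * (D ^^ 2) y1 x + k ^ 4 * y1 x))
      = l\<^sup>2 * (k\<^sup>2 * \<rho> x * y1 x - (r x * y2 x + \<rho> x * y3 x))
        + l * (\<mu> * (D ^^ 4) y1 x) - l * \<mu> * (2 * k\<^sup>2 * y3 x) + l * \<mu> * k ^ 4 * y1 x"
      unfolding e1 using D2[OF x] by (simp add: numeral_2_eq_2 algebra_simps)
    also have "\<dots> = g * k\<^sup>2 * r x * y1 x + \<sigma> * k\<^sup>2 * (2 * r x * D r x * y2 x + (r x)\<^sup>2 * y3 x) - \<sigma> * k ^ 4 * (r x)\<^sup>2 * y1 x"
      unfolding e4 R_def P_def P'_def by (simp add: algebra_simps power2_eq_square power4_eq_xxxx)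
    finally have eq: "l\<^sup>2 * (k\<^sup>2 * \<rho> x * y1 x - D (\<lambda>y. \<rho> y * D y1 y) x)
        + l * (\<mu> * ((D ^^ 4) y1 x - 2 * k\<^sup>2 * (D ^^ 2) y1 x + k ^ 4 * y1 x))
      = g * k\<^sup>2 * r x * y1 x + \<sigma> * k\<^sup>2 * D (\<lambda>y. (r y)\<^sup>2 * D y1 y) x - \<sigma> * k ^ 4 * (r x)\<^sup>2 * y1 x"
      unfolding e2 .
    show "(complex_of_real l)\<^sup>2 * complex_of_real (k\<^sup>2 * \<rho> x * y1 x - D (\<lambda>y. \<rho> y * D y1 y) x)
        + complex_of_real l * complex_of_real (\<mu> * ((D ^^ 4) y1 x - 2 * k\<^sup>2 * (D ^^ 2) y1 x + k ^ 4 * y1 x))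
        = complex_of_real (g * k\<^sup>2 * D \<rho> x * y1 x
            + \<sigma> * k\<^sup>2 * D (\<lambda>y. (D \<rho> y)\<^sup>2 * D y1 y) x
            - \<sigma> * k ^ 4 * (D \<rho> x)\<^sup>2 * y1 x)"
      unfolding eq[symmetric] by (simp only: of_real_add of_real_mult of_real_power)
  qed
qed

end

lemma INF_le_I:
  fixes f :: "real \<Rightarrow> real"
  assumes "continuous_on {0..1} f" "x \<in> {0..1}"
  shows "(INF x\<in>{0..1}. f x) \<le> f x"
proof (rule cINF_lower[OF _ assms(2)])
  show "bdd_below (f ` {0..1})"
    by (intro bounded_imp_bdd_below compact_imp_bounded compact_continuous_image assms compact_Icc)
qed

theorem theorem2p1:
  fixes \<rho>\<^sub>0 :: "real \<Rightarrow> real" and g \<mu> k :: real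
  assumes "\<rho>\<^sub>0 \<in> Cinf_I"
    and "(INF x\<in>{0..1}. \<rho>\<^sub>0 x) > 0"
    and "(INF x\<in>{0..1}. D \<rho>\<^sub>0 x) > 0"
    and "g > 0" and "\<mu> > 0" and "k > 0"
  shows "0 < sigma_c_at g \<rho>\<^sub>0 k \<and> sigma_c_at g \<rho>\<^sub>0 k < sigma_c g \<rho>\<^sub>0 \<and>
    (\<forall>\<sigma>::real. 0 < \<sigma> \<and> ereal \<sigma> < sigma_c_at g \<rho>\<^sub>0 k \<longrightarrow>
      (\<exists>(N::nat) (lam::nat \<Rightarrow> real). N \<ge> 1 \<and>
        (\<forall>j\<in>{1..N}. characteristic_value g \<mu> \<sigma> k \<rho>\<^sub>0 (complex_of_real (lam j))) \<and>
        (\<forall>j\<in>{1..N}. lam j > 0) \<and>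
        (\<forall>i\<in>{1..N}. \<forall>j\<in>{1..N}. i < j \<longrightarrow> lam i > lam j) \<and>
        (\<forall>j\<in>{1..N}. \<exists>\<phi>. nontrivial \<phi> \<and> \<phi> \<in> Cinf_I \<and>
           \<phi> \<in> H0 2 \<inter> (\<Inter>s\<in>{0..}. H s) \<and>
           bvp_solution g \<mu> \<sigma> k \<rho>\<^sub>0 (complex_of_real (lam j)) \<phi>)))"
proof -
  define a where "a = (INF x\<in>{0..1}. \<rho>\<^sub>0 x)"
  define m where "m = (INF x\<in>{0..1}. D \<rho>\<^sub>0 x)"
  have c: "continuous_on {0..1} \<rho>\<^sub>0" "continuous_on {0..1} (D \<rho>\<^sub>0)"
    using assms(1) Cinf_I_D(1) Cinf_I_continuous by blast+
  have am: "0 < a" "0 < m" "\<And>x. x \<in> {0..1} \<Longrightarrow> a \<le> \<rho>\<^sub>0 x" "\<And>x. x \<in> {0..1} \<Longrightarrow> m \<le> D \<rho>\<^sub>0 x"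
    using assms INF_le_I[OF c(1)] INF_le_I[OF c(2)] by (auto simp: a_def m_def)
  interpret dp: density_profile "D \<rho>\<^sub>0" m g k
    by unfold_locales (use c am assms in auto)
  have sc: "sigma_c g \<rho>\<^sub>0 = (SUP \<theta>\<in>H01_nonzero. ereal (dp.num \<theta> / dp.den \<theta>))"
    "sigma_c_at g \<rho>\<^sub>0 k = (SUP \<theta>\<in>H01_nonzero. ereal (dp.num \<theta> / dp.denk \<theta>))"
    by (simp_all add: sigma_c_def sigma_c_at_def dp.num_def dp.den_def dp.denk_def)
  have sol: "\<exists>l \<phi>. 0 < l \<and> nontrivial \<phi> \<and> \<phi> \<in> Cinf_I \<and> \<phi> \<in> H0 2 \<and> bvp_solution g \<mu> \<sigma> k \<rho>\<^sub>0 (complex_of_real l) \<phi>"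
    if \<sigma>: "0 < \<sigma>" "ereal \<sigma> < sigma_c_at g \<rho>\<^sub>0 k" for \<sigma>
  proof -
    interpret sf: stratified_fluid \<rho>\<^sub>0 g \<mu> k \<sigma> a m
      by unfold_locales (use am assms \<sigma> in auto)
    obtain \<psi> where \<psi>: "\<psi> \<in> test_fun" "0 < (LINT x|leb_I. (g * D \<rho>\<^sub>0 x - \<sigma> * k\<^sup>2 * (D \<rho>\<^sub>0 x)\<^sup>2) * (\<psi> x)\<^sup>2)
       - (LINT x|leb_I. \<sigma> * (D \<rho>\<^sub>0 x)\<^sup>2 * (deriv \<psi> x)\<^sup>2)"
      using dp.unstable_test_fun[OF \<sigma>(1) \<sigma>(2)[unfolded sc]] by blast
    have "0 < sf.fC \<psi> (deriv \<psi>)" unfolding sf.fC_def using \<psi>(2) assms by (intro mult_pos_pos) auto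
    from sf.exists_solution[OF sf.unstable_nonempty[OF test_fun_clamped[OF \<psi>(1)] this]]
    obtain l y1 y2 y3 y4 x where l: "0 < l" and s: "clamped_form.solution (l * \<mu>) (sf.P l) (sf.P' l) (sf.R l) (\<lambda>x. 0) y1 y2 y3 y4"
      and x: "x \<in> I01" "y1 x \<noteq> 0" by blast
    have "nontrivial y1" using x by (auto simp: nontrivial_def)
    then show ?thesis using sf.solution_bvp[OF l s] l by blast
  qed
  have ex: "\<exists>(N::nat) (lam::nat \<Rightarrow> real). N \<ge> 1 \<and>
        (\<forall>j\<in>{1..N}. characteristic_value g \<mu> \<sigma> k \<rho>\<^sub>0 (complex_of_real (lam j))) \<and>
        (\<forall>j\<in>{1..N}. lam j > 0) \<and>
        (\<forall>i\<in>{1..N}. \<forall>j\<in>{1..N}. i < j \<longrightarrow> lam i > lam j) \<and>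
        (\<forall>j\<in>{1..N}. \<exists>\<phi>. nontrivial \<phi> \<and> \<phi> \<in> Cinf_I \<and>
           \<phi> \<in> H0 2 \<inter> (\<Inter>s\<in>{0..}. H s) \<and>
           bvp_solution g \<mu> \<sigma> k \<rho>\<^sub>0 (complex_of_real (lam j)) \<phi>)"
    if \<sigma>: "0 < \<sigma>" "ereal \<sigma> < sigma_c_at g \<rho>\<^sub>0 k" for \<sigma>
  proof -
    obtain l \<phi> where l: "0 < l" and \<phi>: "nontrivial \<phi>" "\<phi> \<in> Cinf_I" "\<phi> \<in> H0 2" "bvp_solution g \<mu> \<sigma> k \<rho>\<^sub>0 (complex_of_real l) \<phi>"
      using sol[OF \<sigma>] by blast
    have "characteristic_value g \<mu> \<sigma> k \<rho>\<^sub>0 (complex_of_real l)"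
      unfolding characteristic_value_def using l \<phi> by auto
    then show ?thesis
      \<comment> \<open>For a single value the ordering condition is vacuous, and smoothness puts
        the eigenfunction in every \<open>H s\<close>.\<close>
      by (intro exI[of _ 1] exI[of _ "\<lambda>_. l"]) (use l \<phi> Cinf_I_in_H[OF \<phi>(2)] in auto)
  qed
  show ?thesis using dp.sup_strict ex unfolding sc by blast
qed

end
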